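(* For every $\varepsilon>0$ there exists a (large enough) number $v\ge 1$, depending only on $\varepsilon$ (and not on $N$ or $\nu$), such that for every integer $N\ge 1$ and every probability measure $\nu$ on the unit sphere $S=\{z\in\mathbb{R}^N:|z|=1\}$, with $g$ the random function with parameter $v$ and $\nu_g$ the corresponding random probability measure defined in the context, $$\mathbb{E}\,\nu_g^{\otimes 2}\bigl\{(z^1,z^2)\in S^2 : z^1\cdot z^2\le -\varepsilon\bigr\}\le \varepsilon .$$
   Context: Let $S=\{z\in\mathbb{R}^N:|z|=1\}$ be the Euclidean unit sphere and $z^1\cdot z^2$ the usual scalar product. For a (Borel) probability measure $\nu$ on $S$ and a measurable $g:S\to\mathbb{R}$ with $\int e^{g}\,d\nu<\infty$, the probability measure $\nu_g$ on $S$ is defined by the density $$\frac{d\nu_g}{d\nu}(z)=\frac{e^{g(z)}}{\int e^{g(z')}\,d\nu(z')}.$$ Here $g$ is the random function, depending on a parameter $v\ge 0$, $$g(z)=v\sum_{p\ge 1}2^{-p}x_p\,g_p(z),\qquad g_p(z)=\sum_{1\le i_1,\ldots,i_p\le N} g_{i_1,\ldots,i_p}\,z_{i_1}\cdots z_{i_p},$$ where $(x_p)_{p\ge 1}$ are i.i.d. uniform on $[0,1]$ and $g_{i_1,\ldots,i_p}$ (for all $p\ge 1$ and all $1\le i_1,\ldots,i_p\le N$) are i.i.d. standard Gaussian random variables, independent of $(x_p)_{p\ge1}$. $\mathbb{E}$ denotes expectation over both the Gaussian variables and $(x_p)$; $\nu$ is non-random. It is assumed that the normalizing integral is finite, so that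 $\nu_g$ is well defined. $\nu_g^{\otimes 2}$ is the product measure of $\nu_g$ with itself. *)

theory Defs
  imports "HOL-Probability.Probability"
begin

text \<open>
  The dimension \<open>N\<close> is quantified inside the theorem, so points of $\mathbb{R}^N$ are functions on
  \<open>{1..N}\<close>, extended by \<open>undefined\<close> as usual for \<^const>\<open>PiM\<close>. On this carrier the finite product
  of the Borel \<open>\<sigma>\<close>-algebras is the Borel \<open>\<sigma>\<close>-algebra of $\mathbb{R}^N$. Only the \<open>\<sigma>\<close>-algebra and
  the carrier of \<open>unit_sphere N\<close> matter, not its measure.
\<close>

definition unit_sphere :: "nat \<Rightarrow> (nat \<Rightarrow> real) measure" where
  "unit_sphere N = restrict_space (PiM {1..N} (\<lambda>_. borel)) {z. L2_set z {1..N} = 1}"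

definition scalar_prod :: "nat \<Rightarrow> (nat \<Rightarrow> real) \<Rightarrow> (nat \<Rightarrow> real) \<Rightarrow> real" where
  "scalar_prod N z1 z2 = (\<Sum>i\<in>{1..N}. z1 i * z2 i)"

text \<open>
  A multi-index $(i_1,\ldots,i_p)$ is a list of length \<open>p\<close>; the list determines \<open>p\<close>, so the
  Gaussian variables of all orders form one family indexed by nonempty lists over \<open>{1..N}\<close>.
\<close>

definition multi_indices :: "nat \<Rightarrow> nat \<Rightarrow> nat list set" where
  "multi_indices N p = {is. length is = p \<and> set is \<subseteq> {1..N}}"

text \<open>
  The joint law of the two independent i.i.d. families \<open>(x_p)\<close> and \<open>(g_{i_1,...,i_p})\<close>,
  realised on the canonical product space. Integration against it is the expectation $\mathbb{E}$.
\<close>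

definition disorder :: "nat \<Rightarrow> ((nat \<Rightarrow> real) \<times> (nat list \<Rightarrow> real)) measure" where
  "disorder N =
     PiM {1..} (\<lambda>_. uniform_measure lborel {0..1})
     \<Otimes>\<^sub>M PiM (\<Union>p\<in>{1..}. multi_indices N p) (\<lambda>_. density lborel std_normal_density)"

definition homogeneous_part ::
    "nat \<Rightarrow> nat \<Rightarrow> (nat list \<Rightarrow> real) \<Rightarrow> (nat \<Rightarrow> real) \<Rightarrow> real" where
  "homogeneous_part N p G z = (\<Sum>is\<in>multi_indices N p. G is * (\<Prod>i\<leftarrow>is. z i))"

text \<open>The series starts at \<open>p = 1\<close>, hence the shift by \<^const>\<open>Suc\<close>.\<close>

definition random_fun ::
    "real \<Rightarrow> nat \<Rightarrow> (nat \<Rightarrow> real) \<times> (nat list \<Rightarrow> real) \<Rightarrow> (nat \<Rightarrow> real) \<Rightarrow> real" where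
  "random_fun v N \<omega> z =
     v * (\<Sum>p. (1 / 2) ^ Suc p * fst \<omega> (Suc p) * homogeneous_part N (Suc p) (snd \<omega>) z)"

definition tilted_measure :: "'a measure \<Rightarrow> ('a \<Rightarrow> real) \<Rightarrow> 'a measure" where
  "tilted_measure \<nu> g = density \<nu> (\<lambda>z. ennreal (exp (g z) / (\<integral>z'. exp (g z') \<partial>\<nu>)))"

end

theory Submission
  imports Defs "HOL-Real_Asymp.Real_Asymp"
begin

text \<open>
  Write \<open>R\<close> for the scalar product of two points, the overlap, and call independent draws from
  the same random measure \<open>\<nu>\<^sub>g\<close> replicas. If \<open>m\<close> unit vectors have all pairwise overlaps at most
  \<open>- \<epsilon> / 2\<close>, their sum has squared norm at most \<open>m - m * (m - 1) * \<epsilon> / 2\<close>, which is negative once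
  \<open>m > 1 + 2 / \<epsilon>\<close>. It therefore suffices to show that if two replicas have overlap at most \<open>- \<epsilon>\<close>
  with non-negligible probability, then with positive probability all pairs among \<open>m\<close> replicas have
  overlap at most \<open>- \<epsilon> / 2\<close>.

  What propagates negativity from \<open>n\<close> to \<open>n + 1\<close> replicas is Gaussian integration by parts. Let
  \<open>b\<^sub>p = v * 2 powr (- p) * x\<^sub>p\<close> be the strength of the degree-\<open>p\<close> part \<open>g\<^sub>p\<close>, take a polynomial
  \<open>\<psi>\<close> with coefficients \<open>c\<^sub>p\<close> and put \<open>u = (\<Sum>p. (c\<^sub>p / b\<^sub>p) * g\<^sub>p)\<close> and \<open>U = \<integral> u d\<nu>\<^sub>g\<close>. Since \<open>g\<^sub>p\<close> has
  covariance \<open>R ^ p\<close>, integrating \<open>u (z\<^sub>1)\<close> by parts against a function \<open>f\<close> of \<open>n\<close> replicas produces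
  \<open>\<Sum>l\<le>n. \<psi> (R z\<^sub>1 z\<^sub>l)\<close> minus \<open>n\<close> times \<open>\<psi> (R z\<^sub>1 z)\<close> for a fresh replica \<open>z\<close>. If \<open>v\<close> is large, \<open>u\<close> is nearly
  constant under \<open>\<nu>\<^sub>g\<close>, so the same quantity is also close to \<open>U\<close> times the average of \<open>f\<close>. This is a
  Ghirlanda-Guerra identity in which the random variable \<open>U\<close> stands where an expectation usually does.
  To make use of it, the identity is multiplied by a smooth weight \<open>h U\<close> before integrating by parts
  (\<open>weighted_ghirlanda_guerra\<close>); the derivative of the weight costs only a term that the size of the
  fluctuations of \<open>u\<close> controls as well. So \<open>U\<close> acts as a label of the disorder on which one may
  condition.

  Let \<open>\<psi>\<close> approximate the indicator of overlaps above a level \<open>\<beta> < 0\<close>. The label \<open>y = 1 - \<psi> 1 + U\<close> is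
  then the approximate conditional probability of an overlap below that level, and, if all pairs among
  \<open>n\<close> replicas lie below it, the identity says that a further replica keeps this property with
  conditional probability at least \<open>y\<close>. Weighting with a soft indicator of \<open>y \<ge> \<delta>\<close> gives by induction a
  lower bound \<open>\<delta> ^ (m - 1)\<close> times the total weight, up to errors, for an event that is empty. So the
  total weight is small, \<open>y\<close> is mostly below \<open>\<delta>\<close>, and negative overlaps have probability about \<open>\<delta>\<close>
  (\<open>negative_overlap_bound\<close>). The argument needs overlaps to avoid the short interval in which \<open>\<psi>\<close> rises
  from 0 to 1; among many disjoint candidates for this interval one has small probability
  (\<open>fixed_strength_bound\<close>).

  That \<open>u\<close> hardly fluctuates under \<open>\<nu>\<^sub>g\<close> holds on average over the uniform variables \<open>x\<^sub>p\<close>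
  (\<open>thermal_fluctuations\<close>): the variance of \<open>g\<^sub>p\<close> is the derivative of its mean in \<open>b\<^sub>p\<close>, and the
  expectation of that mean lies between 0 and \<open>b\<^sub>p\<close>, so the variance is of order one on
  average, while \<open>u\<close> carries the factor \<open>1 / b\<^sub>p\<close>.

  Only degrees up to some \<open>d\<close> depending on \<open>\<epsilon>\<close> enter. Conditionally on all variables of higher degree,
  the tail of the series is a fixed function, which can be absorbed into \<open>\<nu>\<close>
  (\<open>annealed_reduction\<close>). This leaves a finite Gaussian vector and an arbitrary probability measure on
  the sphere, and estimates in which neither the measure nor \<open>N\<close> appears (\<open>finite_disorder_bound\<close>).
\<close>

section \<open>Gaussian integration by parts\<close>

abbreviation std_gauss :: "real measure" where
  "std_gauss \<equiv> density lborel std_normal_density"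

abbreviation gauss :: "'i set \<Rightarrow> ('i \<Rightarrow> real) measure" where
  "gauss I \<equiv> PiM I (\<lambda>_. std_gauss)"

lemma prob_space_std_gauss: "prob_space std_gauss"
  by (rule prob_space_normal_density) simp

lemma prob_space_gauss: "prob_space (gauss I)"
  by (intro prob_space_PiM prob_space_std_gauss)

lemma integrable_std_gauss_abs: "integrable std_gauss (\<lambda>t. \<bar>t\<bar>)"
  using integrable_std_normal_moment_abs[of 1] by (subst integrable_density) (auto simp: mult.commute)

lemma gauss_component_distr:
  "i \<in> I \<Longrightarrow> distr (gauss I) std_gauss (\<lambda>G. G i) = std_gauss"
  by (intro distr_PiM_component prob_space_std_gauss)

lemma integrable_gauss_component:
  assumes "i \<in> I" shows "integrable (gauss I) (\<lambda>G. \<bar>G i\<bar>)"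
proof -
  have "integrable (distr (gauss I) std_gauss (\<lambda>G. G i)) (\<lambda>t. \<bar>t\<bar>)"
    unfolding gauss_component_distr[OF assms] by (rule integrable_std_gauss_abs)
  then show ?thesis
    by (subst (asm) integrable_distr_eq) (use assms in measurable)
qed

text \<open>
  The product of \<open>F\<close> with the density is an antiderivative of the difference of the two integrands, and it
  vanishes at infinity. Linear growth of \<open>F'\<close> is allowed because the derivatives to which this is applied
  contain averages of the Hamiltonian, which are linear in the Gaussian variables.
\<close>

lemma std_gauss_ibp:
  fixes F F' :: "real \<Rightarrow> real"
  assumes deriv: "\<And>t. (F has_real_derivative F' t) (at t)"
    and F: "\<And>t. \<bar>F t\<bar> \<le> B" and F': "\<And>t. \<bar>F' t\<bar> \<le> C0 + C1 * \<bar>t\<bar>"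
    and [measurable]: "F' \<in> borel_measurable borel"
  shows "(\<integral>t. t * F t \<partial>std_gauss) = (\<integral>t. F' t \<partial>std_gauss)"
proof -
  let ?\<phi> = std_normal_density
  have Fm[measurable]: "F \<in> borel_measurable borel"
    by (intro borel_measurable_continuous_onI continuous_at_imp_continuous_on)
       (use deriv DERIV_isCont in blast)
  have i0: "integrable lborel ?\<phi>" using integrable_std_normal_moment[of 0] by simp
  have i1: "integrable lborel (\<lambda>t. ?\<phi> t * \<bar>t\<bar>)" using integrable_std_normal_moment_abs[of 1] by simp
  have iF': "integrable lborel (\<lambda>t. ?\<phi> t * F' t)"
  proof (rule Bochner_Integration.integrable_bound)
    show "integrable lborel (\<lambda>t. ?\<phi> t * (\<bar>C0\<bar> + \<bar>C1\<bar> * \<bar>t\<bar>))"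
    proof -
      have "integrable lborel (\<lambda>t. \<bar>C0\<bar> * ?\<phi> t + \<bar>C1\<bar> * (?\<phi> t * \<bar>t\<bar>))"
        using i0 i1 by (intro Bochner_Integration.integrable_add integrable_mult_right)
      then show ?thesis by (simp add: algebra_simps)
    qed
    show "AE t in lborel. norm (?\<phi> t * F' t) \<le> norm (?\<phi> t * (\<bar>C0\<bar> + \<bar>C1\<bar> * \<bar>t\<bar>))"
    proof (intro AE_I2)
      fix t :: real
      have "\<bar>F' t\<bar> \<le> \<bar>C0\<bar> + \<bar>C1\<bar> * \<bar>t\<bar>"
        using F'[of t] by (smt (verit) abs_ge_zero mult_right_mono)
      then show "norm (?\<phi> t * F' t) \<le> norm (?\<phi> t * (\<bar>C0\<bar> + \<bar>C1\<bar> * \<bar>t\<bar>))"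
        by (simp add: abs_mult mult_left_mono)
    qed
  qed simp
  have iF: "integrable lborel (\<lambda>t. ?\<phi> t * (t * F t))"
  proof (rule Bochner_Integration.integrable_bound)
    show "integrable lborel (\<lambda>t. B * (?\<phi> t * \<bar>t\<bar>))"
      using i1 by (intro integrable_mult_right)
    show "AE t in lborel. norm (?\<phi> t * (t * F t)) \<le> norm (B * (?\<phi> t * \<bar>t\<bar>))"
    proof (intro AE_I2)
      fix t :: real
      have "\<bar>t\<bar> * \<bar>F t\<bar> \<le> \<bar>t\<bar> * \<bar>B\<bar>" using F[of t] by (intro mult_left_mono) auto
      then have "?\<phi> t * (\<bar>t\<bar> * \<bar>F t\<bar>) \<le> ?\<phi> t * (\<bar>t\<bar> * \<bar>B\<bar>)" by (rule mult_left_mono) auto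
      then show "norm (?\<phi> t * (t * F t)) \<le> norm (B * (?\<phi> t * \<bar>t\<bar>))"
        by (simp add: abs_mult mult_ac)
    qed
  qed simp
  define W where "W = (\<lambda>t. ?\<phi> t * F t)"
  define f where "f = (\<lambda>t. ?\<phi> t * F' t - ?\<phi> t * (t * F t))"
  have d\<phi>: "(?\<phi> has_real_derivative (- t * ?\<phi> t)) (at t)" for t
    unfolding normal_density_def by (auto intro!: derivative_eq_intros simp: field_simps)
  have dW: "(W has_real_derivative f t) (at t)" for t
    unfolding W_def f_def
    by (rule derivative_eq_intros d\<phi> deriv refl)+ (simp add: algebra_simps)
  have intf: "integrable lborel f" unfolding f_def using iF iF' by auto
  have fin: "(LINT t:{- real n..real n}|lborel. f t) = W (real n) - W (- real n)" for n
  proof -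
    have "(f has_integral W (real n) - W (- real n)) {- real n..real n}"
      by (intro fundamental_theorem_of_calculus)
         (auto simp: has_real_derivative_iff_has_vector_derivative[symmetric] intro: DERIV_subset dW)
    moreover have "set_integrable lborel {- real n..real n} f"
      unfolding set_integrable_def by (intro integrable_mult_indicator intf) auto
    ultimately show ?thesis
      using has_integral_set_lebesgue[of "{- real n..real n}" f] set_borel_integral_eq_integral
      by (metis integral_unique)
  qed
  have "(\<lambda>n. LINT t:{- real n..real n}|lborel. f t) \<longlonglongrightarrow> (LINT t|lborel. f t)"
    unfolding set_lebesgue_integral_def
  proof (rule integral_dominated_convergence[where w="\<lambda>t. norm (f t)"])
    show "AE t in lborel. (\<lambda>n. indicator {- real n..real n} t *\<^sub>R f t) \<longlonglongrightarrow> f t"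
    proof (intro AE_I2 tendsto_eventually)
      fix t :: real
      obtain N where N: "\<bar>t\<bar> \<le> real N" using real_arch_simple by blast
      show "\<forall>\<^sub>F n in sequentially. indicator {- real n..real n} t *\<^sub>R f t = f t"
        using eventually_ge_at_top[of N]
      proof eventually_elim
        case (elim n)
        then have "t \<in> {- real n..real n}" using N by auto
        then show ?case by simp
      qed
    qed
  qed (use intf in \<open>auto split: split_indicator\<close>)
  moreover have "(\<lambda>n. W (real n) - W (- real n)) \<longlonglongrightarrow> 0 - 0"
  proof (rule tendsto_diff)
    have lim: "(\<lambda>n. ?\<phi> (real n) * B) \<longlonglongrightarrow> 0"
    proof -
      have "((\<lambda>t. 1 / sqrt (2 * pi) * exp (- t\<^sup>2 / 2) * B) \<longlongrightarrow> 0) at_top"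
        by real_asymp
      then have "((\<lambda>t. ?\<phi> t * B) \<longlongrightarrow> 0) at_top" by (simp add: normal_density_def)
      then show ?thesis using filterlim_real_sequentially by (rule filterlim_compose)
    qed
    have sym: "?\<phi> (- t) = ?\<phi> t" for t by (simp add: normal_density_def)
    show "(\<lambda>n. W (real n)) \<longlonglongrightarrow> 0"
      by (rule Lim_null_comparison[OF _ lim]) 
         (auto simp: W_def abs_mult intro!: always_eventually mult_left_mono F)
    show "(\<lambda>n. W (- real n)) \<longlonglongrightarrow> 0"
      by (rule Lim_null_comparison[OF _ lim]) 
         (auto simp: W_def abs_mult sym intro!: always_eventually mult_left_mono F)
  qed
  ultimately have "(LINT t|lborel. f t) = 0"
    unfolding fin by (metis LIMSEQ_unique diff_0_right)
  then have "(LINT t|lborel. ?\<phi> t * F' t) = (LINT t|lborel. ?\<phi> t * (t * F t))"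
    unfolding f_def using iF iF' by simp
  then show ?thesis by (simp add: integral_density)
qed

lemma gauss_ibp:
  fixes F F' :: "('i \<Rightarrow> real) \<Rightarrow> real"
  assumes I: "finite I" "i \<in> I"
    and [measurable]: "F \<in> borel_measurable (gauss I)" "F' \<in> borel_measurable (gauss I)"
    and deriv: "\<And>G t. G \<in> space (gauss I) \<Longrightarrow>
      ((\<lambda>t. F (G(i := t))) has_real_derivative F' (G(i := t))) (at t)"
    and F: "\<And>G. G \<in> space (gauss I) \<Longrightarrow> \<bar>F G\<bar> \<le> B"
    and F': "\<And>G. G \<in> space (gauss I) \<Longrightarrow> \<bar>F' G\<bar> \<le> C0 + C1 * (\<Sum>j\<in>I. \<bar>G j\<bar>)"
  shows "integrable (gauss I) (\<lambda>G. G i * F G)" (is ?A)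
    and "integrable (gauss I) F'" (is ?B)
    and "(\<integral>G. G i * F G \<partial>gauss I) = (\<integral>G. F' G \<partial>gauss I)" (is ?C)
proof -
  interpret g: prob_space std_gauss by (rule prob_space_std_gauss)
  interpret G: prob_space "gauss I" by (rule prob_space_gauss)
  interpret P: product_sigma_finite "\<lambda>_::'i. std_gauss"
    by standard
  have [measurable]: "(\<lambda>G. G j) \<in> borel_measurable (gauss I)" if "j \<in> I" for j
    using that by measurable
  have isum: "integrable (gauss I) (\<lambda>G. \<bar>C0\<bar> + \<bar>C1\<bar> * (\<Sum>j\<in>I. \<bar>G j\<bar>))"
    by (intro Bochner_Integration.integrable_add integrable_mult_right
        Bochner_Integration.integrable_sum integrable_gauss_component) auto
  show A: ?A
  proof (rule Bochner_Integration.integrable_bound)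
    show "integrable (gauss I) (\<lambda>G. B * \<bar>G i\<bar>)"
      using I by (intro integrable_mult_right integrable_gauss_component)
    show "AE G in gauss I. norm (G i * F G) \<le> norm (B * \<bar>G i\<bar>)"
    proof (intro AE_I2)
      fix G assume "G \<in> space (gauss I)"
      from F[OF this] have "\<bar>F G\<bar> * \<bar>G i\<bar> \<le> \<bar>B\<bar> * \<bar>G i\<bar>" by (intro mult_right_mono) auto
      then show "norm (G i * F G) \<le> norm (B * \<bar>G i\<bar>)" by (simp add: abs_mult mult.commute)
    qed
  qed (use I in measurable)
  show B: ?B
  proof (rule Bochner_Integration.integrable_bound[OF isum])
    show "AE G in gauss I. norm (F' G) \<le> norm (\<bar>C0\<bar> + \<bar>C1\<bar> * (\<Sum>j\<in>I. \<bar>G j\<bar>))"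
    proof (intro AE_I2)
      fix G assume "G \<in> space (gauss I)"
      from F'[OF this] show "norm (F' G) \<le> norm (\<bar>C0\<bar> + \<bar>C1\<bar> * (\<Sum>j\<in>I. \<bar>G j\<bar>))"
        by (smt (verit, ccfv_SIG) mult_right_mono real_norm_def sum_nonneg)
    qed
  qed simp
  define J where "J = I - {i}"
  have J: "finite J" "i \<notin> J" "I = insert i J" using I by (auto simp: J_def)
  have "(\<integral>G. G i * F G \<partial>gauss I) = (\<integral>G. (\<integral>t. t * F (G(i := t)) \<partial>std_gauss) \<partial>gauss J)"
    using P.product_integral_insert[OF J(1,2), of "\<lambda>G. G i * F G"] A unfolding J(3) by simp
  also have "\<dots> = (\<integral>G. (\<integral>t. F' (G(i := t)) \<partial>std_gauss) \<partial>gauss J)"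
  proof (rule Bochner_Integration.integral_cong[OF refl])
    fix G assume G: "G \<in> space (gauss J)"
    have Gt: "G(i := t) \<in> space (gauss I)" for t
      using G J(2) unfolding J(3) by (auto simp: space_PiM PiE_def extensional_def)
    have upd: "(\<lambda>t. G(i := t)) \<in> measurable std_gauss (gauss I)"
      using measurable_compose[OF measurable_Pair1'[OF G, of std_gauss] measurable_add_dim[of i J "\<lambda>_. std_gauss"]] J(3) by simp
    show "(\<integral>t. t * F (G(i := t)) \<partial>std_gauss) = (\<integral>t. F' (G(i := t)) \<partial>std_gauss)"
    proof (rule std_gauss_ibp)
      show "((\<lambda>t. F (G(i := t))) has_real_derivative F' (G(i := t))) (at t)" for t
        using deriv[OF Gt[of 0], of t] by simp
      show "\<bar>F (G(i := t))\<bar> \<le> B" for t by (rule F[OF Gt])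
      show "\<bar>F' (G(i := t))\<bar> \<le> (C0 + C1 * (\<Sum>j\<in>J. \<bar>G j\<bar>)) + C1 * \<bar>t\<bar>" for t
      proof -
        have "(\<Sum>j\<in>J. \<bar>(G(i := t)) j\<bar>) = (\<Sum>j\<in>J. \<bar>G j\<bar>)" using J by (intro sum.cong) auto
        then show ?thesis using F'[OF Gt[of t]] J by (simp add: algebra_simps)
      qed
      show "(\<lambda>t. F' (G(i := t))) \<in> borel_measurable borel"
        using measurable_compose[OF upd, of F' borel] by simp
    qed
  qed
  also have "\<dots> = (\<integral>G. F' G \<partial>gauss I)"
    using P.product_integral_insert[OF J(1,2), of F'] B unfolding J(3) by simp
  finally show ?C .
qed

section \<open>Exponentially tilted measures\<close>

text \<open>
  This class is closed under the ring operations and \<open>exp\<close>, and its members are integrable for every finite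
  measure on the same \<open>\<sigma>\<close>-algebra.
\<close>

definition bounded_measurable :: "'a measure \<Rightarrow> ('a \<Rightarrow> real) \<Rightarrow> bool" where
  "bounded_measurable M f \<longleftrightarrow> f \<in> borel_measurable M \<and> (\<exists>B. \<forall>z\<in>space M. \<bar>f z\<bar> \<le> B)"

lemma bounded_measurableI:
  "f \<in> borel_measurable M \<Longrightarrow> (\<And>z. z \<in> space M \<Longrightarrow> \<bar>f z\<bar> \<le> B) \<Longrightarrow> bounded_measurable M f"
  by (auto simp: bounded_measurable_def)

lemma bounded_measurableD [measurable_dest]:
  "bounded_measurable M f \<Longrightarrow> f \<in> borel_measurable M"
  by (simp add: bounded_measurable_def)

lemma bounded_measurableE:
  assumes "bounded_measurable M f"
  obtains B where "B \<ge> 0" "\<And>z. z \<in> space M \<Longrightarrow> \<bar>f z\<bar> \<le> B"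
  using assms unfolding bounded_measurable_def
  by (metis abs_ge_zero abs_ge_self order_trans)

lemma bounded_measurable_const [simp, intro!]: "bounded_measurable M (\<lambda>_. c)"
  by (rule bounded_measurableI[where B="\<bar>c\<bar>"]) auto

lemma bounded_measurable_add [intro!]:
  assumes "bounded_measurable M f" "bounded_measurable M g"
  shows "bounded_measurable M (\<lambda>z. f z + g z)"
proof -
  note [measurable] = assms[THEN bounded_measurableD]
  obtain B C where "\<And>z. z \<in> space M \<Longrightarrow> \<bar>f z\<bar> \<le> B" "\<And>z. z \<in> space M \<Longrightarrow> \<bar>g z\<bar> \<le> C"
    using assms by (metis bounded_measurableE)
  then show ?thesis by (intro bounded_measurableI[where B="B + C"]) (measurable, smt (verit))
qed

lemma bounded_measurable_mult [intro!]:
  assumes "bounded_measurable M f" "bounded_measurable M g"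
  shows "bounded_measurable M (\<lambda>z. f z * g z)"
proof -
  note [measurable] = assms[THEN bounded_measurableD]
  obtain B C where "B \<ge> 0" "\<And>z. z \<in> space M \<Longrightarrow> \<bar>f z\<bar> \<le> B" "\<And>z. z \<in> space M \<Longrightarrow> \<bar>g z\<bar> \<le> C"
    using assms by (metis bounded_measurableE)
  then show ?thesis
    by (intro bounded_measurableI[where B="B * C"]) (measurable, simp add: abs_mult mult_mono')
qed

lemma bounded_measurable_minus [intro!]:
  "bounded_measurable M f \<Longrightarrow> bounded_measurable M (\<lambda>z. - f z)"
  using bounded_measurable_mult[of M "\<lambda>_. -1" f] by simp

lemma bounded_measurable_diff [intro!]:
  "bounded_measurable M f \<Longrightarrow> bounded_measurable M g \<Longrightarrow> bounded_measurable M (\<lambda>z. f z - g z)"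
  using bounded_measurable_add[of M f "\<lambda>z. - g z"] bounded_measurable_minus[of M g] by simp

lemma bounded_measurable_sum [intro!]:
  "(\<And>i. i \<in> I \<Longrightarrow> bounded_measurable M (f i)) \<Longrightarrow> bounded_measurable M (\<lambda>z. \<Sum>i\<in>I. f i z)"
  by (induction I rule: infinite_finite_induct) auto

lemma bounded_measurable_abs [intro!]:
  "bounded_measurable M f \<Longrightarrow> bounded_measurable M (\<lambda>z. \<bar>f z\<bar>)"
  by (auto simp: bounded_measurable_def)

lemma bounded_measurable_power [intro!]:
  "bounded_measurable M f \<Longrightarrow> bounded_measurable M (\<lambda>z. f z ^ n)"
  by (induction n) auto

lemma bounded_measurable_exp [intro!]:
  assumes "bounded_measurable M f" shows "bounded_measurable M (\<lambda>z. exp (f z))"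
proof -
  note [measurable] = assms[THEN bounded_measurableD]
  obtain B where "\<And>z. z \<in> space M \<Longrightarrow> \<bar>f z\<bar> \<le> B" using assms by (metis bounded_measurableE)
  then show ?thesis 
    by (intro bounded_measurableI[where B="exp B"]) (measurable, auto simp: abs_le_iff)
qed

lemma bounded_measurable_compose:
  assumes "bounded_measurable N f" "g \<in> measurable M N"
  shows "bounded_measurable M (\<lambda>z. f (g z))"
proof -
  note [measurable] = assms(2) assms(1)[THEN bounded_measurableD]
  obtain B where "\<And>z. z \<in> space N \<Longrightarrow> \<bar>f z\<bar> \<le> B" using assms by (metis bounded_measurableE)
  then show ?thesis
    by (intro bounded_measurableI[where B=B]) (measurable, auto dest: measurable_space[OF assms(2)])
qed

lemma (in finite_measure) integrable_bounded_measurable [simp, intro]: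
  assumes "bounded_measurable M f" shows "integrable M f"
proof -
  note [measurable] = assms[THEN bounded_measurableD]
  obtain B where "\<And>z. z \<in> space M \<Longrightarrow> \<bar>f z\<bar> \<le> B" using assms by (metis bounded_measurableE)
  then show ?thesis by (intro integrable_const_bound[where B=B]) auto
qed

lemma (in prob_space) abs_integral_le:
  fixes f :: "'a \<Rightarrow> real"
  assumes "f \<in> borel_measurable M" "\<And>z. z \<in> space M \<Longrightarrow> \<bar>f z\<bar> \<le> B"
  shows "\<bar>\<integral>z. f z \<partial>M\<bar> \<le> B"
proof -
  have i: "integrable M f" by (intro integrable_bounded_measurable bounded_measurableI[where B=B] assms)
  have "\<bar>\<integral>z. f z \<partial>M\<bar> \<le> (\<integral>z. \<bar>f z\<bar> \<partial>M)" by (rule integral_abs_bound)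
  also have "\<dots> \<le> (\<integral>z. B \<partial>M)" using i assms by (intro integral_mono) auto
  finally show ?thesis by (simp add: prob_space)
qed

lemma abs_exp_minus_linear_le:
  assumes "\<bar>y\<bar> \<le> (1::real)" shows "\<bar>exp y - 1 - y\<bar> \<le> y\<^sup>2"
proof (cases "y \<ge> 0")
  case True
  have 1: "exp y \<le> 1 + y + y\<^sup>2" using True assms by (intro exp_bound) auto
  have 2: "1 + y \<le> exp y" by (rule exp_ge_add_one_self)
  show ?thesis unfolding abs_le_iff using 1 2 zero_le_power2[of y] by linarith
next
  case False
  define x where "x = - y"
  have x: "0 < x" "x \<le> 1" using False assms by (auto simp: x_def)
  have "exp x \<ge> 1 + x" by (rule exp_ge_add_one_self)
  then have "exp (-x) \<le> 1 / (1 + x)" using x by (simp add: exp_minus divide_simps)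
  also have "\<dots> \<le> 1 - x + x\<^sup>2"
  proof -
    have "(1 + x) * (1 - x + x\<^sup>2) = 1 + x ^ 3" by (simp add: algebra_simps power2_eq_square power3_eq_cube)
    then show ?thesis using x by (simp add: divide_simps mult.commute)
  qed
  finally have 1: "exp y \<le> 1 + y + y\<^sup>2" by (simp add: x_def)
  have 2: "1 + y \<le> exp y" by (rule exp_ge_add_one_self)
  show ?thesis unfolding abs_le_iff using 1 2 zero_le_power2[of y] by linarith
qed

text \<open>
  Boundedness of \<open>a\<close> makes the second-order Taylor remainder of the integrand uniformly quadratic, so that
  one may differentiate under the integral.
\<close>

lemma (in finite_measure) integral_exp_has_derivative:
  assumes k: "bounded_measurable M k" and h: "bounded_measurable M h" and a: "bounded_measurable M a"
  shows "((\<lambda>t. \<integral>z. k z * exp (h z + t * a z) \<partial>M) has_real_derivative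
          (\<integral>z. k z * a z * exp (h z + t * a z) \<partial>M)) (at t)"
proof -
  obtain A where A: "A \<ge> 0" "\<And>z. z \<in> space M \<Longrightarrow> \<bar>a z\<bar> \<le> A" using a by (metis bounded_measurableE)
  define w where "w = (\<lambda>z. k z * exp (h z + t * a z))"
  have w: "bounded_measurable M w" unfolding w_def using assms by auto
  have we: "bounded_measurable M (\<lambda>z. w z * exp (s * a z))" for s using w a by auto
  have wa: "bounded_measurable M (\<lambda>z. w z * a z)" using w a by auto
  define C where "C = (\<integral>z. \<bar>w z\<bar> * A\<^sup>2 \<partial>M)"
  have C0: "C \<ge> 0" unfolding C_def by (intro integral_nonneg_AE) auto
  let ?D = "\<integral>z. w z * a z \<partial>M"
  have key: "\<bar>((\<integral>z. w z * exp (s * a z) \<partial>M) - (\<integral>z. w z \<partial>M)) / s - ?D\<bar> \<le> C * \<bar>s\<bar>"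
    if s: "s \<noteq> 0" "\<bar>s\<bar> * A \<le> 1" for s
  proof -
    have "(\<integral>z. w z * exp (s * a z) \<partial>M) - (\<integral>z. w z \<partial>M) - s * ?D
        = (\<integral>z. w z * exp (s * a z) - w z - s * (w z * a z) \<partial>M)"
      using we[of s] w wa by simp
    also have "\<bar>\<dots>\<bar> \<le> (\<integral>z. \<bar>w z * exp (s * a z) - w z - s * (w z * a z)\<bar> \<partial>M)"
      by (rule integral_abs_bound)
    also have "\<dots> \<le> (\<integral>z. s\<^sup>2 * (\<bar>w z\<bar> * A\<^sup>2) \<partial>M)"
    proof (rule integral_mono)
      fix z assume z: "z \<in> space M"
      have "\<bar>s * a z\<bar> \<le> \<bar>s\<bar> * A" using A z by (auto simp: abs_mult intro: mult_left_mono)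
      then have "\<bar>exp (s * a z) - 1 - s * a z\<bar> \<le> (s * a z)\<^sup>2"
        using s by (intro abs_exp_minus_linear_le) auto
      also have "\<dots> \<le> s\<^sup>2 * A\<^sup>2"
        using A(2)[OF z] by (simp add: power_mult_distrib abs_le_square_iff[symmetric] mult_left_mono A(1))
      finally have "\<bar>w z\<bar> * \<bar>exp (s * a z) - 1 - s * a z\<bar> \<le> \<bar>w z\<bar> * (s\<^sup>2 * A\<^sup>2)"
        by (intro mult_left_mono) auto
      moreover have *: "w z * exp (s * a z) - w z - s * (w z * a z) = w z * (exp (s * a z) - 1 - s * a z)"
        by (simp add: algebra_simps)
      ultimately show "\<bar>w z * exp (s * a z) - w z - s * (w z * a z)\<bar> \<le> s\<^sup>2 * (\<bar>w z\<bar> * A\<^sup>2)"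
        by (simp add: * abs_mult mult_ac)
    qed (use we[of s] w wa in auto)
    also have "\<dots> = s\<^sup>2 * C" unfolding C_def by simp
    finally have "\<bar>(\<integral>z. w z * exp (s * a z) \<partial>M) - (\<integral>z. w z \<partial>M) - s * ?D\<bar> / \<bar>s\<bar> \<le> s\<^sup>2 * C / \<bar>s\<bar>"
      by (rule divide_right_mono) auto
    also have "s\<^sup>2 * C / \<bar>s\<bar> = C * \<bar>s\<bar>" using s(1) by (simp add: power2_eq_square field_simps abs_mult_self_eq)
    finally show ?thesis using s(1) by (simp add: abs_divide[symmetric] diff_divide_distrib)
  qed
  have ev: "\<forall>\<^sub>F s in at 0. \<bar>((\<integral>z. w z * exp (s * a z) \<partial>M) - (\<integral>z. w z \<partial>M)) / s - ?D\<bar> \<le> C * \<bar>s\<bar>"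
    unfolding eventually_at
  proof (intro exI[of _ "1 / (A + 1)"] conjI ballI impI)
    show "0 < 1 / (A + 1)" using A by simp
    fix s :: real assume s: "s \<noteq> 0 \<and> dist s 0 < 1 / (A + 1)"
    then have "\<bar>s\<bar> * (A + 1) \<le> 1" using A by (simp add: dist_real_def field_simps)
    moreover have "\<bar>s\<bar> * A \<le> \<bar>s\<bar> * (A + 1)" by (simp add: mult_left_mono)
    ultimately have "\<bar>s\<bar> * A \<le> 1" by linarith
    then show "\<bar>((\<integral>z. w z * exp (s * a z) \<partial>M) - (\<integral>z. w z \<partial>M)) / s - ?D\<bar> \<le> C * \<bar>s\<bar>"
      using key[of s] s by auto
  qed
  have "((\<lambda>s. ((\<integral>z. w z * exp (s * a z) \<partial>M) - (\<integral>z. w z \<partial>M)) / s - ?D) \<longlongrightarrow> 0) (at 0)"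
  proof (rule Lim_null_comparison)
    show "((\<lambda>s::real. C * \<bar>s\<bar>) \<longlongrightarrow> 0) (at 0)" by (auto intro!: tendsto_eq_intros)
    show "\<forall>\<^sub>F s in at 0. norm (((\<integral>z. w z * exp (s * a z) \<partial>M) - (\<integral>z. w z \<partial>M)) / s - ?D) \<le> C * \<bar>s\<bar>"
      using ev by simp
  qed
  then have lim: "((\<lambda>s. ((\<integral>z. w z * exp (s * a z) \<partial>M) - (\<integral>z. w z \<partial>M)) / s) \<longlongrightarrow> ?D) (at 0)"
    by (simp add: LIM_zero_iff)
  have w1: "k z * exp (h z + (t + s) * a z) = w z * exp (s * a z)" for z s
    by (simp add: w_def exp_add distrib_right)
  have w2: "k z * a z * exp (h z + t * a z) = w z * a z" for z
    by (simp add: w_def)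
  show ?thesis
    using lim unfolding DERIV_def w1 w2 by (simp add: w_def)
qed

lemma sets_tilted [simp, measurable_cong]: "sets (tilted_measure M g) = sets M"
  by (simp add: tilted_measure_def)

lemma space_tilted [simp]: "space (tilted_measure M g) = space M"
  by (simp add: tilted_measure_def)

lemma bounded_measurable_tilted [simp]:
  "bounded_measurable (tilted_measure M g) f \<longleftrightarrow> bounded_measurable M f"
  by (simp add: bounded_measurable_def cong: measurable_cong_sets)

context prob_space
begin

lemma integral_exp_pos:
  assumes "bounded_measurable M g" shows "(\<integral>z. exp (g z) \<partial>M) > 0"
proof -
  obtain B where B: "\<And>z. z \<in> space M \<Longrightarrow> \<bar>g z\<bar> \<le> B" using assms by (metis bounded_measurableE)
  have "exp (- B) = (\<integral>z. exp (- B) \<partial>M)" by (simp add: prob_space)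
  also have "\<dots> \<le> (\<integral>z. exp (g z) \<partial>M)"
    using assms by (intro integral_mono) (auto simp: B minus_le_iff abs_le_iff intro!: integrable_bounded_measurable dest!: B)
  finally show ?thesis using exp_gt_zero[of "-B"] by linarith
qed

lemma integral_tilted:
  assumes g: "g \<in> borel_measurable M" and [measurable]: "f \<in> borel_measurable M"
  shows "(\<integral>z. f z \<partial>tilted_measure M g) = (\<integral>z. f z * exp (g z) \<partial>M) / (\<integral>z. exp (g z) \<partial>M)"
proof -
  note [measurable] = g
  have "(\<integral>z. f z \<partial>tilted_measure M g) = (\<integral>z. (f z * exp (g z)) / (\<integral>z. exp (g z) \<partial>M) \<partial>M)"
    unfolding tilted_measure_def
    by (subst integral_density) (auto simp: mult.commute)
  then show ?thesis by simp
qed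

lemma prob_space_tilted:
  assumes g: "g \<in> borel_measurable M" and i: "integrable M (\<lambda>z. exp (g z))"
  shows "prob_space (tilted_measure M g)"
proof
  note [measurable] = g
  have pos: "(\<integral>z. exp (g z) \<partial>M) > 0"
    using i integral_less_AE_space[of "\<lambda>_. 0" "\<lambda>z. exp (g z)"] emeasure_space_1 by simp
  have "emeasure (tilted_measure M g) (space (tilted_measure M g))
      = (\<integral>\<^sup>+z. ennreal (exp (g z) / (\<integral>z'. exp (g z') \<partial>M)) \<partial>M)"
    unfolding tilted_measure_def by (simp add: emeasure_density cong: nn_integral_cong)
  also have "\<dots> = ennreal (\<integral>z. exp (g z) / (\<integral>z'. exp (g z') \<partial>M) \<partial>M)"
    using i pos by (intro nn_integral_eq_integral) auto
  also have "\<dots> = 1" using pos by simp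
  finally show "emeasure (tilted_measure M g) (space (tilted_measure M g)) = 1" .
qed

lemma prob_space_tilted_bounded:
  "bounded_measurable M g \<Longrightarrow> prob_space (tilted_measure M g)"
  by (intro prob_space_tilted integrable_bounded_measurable) auto

text \<open>
  Differentiating the quotient of \<open>\<integral> k * exp (h + t * a)\<close> and \<open>\<integral> exp (h + t * a)\<close> leaves a covariance. Derivatives
  of averages in a Gaussian variable and in a strength are both instances of this one.
\<close>

lemma tilted_has_derivative:
  assumes k: "bounded_measurable M k" and h: "bounded_measurable M h" and a: "bounded_measurable M a"
  defines "T \<equiv> \<lambda>t. tilted_measure M (\<lambda>z. h z + t * a z)"
  shows "((\<lambda>t. \<integral>z. k z \<partial>T t) has_real_derivative
     (\<integral>z. k z * a z \<partial>T t) - (\<integral>z. k z \<partial>T t) * (\<integral>z. a z \<partial>T t)) (at t)"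
proof -
  note [measurable] = k[THEN bounded_measurableD] h[THEN bounded_measurableD] a[THEN bounded_measurableD]
  have Z: "(\<integral>z. exp (h z + t * a z) \<partial>M) > 0" for t using h a by (intro integral_exp_pos) auto
  have dZ: "((\<lambda>t. \<integral>z. exp (h z + t * a z) \<partial>M) has_real_derivative
          (\<integral>z. a z * exp (h z + t * a z) \<partial>M)) (at t)" for t
    using integral_exp_has_derivative[of "\<lambda>_. 1" h a t] h a by simp
  have T: "(\<integral>z. f z \<partial>T t) = (\<integral>z. f z * exp (h z + t * a z) \<partial>M) / (\<integral>z. exp (h z + t * a z) \<partial>M)"
    if "f \<in> borel_measurable M" for f t
    unfolding T_def using that by (intro integral_tilted) measurable
  show ?thesis
    unfolding T[OF bounded_measurableD[OF k]] T[OF bounded_measurableD[OF a]]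
      T[OF bounded_measurableD[OF bounded_measurable_mult[OF k a]]]
    by (rule derivative_eq_intros integral_exp_has_derivative k h a dZ refl)+
       (use Z[of t] in \<open>auto simp: field_simps\<close>)
qed

end

text \<open>
  Seen as a tilt of a product measure, the law of several replicas can be differentiated by
  \<open>tilted_has_derivative\<close> like that of a single one.
\<close>

lemma PiM_tilted:
  fixes M :: "'a measure"
  assumes "prob_space M" and g: "bounded_measurable M g" and J: "finite J"
  shows "PiM J (\<lambda>_. tilted_measure M g)
       = tilted_measure (PiM J (\<lambda>_. M)) (\<lambda>zs. \<Sum>l\<in>J. g (zs l))"
proof -
  interpret prob_space M by fact
  interpret T: prob_space "tilted_measure M g" using g by (rule prob_space_tilted_bounded)
  interpret TP: product_sigma_finite "\<lambda>_::'b. tilted_measure M g" by standard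
  interpret P: product_sigma_finite "\<lambda>_::'b. M" by standard
  note [measurable] = g[THEN bounded_measurableD]
  have [measurable]: "(\<lambda>zs. zs l) \<in> measurable (PiM J (\<lambda>_. M)) M" if "l \<in> J" for l
    using that by measurable
  define Z where "Z = (\<integral>z. exp (g z) \<partial>M)"
  have Z: "Z > 0" unfolding Z_def using g by (rule integral_exp_pos)
  have ZJ: "(\<integral>zs. exp (\<Sum>l\<in>J. g (zs l)) \<partial>PiM J (\<lambda>_. M)) = Z ^ card J"
    using P.product_integral_prod[OF J, of "\<lambda>_ z. exp (g z)"] J g
    by (simp add: exp_sum Z_def bounded_measurable_exp)
  show ?thesis
  proof (rule TP.PiM_eqI[OF J, symmetric])
    show "sets (tilted_measure (PiM J (\<lambda>_. M)) (\<lambda>zs. \<Sum>l\<in>J. g (zs l)))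
        = sets (PiM J (\<lambda>_. tilted_measure M g))"
      by (simp cong: sets_PiM_cong)
    fix A assume A: "\<And>l. l \<in> J \<Longrightarrow> A l \<in> sets (tilted_measure M g)"
    then have [measurable]: "A l \<in> sets M" if "l \<in> J" for l using that by simp
    have AJ: "Pi\<^sub>E J A \<in> sets (PiM J (\<lambda>_. M))" using J by (intro sets_PiM_I_finite) auto
    have "emeasure (tilted_measure (PiM J (\<lambda>_. M)) (\<lambda>zs. \<Sum>l\<in>J. g (zs l))) (Pi\<^sub>E J A)
      = (\<integral>\<^sup>+zs. ennreal (exp (\<Sum>l\<in>J. g (zs l)) / Z ^ card J) * indicator (Pi\<^sub>E J A) zs \<partial>PiM J (\<lambda>_. M))"
      unfolding tilted_measure_def ZJ by (intro emeasure_density AJ) measurable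
    also have "\<dots> = (\<integral>\<^sup>+zs. (\<Prod>l\<in>J. ennreal (exp (g (zs l)) / Z) * indicator (A l) (zs l)) \<partial>PiM J (\<lambda>_. M))"
    proof (rule nn_integral_cong)
      fix zs assume "zs \<in> space (PiM J (\<lambda>_. M))"
      then have "indicator (Pi\<^sub>E J A) zs = (\<Prod>l\<in>J. indicator (A l) (zs l) :: ennreal)"
        using J by (auto simp: space_PiM PiE_def Pi_def indicator_def prod.neutral intro!: prod_zero)
      moreover have "ennreal (exp (\<Sum>l\<in>J. g (zs l)) / Z ^ card J) = (\<Prod>l\<in>J. ennreal (exp (g (zs l)) / Z))"
        using J Z by (simp add: exp_sum prod_ennreal prod_dividef)
      ultimately show "ennreal (exp (\<Sum>l\<in>J. g (zs l)) / Z ^ card J) * indicator (Pi\<^sub>E J A) zs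
         = (\<Prod>l\<in>J. ennreal (exp (g (zs l)) / Z) * indicator (A l) (zs l))"
        by (simp add: prod.distrib)
    qed
    also have "\<dots> = (\<Prod>l\<in>J. \<integral>\<^sup>+z. ennreal (exp (g z) / Z) * indicator (A l) z \<partial>M)"
      using J by (intro P.product_nn_integral_prod) measurable
    also have "\<dots> = (\<Prod>l\<in>J. emeasure (tilted_measure M g) (A l))"
      unfolding tilted_measure_def Z_def[symmetric] by (intro prod.cong refl) (simp add: emeasure_density)
    finally show "emeasure (tilted_measure (PiM J (\<lambda>_. M)) (\<lambda>zs. \<Sum>l\<in>J. g (zs l))) (Pi\<^sub>E J A)
       = (\<Prod>l\<in>J. emeasure (tilted_measure M g) (A l))" .
  qed
qed

section \<open>Gibbs measures with a finite Gaussian Hamiltonian\<close>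

text \<open>
  The sphere enters only through the functions \<open>e i\<close>, the monomials in the coordinates. The index set is
  finite and the functions are bounded by 1, so that for fixed disorder all exponents are bounded.
\<close>

locale gaussian_gibbs = prob_space M for M :: "'a measure" +
  fixes I :: "'i set" and e :: "'i \<Rightarrow> 'a \<Rightarrow> real"
  assumes finite_I: "finite I"
    and e_measurable [measurable]: "i \<in> I \<Longrightarrow> e i \<in> borel_measurable M"
    and e_le_1: "i \<in> I \<Longrightarrow> z \<in> space M \<Longrightarrow> \<bar>e i z\<bar> \<le> 1"
begin

definition ham :: "('i \<Rightarrow> real) \<Rightarrow> ('i \<Rightarrow> real) \<Rightarrow> 'a \<Rightarrow> real" where
  "ham b G z = (\<Sum>i\<in>I. b i * G i * e i z)"

definition gibbs :: "('i \<Rightarrow> real) \<Rightarrow> ('i \<Rightarrow> real) \<Rightarrow> 'a measure" where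
  "gibbs b G = tilted_measure M (ham b G)"

definition replicas :: "nat \<Rightarrow> ('i \<Rightarrow> real) \<Rightarrow> ('i \<Rightarrow> real) \<Rightarrow> (nat \<Rightarrow> 'a) measure" where
  "replicas n b G = PiM {..<n} (\<lambda>_. gibbs b G)"

lemma bounded_measurable_e [intro!]: "i \<in> I \<Longrightarrow> bounded_measurable M (e i)"
  by (intro bounded_measurableI[where B=1] e_measurable e_le_1)

lemma bounded_measurable_ham [intro!]: "bounded_measurable M (ham b G)"
  unfolding ham_def[abs_def] by auto

lemma ham_abs_le:
  assumes "z \<in> space M" shows "\<bar>ham b G z\<bar> \<le> (\<Sum>i\<in>I. \<bar>b i\<bar> * \<bar>G i\<bar>)"
  unfolding ham_def
proof (rule order_trans[OF sum_abs sum_mono])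
  fix i assume "i \<in> I"
  from e_le_1[OF this assms] have "(\<bar>b i\<bar> * \<bar>G i\<bar>) * \<bar>e i z\<bar> \<le> (\<bar>b i\<bar> * \<bar>G i\<bar>) * 1"
    by (intro mult_left_mono) auto
  then show "\<bar>b i * G i * e i z\<bar> \<le> \<bar>b i\<bar> * \<bar>G i\<bar>" by (simp add: abs_mult)
qed

lemma ham_upd:
  assumes "i \<in> I" shows "ham b (G(i := t)) z = ham b (G(i := 0)) z + t * (b i * e i z)"
proof -
  have "(\<Sum>k\<in>I-{i}. b k * (G(i := t)) k * e k z) = (\<Sum>k\<in>I-{i}. b k * (G(i := 0)) k * e k z)"
    by (intro sum.cong) auto
  then show ?thesis
    unfolding ham_def using finite_I assms by (simp add: sum.remove[of I i])
qed

lemma measurable_ham: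
  assumes [measurable]: "\<And>i. i \<in> I \<Longrightarrow> (\<lambda>\<omega>. b \<omega> i) \<in> borel_measurable N"
    "\<And>i. i \<in> I \<Longrightarrow> (\<lambda>\<omega>. G \<omega> i) \<in> borel_measurable N"
  shows "(\<lambda>x. ham (b (fst x)) (G (fst x)) (snd x)) \<in> borel_measurable (N \<Otimes>\<^sub>M M)"
  unfolding ham_def by measurable

lemma sets_gibbs [simp, measurable_cong]: "sets (gibbs b G) = sets M"
  by (simp add: gibbs_def)

lemma space_gibbs [simp]: "space (gibbs b G) = space M"
  by (simp add: gibbs_def)

lemma bounded_measurable_gibbs [simp]:
  "bounded_measurable (gibbs b G) f \<longleftrightarrow> bounded_measurable M f"
  by (simp add: gibbs_def)

lemma prob_space_gibbs: "prob_space (gibbs b G)"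
  unfolding gibbs_def by (intro prob_space_tilted_bounded) auto

lemma prob_space_product: "prob_space (PiM {..<n::nat} (\<lambda>_. M))"
  by (intro prob_space_PiM) unfold_locales

lemma sets_replicas [simp, measurable_cong]:
  "sets (replicas n b G) = sets (PiM {..<n} (\<lambda>_. M))"
  unfolding replicas_def by (intro sets_PiM_cong) auto

lemma space_replicas [simp]: "space (replicas n b G) = space (PiM {..<n} (\<lambda>_. M))"
  by (rule sets_eq_imp_space_eq) simp

lemma bounded_measurable_replicas [simp]:
  "bounded_measurable (replicas n b G) f \<longleftrightarrow> bounded_measurable (PiM {..<n} (\<lambda>_. M)) f"
  by (simp add: bounded_measurable_def cong: measurable_cong_sets)

lemma prob_space_replicas: "prob_space (replicas n b G)"
  unfolding replicas_def by (intro prob_space_PiM prob_space_gibbs)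

lemma replicas_tilted:
  "replicas n b G = tilted_measure (PiM {..<n} (\<lambda>_. M)) (\<lambda>zs. \<Sum>l<n. ham b G (zs l))"
  unfolding replicas_def gibbs_def
  by (rule PiM_tilted) (auto intro: prob_space_axioms)

lemma integrable_gibbs [intro]: "bounded_measurable M f \<Longrightarrow> integrable (gibbs b G) f"
proof -
  assume f: "bounded_measurable M f"
  interpret T: prob_space "gibbs b G" by (rule prob_space_gibbs)
  show ?thesis using f by auto
qed

lemma integrable_replicas [intro]:
  "bounded_measurable (PiM {..<n} (\<lambda>_. M)) f \<Longrightarrow> integrable (replicas n b G) f"
proof -
  assume f: "bounded_measurable (PiM {..<n} (\<lambda>_. M)) f"
  interpret T: prob_space "replicas n b G" by (rule prob_space_replicas)
  show ?thesis using f by auto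
qed

lemma abs_integral_gibbs_le:
  fixes f :: "'a \<Rightarrow> real"
  assumes "f \<in> borel_measurable M" "\<And>z. z \<in> space M \<Longrightarrow> \<bar>f z\<bar> \<le> B"
  shows "\<bar>\<integral>z. f z \<partial>gibbs b G\<bar> \<le> B"
proof -
  interpret T: prob_space "gibbs b G" by (rule prob_space_gibbs)
  show ?thesis using assms by (intro T.abs_integral_le) auto
qed

lemma abs_integral_replicas_le:
  fixes f :: "(nat \<Rightarrow> 'a) \<Rightarrow> real"
  assumes "f \<in> borel_measurable (PiM {..<n} (\<lambda>_. M))" "\<And>zs. zs \<in> space (PiM {..<n} (\<lambda>_. M)) \<Longrightarrow> \<bar>f zs\<bar> \<le> B"
  shows "\<bar>\<integral>zs. f zs \<partial>replicas n b G\<bar> \<le> B"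
proof -
  interpret T: prob_space "replicas n b G" by (rule prob_space_replicas)
  show ?thesis using assms by (intro T.abs_integral_le) auto
qed

lemma space_productD: "zs \<in> space (PiM {..<n} (\<lambda>_. M)) \<Longrightarrow> j < n \<Longrightarrow> zs j \<in> space M"
  by (auto simp: space_PiM)

lemma bounded_measurable_component:
  "bounded_measurable M f \<Longrightarrow> j < n \<Longrightarrow> bounded_measurable (PiM {..<n} (\<lambda>_. M)) (\<lambda>zs. f (zs j))"
  by (erule bounded_measurable_compose) measurable

lemma integral_replica_component:
  assumes "j < n" and [measurable]: "f \<in> borel_measurable M"
  shows "(\<integral>zs. f (zs j) \<partial>replicas n b G) = (\<integral>z. (f z :: real) \<partial>gibbs b G)"
proof -
  have "distr (replicas n b G) (gibbs b G) (\<lambda>zs. zs j) = gibbs b G"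
    unfolding replicas_def using assms(1) by (intro distr_PiM_component prob_space_gibbs) auto
  then have "(\<integral>z. f z \<partial>gibbs b G) = (\<integral>z. f z \<partial>distr (replicas n b G) (gibbs b G) (\<lambda>zs. zs j))"
    by simp
  also have "\<dots> = (\<integral>zs. f (zs j) \<partial>replicas n b G)"
    using assms(1) by (intro integral_distr) measurable
  finally show ?thesis by simp
qed

lemma measurable_integral_gibbs:
  fixes F :: "'b \<Rightarrow> 'a \<Rightarrow> real"
  assumes b: "\<And>i. i \<in> I \<Longrightarrow> (\<lambda>\<omega>. b \<omega> i) \<in> borel_measurable N"
    and G: "\<And>i. i \<in> I \<Longrightarrow> (\<lambda>\<omega>. G \<omega> i) \<in> borel_measurable N"
    and F[measurable]: "(\<lambda>x. F (fst x) (snd x)) \<in> borel_measurable (N \<Otimes>\<^sub>M M)"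
  shows "(\<lambda>\<omega>. \<integral>z. F \<omega> z \<partial>gibbs (b \<omega>) (G \<omega>)) \<in> borel_measurable N"
proof -
  note [measurable] = measurable_ham[OF b G]
  have [measurable]: "(\<lambda>(\<omega>, z). F \<omega> z * exp (ham (b \<omega>) (G \<omega>) z)) \<in> borel_measurable (N \<Otimes>\<^sub>M M)"
    "(\<lambda>(\<omega>, z). exp (ham (b \<omega>) (G \<omega>) z)) \<in> borel_measurable (N \<Otimes>\<^sub>M M)"
    by (auto simp: case_prod_beta)
  have "(\<lambda>\<omega>. (\<integral>z. F \<omega> z * exp (ham (b \<omega>) (G \<omega>) z) \<partial>M) / (\<integral>z. exp (ham (b \<omega>) (G \<omega>) z) \<partial>M)) \<in> borel_measurable N"
    by measurable
  moreover have "(\<integral>z. F \<omega> z \<partial>gibbs (b \<omega>) (G \<omega>))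
      = (\<integral>z. F \<omega> z * exp (ham (b \<omega>) (G \<omega>) z) \<partial>M) / (\<integral>z. exp (ham (b \<omega>) (G \<omega>) z) \<partial>M)"
    if "\<omega> \<in> space N" for \<omega>
    unfolding gibbs_def
  proof (rule integral_tilted)
    show "ham (b \<omega>) (G \<omega>) \<in> borel_measurable M" by (rule bounded_measurableD) auto
    show "F \<omega> \<in> borel_measurable M"
      using measurable_compose[OF measurable_Pair1'[OF that, of M] F] by simp
  qed
  ultimately show ?thesis by (simp cong: measurable_cong)
qed

lemma measurable_integral_replicas:
  fixes f :: "(nat \<Rightarrow> 'a) \<Rightarrow> real"
  assumes b: "\<And>i. i \<in> I \<Longrightarrow> (\<lambda>\<omega>. b \<omega> i) \<in> borel_measurable N"
    and G: "\<And>i. i \<in> I \<Longrightarrow> (\<lambda>\<omega>. G \<omega> i) \<in> borel_measurable N"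
    and f[measurable]: "f \<in> borel_measurable (PiM {..<n} (\<lambda>_. M))"
  shows "(\<lambda>\<omega>. \<integral>zs. f zs \<partial>replicas n (b \<omega>) (G \<omega>)) \<in> borel_measurable N"
proof -
  interpret P: prob_space "PiM {..<n} (\<lambda>_. M)" by (rule prob_space_product)
  define H where "H = (\<lambda>\<omega> zs. \<Sum>l<n. ham (b \<omega>) (G \<omega>) (zs l))"
  have [measurable]: "(\<lambda>x. ham (b (fst x)) (G (fst x)) (snd x l)) \<in> borel_measurable (N \<Otimes>\<^sub>M PiM {..<n} (\<lambda>_. M))"
    if "l < n" for l
  proof -
    have "(\<lambda>x. (fst x, snd x l)) \<in> measurable (N \<Otimes>\<^sub>M PiM {..<n} (\<lambda>_. M)) (N \<Otimes>\<^sub>M M)"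
      by measurable (use that in simp)
    from measurable_compose[OF this measurable_ham[OF b G]] show ?thesis by simp
  qed
  have [measurable]: "(\<lambda>x. H (fst x) (snd x)) \<in> borel_measurable (N \<Otimes>\<^sub>M PiM {..<n} (\<lambda>_. M))"
    unfolding H_def by measurable
  have "(\<lambda>\<omega>. (\<integral>zs. f zs * exp (H \<omega> zs) \<partial>PiM {..<n} (\<lambda>_. M)) / (\<integral>zs. exp (H \<omega> zs) \<partial>PiM {..<n} (\<lambda>_. M))) \<in> borel_measurable N"
    by measurable
  moreover have "(\<integral>zs. f zs \<partial>replicas n (b \<omega>) (G \<omega>))
      = (\<integral>zs. f zs * exp (H \<omega> zs) \<partial>PiM {..<n} (\<lambda>_. M)) / (\<integral>zs. exp (H \<omega> zs) \<partial>PiM {..<n} (\<lambda>_. M))" for \<omega>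
    unfolding replicas_tilted H_def
    by (intro P.integral_tilted f bounded_measurableD bounded_measurable_sum bounded_measurable_component) auto
  ultimately show ?thesis by simp
qed

lemma gibbs_has_derivative:
  assumes i: "i \<in> I" and k: "bounded_measurable M k"
  shows "((\<lambda>t. \<integral>z. k z \<partial>gibbs b (G(i := t))) has_real_derivative
     b i * ((\<integral>z. k z * e i z \<partial>gibbs b (G(i := t))) -
      (\<integral>z. k z \<partial>gibbs b (G(i := t))) * (\<integral>z. e i z \<partial>gibbs b (G(i := t))))) (at t)"
proof -
  have eq: "gibbs b (G(i := t)) = tilted_measure M (\<lambda>z. ham b (G(i := 0)) z + t * (b i * e i z))" for t
    unfolding gibbs_def by (intro arg_cong[where f="tilted_measure M"] ext ham_upd[OF i])
  show ?thesis
    unfolding eq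
    by (rule DERIV_cong[OF tilted_has_derivative])
       (use i k in \<open>auto simp: algebra_simps\<close>)
qed

lemma replicas_has_derivative:
  assumes i: "i \<in> I" and k: "bounded_measurable (PiM {..<n} (\<lambda>_. M)) k"
  shows "((\<lambda>t. \<integral>zs. k zs \<partial>replicas n b (G(i := t))) has_real_derivative
     b i * ((\<Sum>l<n. \<integral>zs. k zs * e i (zs l) \<partial>replicas n b (G(i := t))) -
      (\<integral>zs. k zs \<partial>replicas n b (G(i := t))) * (real n * (\<integral>z. e i z \<partial>gibbs b (G(i := t)))))) (at t)"
proof -
  interpret P: prob_space "PiM {..<n} (\<lambda>_. M)" by (rule prob_space_product)
  have eq: "replicas n b (G(i := t)) = tilted_measure (PiM {..<n} (\<lambda>_. M))
      (\<lambda>zs. (\<Sum>l<n. ham b (G(i := 0)) (zs l)) + t * (b i * (\<Sum>l<n. e i (zs l))))" for t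
    unfolding replicas_tilted
    by (intro arg_cong[where f="tilted_measure (PiM {..<n} (\<lambda>_. M))"] ext)
       (subst ham_upd[OF i], simp add: sum.distrib sum_distrib_left)
  have bi: "bounded_measurable (PiM {..<n} (\<lambda>_. M)) (\<lambda>zs. \<Sum>l<n. e i (zs l))"
    using i by (intro bounded_measurable_sum bounded_measurable_component) auto
  have bh: "bounded_measurable (PiM {..<n} (\<lambda>_. M)) (\<lambda>zs. \<Sum>l<n. ham b (G(i := 0)) (zs l))"
    by (intro bounded_measurable_sum bounded_measurable_component) auto
  let ?T = "replicas n b (G(i := t))"
  have d: "((\<lambda>t. \<integral>zs. k zs \<partial>replicas n b (G(i := t))) has_real_derivative
     (\<integral>zs. k zs * (b i * (\<Sum>l<n. e i (zs l))) \<partial>?T) -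
      (\<integral>zs. k zs \<partial>?T) * (\<integral>zs. b i * (\<Sum>l<n. e i (zs l)) \<partial>?T)) (at t)"
    unfolding eq by (rule P.tilted_has_derivative) (use k bi bh in auto)
  have e1: "(\<integral>zs. k zs * (b i * (\<Sum>l<n. e i (zs l))) \<partial>?T) = b i * (\<Sum>l<n. \<integral>zs. k zs * e i (zs l) \<partial>?T)"
  proof -
    have "(\<integral>zs. k zs * (b i * (\<Sum>l<n. e i (zs l))) \<partial>?T) = (\<integral>zs. b i * (\<Sum>l<n. k zs * e i (zs l)) \<partial>?T)"
      by (intro Bochner_Integration.integral_cong refl) (simp add: sum_distrib_left mult_ac)
    also have "\<dots> = b i * (\<Sum>l<n. \<integral>zs. k zs * e i (zs l) \<partial>?T)"
      using i k by (subst integral_mult_right_zero, subst Bochner_Integration.integral_sum)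
        (auto intro!: integrable_replicas bounded_measurable_component)
    finally show ?thesis .
  qed
  have e2: "(\<integral>zs. b i * (\<Sum>l<n. e i (zs l)) \<partial>?T) = b i * (real n * (\<integral>z. e i z \<partial>gibbs b (G(i := t))))"
  proof -
    have "(\<integral>zs. (\<Sum>l<n. e i (zs l)) \<partial>?T) = (\<Sum>l<n. \<integral>zs. e i (zs l) \<partial>?T)"
      using i by (intro Bochner_Integration.integral_sum integrable_replicas bounded_measurable_component) auto
    also have "\<dots> = (\<Sum>l<n. \<integral>z. e i z \<partial>gibbs b (G(i := t)))"
      using i by (intro sum.cong integral_replica_component) auto
    finally show ?thesis by simp
  qed
  show ?thesis using d unfolding e1 e2 by (simp add: algebra_simps)
qed

text \<open>
  Sums over \<open>I\<close> of products of averages are averages of a kernel over independent points. In this form the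
  bound on the kernel can be used in place of a bound on the number of indices, which depends on \<open>N\<close>.
\<close>

lemma kernel_integral:
  assumes j: "j < n" and f: "bounded_measurable (PiM {..<n} (\<lambda>_. M)) f" and w: "bounded_measurable M w"
  shows "(\<integral>zs. f zs * (\<integral>z. w z * (\<Sum>i\<in>I. a i * e i (zs j) * e i z) \<partial>gibbs b G) \<partial>replicas n b G)
   = (\<Sum>i\<in>I. a i * (\<integral>z. w z * e i z \<partial>gibbs b G) * (\<integral>zs. f zs * e i (zs j) \<partial>replicas n b G))"
proof -
  have lin: "(\<integral>z. w z * (\<Sum>i\<in>I. a i * x i * e i z) \<partial>gibbs b G) = (\<Sum>i\<in>I. a i * x i * (\<integral>z. w z * e i z \<partial>gibbs b G))" for x
  proof -
    have "(\<integral>z. w z * (\<Sum>i\<in>I. a i * x i * e i z) \<partial>gibbs b G) = (\<integral>z. (\<Sum>i\<in>I. a i * x i * (w z * e i z)) \<partial>gibbs b G)"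
      by (intro Bochner_Integration.integral_cong refl) (simp add: sum_distrib_left mult_ac)
    also have "\<dots> = (\<Sum>i\<in>I. \<integral>z. a i * x i * (w z * e i z) \<partial>gibbs b G)"
      using w by (intro Bochner_Integration.integral_sum integrable_gibbs) auto
    finally show ?thesis by simp
  qed
  have "(\<integral>zs. f zs * (\<integral>z. w z * (\<Sum>i\<in>I. a i * e i (zs j) * e i z) \<partial>gibbs b G) \<partial>replicas n b G)
     = (\<integral>zs. (\<Sum>i\<in>I. (a i * (\<integral>z. w z * e i z \<partial>gibbs b G)) * (f zs * e i (zs j))) \<partial>replicas n b G)"
    unfolding lin by (intro Bochner_Integration.integral_cong refl) (simp add: sum_distrib_left mult_ac)
  also have "\<dots> = (\<Sum>i\<in>I. \<integral>zs. (a i * (\<integral>z. w z * e i z \<partial>gibbs b G)) * (f zs * e i (zs j)) \<partial>replicas n b G)"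
    using f j by (intro Bochner_Integration.integral_sum integrable_replicas bounded_measurable_mult
       bounded_measurable_component bounded_measurable_const) auto
  finally show ?thesis by simp
qed

lemma measurable_gauss_component [measurable]: "i \<in> I \<Longrightarrow> (\<lambda>G. G i) \<in> borel_measurable (gauss I)"
  by measurable

lemma measurable_gibbs_G:
  fixes F :: "('i \<Rightarrow> real) \<Rightarrow> 'a \<Rightarrow> real"
  assumes "(\<lambda>x. F (fst x) (snd x)) \<in> borel_measurable (gauss I \<Otimes>\<^sub>M M)"
  shows "(\<lambda>G. \<integral>z. F G z \<partial>gibbs b G) \<in> borel_measurable (gauss I)"
  by (rule measurable_integral_gibbs[where G="\<lambda>G. G" and b="\<lambda>_. b", OF _ _ assms]) auto

lemma measurable_gibbs_G':
  fixes k :: "'a \<Rightarrow> real"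
  assumes [measurable]: "k \<in> borel_measurable M"
  shows "(\<lambda>G. \<integral>z. k z \<partial>gibbs b G) \<in> borel_measurable (gauss I)"
  by (rule measurable_gibbs_G) measurable

lemma measurable_replicas_G:
  fixes f :: "(nat \<Rightarrow> 'a) \<Rightarrow> real"
  assumes "f \<in> borel_measurable (PiM {..<n} (\<lambda>_. M))"
  shows "(\<lambda>G. \<integral>zs. f zs \<partial>replicas n b G) \<in> borel_measurable (gauss I)"
  by (rule measurable_integral_replicas[where G="\<lambda>G. G" and b="\<lambda>_. b", OF _ _ assms]) auto

lemma measurable_ham_G [measurable]:
  "(\<lambda>x. ham b (fst x) (snd x)) \<in> borel_measurable (gauss I \<Otimes>\<^sub>M M)"
  by (rule measurable_ham[where G="\<lambda>G. G" and b="\<lambda>_. b"]) auto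

section \<open>Weighted Ghirlanda-Guerra identities\<close>

text \<open>
  Integration by parts in each Gaussian variable of \<open>h (U G)\<close> times the average of \<open>f * u (zs j)\<close>. The
  derivative of the replica average yields the kernel \<open>\<Psi>\<close> between \<open>zs j\<close> and the replicas \<open>zs l\<close>, and
  \<open>- n\<close> times the kernel between \<open>zs j\<close> and a fresh replica. The derivative of the weight involves
  \<open>\<partial>U / \<partial>G i\<close>, which has an explicit part, of size \<open>\<kappa>\<close> after summation, and a covariance of \<open>u\<close> with
  \<open>e i\<close>; the latter, like the error of replacing \<open>u (zs j)\<close> by \<open>U\<close>, is bounded by the mean absolute
  fluctuation of \<open>u\<close>.
\<close>

theorem weighted_ghirlanda_guerra:
  fixes b c :: "'i \<Rightarrow> real" and h h' :: "real \<Rightarrow> real" and f :: "(nat \<Rightarrow> 'a) \<Rightarrow> real"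
  assumes b: "\<And>i. i \<in> I \<Longrightarrow> b i \<noteq> 0"
    and \<Lambda>: "\<And>z z'. z \<in> space M \<Longrightarrow> z' \<in> space M \<Longrightarrow> \<bar>\<Sum>i\<in>I. c i * e i z * e i z'\<bar> \<le> \<Lambda>"
    and \<kappa>: "\<And>z z'. z \<in> space M \<Longrightarrow> z' \<in> space M \<Longrightarrow> \<bar>\<Sum>i\<in>I. (c i / b i)\<^sup>2 * e i z * e i z'\<bar> \<le> \<kappa>"
    and h: "\<And>t. (h has_real_derivative h' t) (at t)" "\<And>t. \<bar>h t\<bar> \<le> 1" "\<And>t. \<bar>h' t\<bar> \<le> L"
    and h'[measurable]: "h' \<in> borel_measurable borel"
    and f[measurable]: "f \<in> borel_measurable (PiM {..<n} (\<lambda>_. M))"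
    and f1: "\<And>zs. zs \<in> space (PiM {..<n} (\<lambda>_. M)) \<Longrightarrow> \<bar>f zs\<bar> \<le> 1"
    and j: "j < n"
  defines "\<Psi> \<equiv> \<lambda>z z'. \<Sum>i\<in>I. c i * e i z * e i z'"
    and "u \<equiv> ham (\<lambda>i. c i / b i)"
    and "U \<equiv> \<lambda>G. \<integral>z. ham (\<lambda>i. c i / b i) G z \<partial>gibbs b G"
  shows "\<bar>\<integral>G. h (U G) * ((\<integral>zs. f zs * ((\<Sum>l<n. \<Psi> (zs j) (zs l)) - n * (\<integral>z. \<Psi> (zs j) z \<partial>gibbs b G)) \<partial>replicas n b G)
       - U G * (\<integral>zs. f zs \<partial>replicas n b G)) \<partial>gauss I\<bar>
     \<le> (1 + L * \<Lambda>) * (\<integral>G. (\<integral>z. \<bar>u G z - U G\<bar> \<partial>gibbs b G) \<partial>gauss I) + L * \<kappa>"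
proof -
  interpret \<Gamma>: prob_space "gauss I" by (rule prob_space_gauss)
  interpret P: prob_space "PiM {..<n} (\<lambda>_. M)" by (rule prob_space_product)
  define q where "q = (\<lambda>i. c i / b i)"
  have qb: "q i * b i = c i" if "i \<in> I" for i using b[OF that] by (simp add: q_def)
  have u_def': "u G z = ham q G z" for G z by (simp add: u_def q_def)
  have U_def': "U G = (\<integral>z. u G z \<partial>gibbs b G)" for G by (simp add: U_def u_def)
  have L0: "0 \<le> L" using h(3)[of 0] by linarith
  have fb: "bounded_measurable (PiM {..<n} (\<lambda>_. M)) f"
    using f f1 by (rule bounded_measurableI)
  have ub[intro!]: "bounded_measurable M (u G)" for G unfolding u_def by auto
  define \<tau> where "\<tau> = (\<lambda>G. \<integral>z. \<bar>u G z - U G\<bar> \<partial>gibbs b G)"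
  define E where "E = (\<lambda>i G. \<integral>z. e i z \<partial>gibbs b G)"
  define A where "A = (\<lambda>i G. \<integral>zs. f zs * e i (zs j) \<partial>replicas n b G)"
  \<comment> \<open>\<open>D i\<close> and \<open>B i\<close> are the derivatives of \<open>U\<close> and of \<open>A i\<close> in the \<open>i\<close>-th Gaussian variable; \<open>Y\<close> and \<open>X\<close>
     collect the terms with \<open>h\<close> and with \<open>h'\<close> after summation over \<open>i\<close>.\<close>
  define D where "D = (\<lambda>i G. q i * E i G + b i * ((\<integral>z. u G z * e i z \<partial>gibbs b G) - U G * E i G))"
  define B where "B = (\<lambda>i G. b i * ((\<Sum>l<n. \<integral>zs. f zs * e i (zs j) * e i (zs l) \<partial>replicas n b G) - A i G * (n * E i G)))"
  define Y where "Y = (\<lambda>G. \<integral>zs. f zs * ((\<Sum>l<n. \<Psi> (zs j) (zs l)) - n * (\<integral>z. \<Psi> (zs j) z \<partial>gibbs b G)) \<partial>replicas n b G)"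
  define X where "X = (\<lambda>G. \<Sum>i\<in>I. q i * (D i G * A i G))"
  define Q where "Q = (\<lambda>G. \<Sum>k\<in>I. \<bar>q k\<bar> * \<bar>G k\<bar>)"
  have fe: "bounded_measurable (PiM {..<n} (\<lambda>_. M)) (\<lambda>zs. f zs * e i (zs j))" if "i \<in> I" for i
    using that j by (intro bounded_measurable_mult fb bounded_measurable_component) auto
  have fee: "bounded_measurable (PiM {..<n} (\<lambda>_. M)) (\<lambda>zs. f zs * e i (zs j) * e i (zs l))" if "i \<in> I" "l < n" for i l
    using that by (intro bounded_measurable_mult fe bounded_measurable_component) auto
  have fe1: "\<bar>f zs * e i (zs j)\<bar> \<le> 1" if "i \<in> I" "zs \<in> space (PiM {..<n} (\<lambda>_. M))" for i zs
    using mult_mono[OF f1[OF that(2)] e_le_1[OF that(1) space_productD[OF that(2) j]]]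
    by (simp add: abs_mult)
  have E1: "\<bar>E i G\<bar> \<le> 1" if "i \<in> I" for i G
    unfolding E_def using that by (intro abs_integral_gibbs_le e_measurable e_le_1)
  have A1: "\<bar>A i G\<bar> \<le> 1" if "i \<in> I" for i G
    unfolding A_def using that by (intro abs_integral_replicas_le bounded_measurableD fe fe1)
  have uQ: "\<bar>u G z\<bar> \<le> Q G" if "z \<in> space M" for G z
    unfolding u_def' Q_def using that by (rule ham_abs_le)
  have UQ: "\<bar>U G\<bar> \<le> Q G" for G
    unfolding U_def' by (intro abs_integral_gibbs_le bounded_measurableD uQ) auto
  have ueQ: "\<bar>\<integral>z. u G z * e i z \<partial>gibbs b G\<bar> \<le> Q G" if "i \<in> I" for G i
  proof (rule abs_integral_gibbs_le)
    show "(\<lambda>z. u G z * e i z) \<in> borel_measurable M" using that by (intro bounded_measurableD) auto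
    fix z assume z: "z \<in> space M"
    show "\<bar>u G z * e i z\<bar> \<le> Q G"
      using mult_mono[OF uQ[OF z] e_le_1[OF that z]] uQ[OF z, of G] by (simp add: abs_mult)
  qed
  have Um[measurable]: "U \<in> borel_measurable (gauss I)"
    unfolding U_def' u_def' by (rule measurable_gibbs_G) measurable
  have Em[measurable]: "E i \<in> borel_measurable (gauss I)" if "i \<in> I" for i
    unfolding E_def using that by (intro measurable_gibbs_G' e_measurable)
  have Am[measurable]: "A i \<in> borel_measurable (gauss I)" if "i \<in> I" for i
    unfolding A_def using that by (intro measurable_replicas_G bounded_measurableD fe)
  have Dm[measurable]: "D i \<in> borel_measurable (gauss I)" if "i \<in> I" for i
  proof -
    have [measurable]: "(\<lambda>G. \<integral>z. u G z * e i z \<partial>gibbs b G) \<in> borel_measurable (gauss I)"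
      unfolding u_def' using that by (intro measurable_gibbs_G) measurable
    show ?thesis unfolding D_def using that by measurable
  qed
  have Bm[measurable]: "B i \<in> borel_measurable (gauss I)" if "i \<in> I" for i
  proof -
    have [measurable]: "(\<lambda>G. \<integral>zs. f zs * e i (zs j) * e i (zs l) \<partial>replicas n b G) \<in> borel_measurable (gauss I)" if "l < n" for l
      using that \<open>i \<in> I\<close> by (intro measurable_replicas_G bounded_measurableD fee)
    show ?thesis unfolding B_def using that by measurable
  qed
  have \<tau>m[measurable]: "\<tau> \<in> borel_measurable (gauss I)"
    unfolding \<tau>_def u_def' by (rule measurable_gibbs_G) measurable
  have hm[measurable]: "h \<in> borel_measurable borel"
    by (intro borel_measurable_continuous_onI continuous_at_imp_continuous_on)
       (use h(1) DERIV_isCont in blast)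
  have iQ: "integrable (gauss I) Q"
    unfolding Q_def by (intro Bochner_Integration.integrable_sum integrable_mult_right integrable_gauss_component)
  have Q0: "0 \<le> Q G" for G unfolding Q_def by (intro sum_nonneg) auto

  have dU: "((\<lambda>t. U (G(i := t))) has_real_derivative D i (G(i := t))) (at t)" if i: "i \<in> I" for i G t
  proof -
    have Ut: "U (G(i := t)) = (\<integral>z. u (G(i := 0)) z \<partial>gibbs b (G(i := t))) + t * q i * E i (G(i := t))" for t
    proof -
      have "U (G(i := t)) = (\<integral>z. u (G(i := 0)) z + t * (q i * e i z) \<partial>gibbs b (G(i := t)))"
        unfolding U_def' u_def' ham_upd[OF i, of q G t] ..
      also have "\<dots> = (\<integral>z. u (G(i := 0)) z \<partial>gibbs b (G(i := t))) + (\<integral>z. t * (q i * e i z) \<partial>gibbs b (G(i := t)))"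
        using i by (intro Bochner_Integration.integral_add integrable_gibbs) auto
      finally show ?thesis by (simp add: E_def)
    qed
    have ue: "(\<integral>z. u (G(i := t)) z * e i z \<partial>gibbs b (G(i := t)))
       = (\<integral>z. u (G(i := 0)) z * e i z \<partial>gibbs b (G(i := t))) + t * q i * (\<integral>z. e i z * e i z \<partial>gibbs b (G(i := t)))" for t
    proof -
      have "(\<integral>z. u (G(i := t)) z * e i z \<partial>gibbs b (G(i := t)))
         = (\<integral>z. u (G(i := 0)) z * e i z + t * q i * (e i z * e i z) \<partial>gibbs b (G(i := t)))"
        unfolding u_def' ham_upd[OF i, of q G t]
        by (intro Bochner_Integration.integral_cong refl) (simp add: algebra_simps)
      also have "\<dots> = (\<integral>z. u (G(i := 0)) z * e i z \<partial>gibbs b (G(i := t))) + (\<integral>z. t * q i * (e i z * e i z) \<partial>gibbs b (G(i := t)))"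
        using i by (intro Bochner_Integration.integral_add integrable_gibbs) auto
      finally show ?thesis by simp
    qed
    have dt: "((\<lambda>t. t * q i) has_real_derivative q i) (at t)"
      by (auto intro!: derivative_eq_intros)
    show ?thesis
      unfolding Ut E_def
      by (rule DERIV_cong[OF DERIV_add[OF gibbs_has_derivative[OF i ub]
            DERIV_mult[OF dt gibbs_has_derivative[OF i bounded_measurable_e[OF i]]]]])
         (simp only: D_def ue Ut E_def, simp add: algebra_simps)
  qed
  have dA: "((\<lambda>t. A i (G(i := t))) has_real_derivative B i (G(i := t))) (at t)" if i: "i \<in> I" for i G t
    unfolding A_def B_def E_def using replicas_has_derivative[OF i fe[OF i]] by simp

  have ibp: "integrable (gauss I) (\<lambda>G. G i * (h (U G) * A i G))"
     "integrable (gauss I) (\<lambda>G. h' (U G) * D i G * A i G + h (U G) * B i G)"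
     "(\<integral>G. G i * (h (U G) * A i G) \<partial>gauss I) = (\<integral>G. h' (U G) * D i G * A i G + h (U G) * B i G \<partial>gauss I)"
    if i: "i \<in> I" for i
  proof -
    note m = finite_I i
    have der: "((\<lambda>t. h (U (G(i := t))) * A i (G(i := t))) has_real_derivative
          h' (U (G(i := t))) * D i (G(i := t)) * A i (G(i := t)) + h (U (G(i := t))) * B i (G(i := t))) (at t)" for G t
      by (rule DERIV_cong[OF DERIV_mult[OF DERIV_chain2[OF h(1) dU[OF i]] dA[OF i]]]) (simp add: algebra_simps)
    have bd: "\<bar>h (U G) * A i G\<bar> \<le> 1" for G
      using mult_mono[OF h(2)[of "U G"] A1[OF i, of G]] by (simp add: abs_mult)
    have Dle: "\<bar>D i G\<bar> \<le> \<bar>q i\<bar> + \<bar>b i\<bar> * (2 * Q G)" for G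
    proof -
      have "\<bar>U G * E i G\<bar> \<le> Q G" using mult_mono[OF UQ[of G] E1[OF i, of G]] Q0[of G] by (simp add: abs_mult)
      then have "\<bar>(\<integral>z. u G z * e i z \<partial>gibbs b G) - U G * E i G\<bar> \<le> 2 * Q G"
        using ueQ[OF i, of G] by linarith
      then have "\<bar>b i * ((\<integral>z. u G z * e i z \<partial>gibbs b G) - U G * E i G)\<bar> \<le> \<bar>b i\<bar> * (2 * Q G)"
        by (simp add: abs_mult mult_left_mono)
      moreover have "\<bar>q i * E i G\<bar> \<le> \<bar>q i\<bar>" using mult_left_mono[OF E1[OF i, of G], of "\<bar>q i\<bar>"] by (simp add: abs_mult)
      ultimately show ?thesis unfolding D_def by linarith
    qed
    have Ble: "\<bar>B i G\<bar> \<le> \<bar>b i\<bar> * (2 * real n)" for G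
    proof -
      have "\<bar>\<Sum>l<n. \<integral>zs. f zs * e i (zs j) * e i (zs l) \<partial>replicas n b G\<bar> \<le> (\<Sum>l<n. 1)"
      proof (rule order_trans[OF sum_abs sum_mono], rule abs_integral_replicas_le)
        fix l zs assume l: "l \<in> {..<n}" and zs: "zs \<in> space (PiM {..<n} (\<lambda>_. M))"
        show "\<bar>f zs * e i (zs j) * e i (zs l)\<bar> \<le> 1"
          using mult_mono[OF fe1[OF i zs] e_le_1[OF i space_productD[OF zs, of l]]] l by (simp add: abs_mult)
      qed (use fee[OF i] in \<open>auto intro: bounded_measurableD\<close>)
      moreover have "\<bar>A i G * (n * E i G)\<bar> \<le> n"
      proof -
        have "\<bar>A i G\<bar> * \<bar>E i G\<bar> \<le> 1" using mult_mono[OF A1[OF i, of G] E1[OF i, of G]] by simp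
        then have "real n * (\<bar>A i G\<bar> * \<bar>E i G\<bar>) \<le> real n * 1" by (intro mult_left_mono) auto
        then show ?thesis by (simp add: abs_mult mult_ac)
      qed
      ultimately have "\<bar>(\<Sum>l<n. \<integral>zs. f zs * e i (zs j) * e i (zs l) \<partial>replicas n b G) - A i G * (n * E i G)\<bar> \<le> 2 * real n"
        by simp
      then show ?thesis unfolding B_def by (simp add: abs_mult mult_left_mono)
    qed
    define qm where "qm = (\<Sum>k\<in>I. \<bar>q k\<bar>)"
    have Qle: "Q G \<le> qm * (\<Sum>k\<in>I. \<bar>G k\<bar>)" for G
      unfolding Q_def sum_distrib_left
    proof (intro sum_mono mult_right_mono)
      fix k assume "k \<in> I"
      then show "\<bar>q k\<bar> \<le> qm" unfolding qm_def using finite_I by (intro member_le_sum) auto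
    qed simp
    have gr: "\<bar>h' (U G) * D i G * A i G + h (U G) * B i G\<bar>
        \<le> (L * \<bar>q i\<bar> + \<bar>b i\<bar> * (2 * real n)) + L * \<bar>b i\<bar> * 2 * qm * (\<Sum>k\<in>I. \<bar>G k\<bar>)" for G
    proof -
      have "\<bar>h' (U G)\<bar> * \<bar>D i G\<bar> * \<bar>A i G\<bar> \<le> L * (\<bar>q i\<bar> + \<bar>b i\<bar> * (2 * Q G)) * 1"
        using L0 Q0[of G] by (intro mult_mono h(3) Dle A1 i mult_nonneg_nonneg add_nonneg_nonneg) auto
      also have "\<dots> \<le> L * (\<bar>q i\<bar> + \<bar>b i\<bar> * (2 * (qm * (\<Sum>k\<in>I. \<bar>G k\<bar>))))"
        using L0 Qle[of G] by (simp add: mult_left_mono)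
      finally have 1: "\<bar>h' (U G) * D i G * A i G\<bar> \<le> L * (\<bar>q i\<bar> + \<bar>b i\<bar> * (2 * (qm * (\<Sum>k\<in>I. \<bar>G k\<bar>))))"
        by (simp add: abs_mult)
      have "\<bar>h (U G)\<bar> * \<bar>B i G\<bar> \<le> 1 * (\<bar>b i\<bar> * (2 * real n))"
        by (intro mult_mono h(2) Ble) auto
      then have 2: "\<bar>h (U G) * B i G\<bar> \<le> \<bar>b i\<bar> * (2 * real n)" by (simp add: abs_mult)
      have "\<bar>h' (U G) * D i G * A i G + h (U G) * B i G\<bar> \<le>
         L * (\<bar>q i\<bar> + \<bar>b i\<bar> * (2 * (qm * (\<Sum>k\<in>I. \<bar>G k\<bar>)))) + \<bar>b i\<bar> * (2 * real n)"
        using 1 2 by linarith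
      then show ?thesis by (simp add: algebra_simps)
    qed
    have m1: "(\<lambda>G. h (U G) * A i G) \<in> borel_measurable (gauss I)"
      "(\<lambda>G. h' (U G) * D i G * A i G + h (U G) * B i G) \<in> borel_measurable (gauss I)"
      using i by measurable
    show "integrable (gauss I) (\<lambda>G. G i * (h (U G) * A i G))"
     "integrable (gauss I) (\<lambda>G. h' (U G) * D i G * A i G + h (U G) * B i G)"
     "(\<integral>G. G i * (h (U G) * A i G) \<partial>gauss I) = (\<integral>G. h' (U G) * D i G * A i G + h (U G) * B i G \<partial>gauss I)"
      by (rule gauss_ibp[OF finite_I i m1 der bd gr])+
  qed

  have Aq: "(\<Sum>i\<in>I. q i * (G i * (h (U G) * A i G))) = h (U G) * (\<integral>zs. f zs * u G (zs j) \<partial>replicas n b G)" for G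
  proof -
    have "(\<integral>zs. f zs * u G (zs j) \<partial>replicas n b G) = (\<integral>zs. (\<Sum>i\<in>I. q i * G i * (f zs * e i (zs j))) \<partial>replicas n b G)"
      unfolding u_def' ham_def by (intro Bochner_Integration.integral_cong refl) (simp add: sum_distrib_left mult_ac)
    also have "\<dots> = (\<Sum>i\<in>I. \<integral>zs. q i * G i * (f zs * e i (zs j)) \<partial>replicas n b G)"
      by (intro Bochner_Integration.integral_sum integrable_mult_right integrable_replicas fe)
    also have "\<dots> = (\<Sum>i\<in>I. q i * G i * A i G)" unfolding A_def by simp
    finally show ?thesis by (simp add: sum_distrib_left mult_ac)
  qed
  have kE: "(\<Sum>i\<in>I. a i * E i G * A i G) = (\<integral>zs. f zs * (\<integral>z. (\<Sum>i\<in>I. a i * e i (zs j) * e i z) \<partial>gibbs b G) \<partial>replicas n b G)" for a G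
    using kernel_integral[OF j fb, where w="\<lambda>_. 1" and a=a and b=b and G=G] unfolding E_def A_def by simp
  have Bq: "(\<Sum>i\<in>I. q i * (h (U G) * B i G)) = h (U G) * Y G" for G
  proof -
    have pair: "(\<integral>zs. f zs * \<Psi> (zs j) (zs l) \<partial>replicas n b G) = (\<Sum>i\<in>I. c i * (\<integral>zs. f zs * e i (zs j) * e i (zs l) \<partial>replicas n b G))"
      if l: "l < n" for l
    proof -
      have "(\<integral>zs. f zs * \<Psi> (zs j) (zs l) \<partial>replicas n b G) = (\<integral>zs. (\<Sum>i\<in>I. c i * (f zs * e i (zs j) * e i (zs l))) \<partial>replicas n b G)"
        unfolding \<Psi>_def by (intro Bochner_Integration.integral_cong refl) (simp add: sum_distrib_left mult_ac)
      also have "\<dots> = (\<Sum>i\<in>I. \<integral>zs. c i * (f zs * e i (zs j) * e i (zs l)) \<partial>replicas n b G)"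
        using l by (intro Bochner_Integration.integral_sum integrable_mult_right integrable_replicas fee) auto
      finally show ?thesis by simp
    qed
    have b1: "bounded_measurable (PiM {..<n} (\<lambda>_. M)) (\<lambda>zs. f zs * \<Psi> (zs j) (zs l))" if "l < n" for l
      unfolding \<Psi>_def using j that
      by (intro bounded_measurable_mult bounded_measurable_sum fb bounded_measurable_component bounded_measurable_const bounded_measurable_e)
    have inner: "(\<integral>z. \<Psi> (zs j) z \<partial>gibbs b G) = (\<Sum>i\<in>I. c i * E i G * e i (zs j))" for zs
    proof -
      have "(\<integral>z. \<Psi> (zs j) z \<partial>gibbs b G) = (\<Sum>i\<in>I. \<integral>z. c i * e i (zs j) * e i z \<partial>gibbs b G)"
        unfolding \<Psi>_def by (intro Bochner_Integration.integral_sum integrable_gibbs) auto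
      then show ?thesis by (simp add: E_def mult_ac)
    qed
    have b2: "bounded_measurable (PiM {..<n} (\<lambda>_. M)) (\<lambda>zs. f zs * (\<integral>z. \<Psi> (zs j) z \<partial>gibbs b G))"
      unfolding inner using j
      by (intro bounded_measurable_mult bounded_measurable_sum fb bounded_measurable_component bounded_measurable_const bounded_measurable_e)
    have "Y G = (\<integral>zs. (\<Sum>l<n. f zs * \<Psi> (zs j) (zs l)) - n * (f zs * (\<integral>z. \<Psi> (zs j) z \<partial>gibbs b G)) \<partial>replicas n b G)"
      unfolding Y_def by (intro Bochner_Integration.integral_cong refl) (simp add: algebra_simps sum_distrib_left)
    also have "\<dots> = (\<Sum>l<n. \<integral>zs. f zs * \<Psi> (zs j) (zs l) \<partial>replicas n b G) - n * (\<integral>zs. f zs * (\<integral>z. \<Psi> (zs j) z \<partial>gibbs b G) \<partial>replicas n b G)"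
    proof -
      have "integrable (replicas n b G) (\<lambda>zs. \<Sum>l<n. f zs * \<Psi> (zs j) (zs l))"
        by (intro Bochner_Integration.integrable_sum integrable_replicas b1) auto
      moreover have "integrable (replicas n b G) (\<lambda>zs. n * (f zs * (\<integral>z. \<Psi> (zs j) z \<partial>gibbs b G)))"
        by (intro integrable_mult_right integrable_replicas b2)
      moreover have "(\<integral>zs. (\<Sum>l<n. f zs * \<Psi> (zs j) (zs l)) \<partial>replicas n b G) = (\<Sum>l<n. \<integral>zs. f zs * \<Psi> (zs j) (zs l) \<partial>replicas n b G)"
        by (intro Bochner_Integration.integral_sum integrable_replicas b1) auto
      ultimately show ?thesis by (simp only: Bochner_Integration.integral_diff integral_mult_right_zero)
    qed
    also have "\<dots> = (\<Sum>l<n. \<Sum>i\<in>I. c i * (\<integral>zs. f zs * e i (zs j) * e i (zs l) \<partial>replicas n b G)) - n * (\<Sum>i\<in>I. c i * E i G * A i G)"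
      using kE[of c G] pair by (simp add: \<Psi>_def[abs_def])
    also have "\<dots> = (\<Sum>i\<in>I. q i * B i G)"
    proof -
      have "(\<Sum>i\<in>I. q i * B i G) = (\<Sum>i\<in>I. (q i * b i) * ((\<Sum>l<n. \<integral>zs. f zs * e i (zs j) * e i (zs l) \<partial>replicas n b G) - A i G * (n * E i G)))"
        unfolding B_def by (simp add: mult.assoc)
      also have "\<dots> = (\<Sum>i\<in>I. c i * ((\<Sum>l<n. \<integral>zs. f zs * e i (zs j) * e i (zs l) \<partial>replicas n b G) - A i G * (n * E i G)))"
        by (intro sum.cong refl) (simp add: qb)
      also have "\<dots> = (\<Sum>i\<in>I. \<Sum>l<n. c i * (\<integral>zs. f zs * e i (zs j) * e i (zs l) \<partial>replicas n b G)) - n * (\<Sum>i\<in>I. c i * E i G * A i G)"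
        by (simp add: right_diff_distrib sum_subtractf sum_distrib_left mult_ac)
      finally show ?thesis by (subst sum.swap) simp
    qed
    finally show ?thesis by (simp add: sum_distrib_left mult_ac)
  qed
  have Xq: "(\<Sum>i\<in>I. q i * (h' (U G) * D i G * A i G)) = h' (U G) * X G" for G
    unfolding X_def by (simp add: sum_distrib_left mult_ac)
  have Xle: "\<bar>X G\<bar> \<le> \<kappa> + \<Lambda> * \<tau> G" for G
  proof -
    have cov: "(\<integral>z. u G z * e i z \<partial>gibbs b G) - U G * E i G = (\<integral>z. (u G z - U G) * e i z \<partial>gibbs b G)" if i: "i \<in> I" for i
    proof -
      have "(\<integral>z. (u G z - U G) * e i z \<partial>gibbs b G) = (\<integral>z. u G z * e i z - U G * e i z \<partial>gibbs b G)"
        by (simp add: left_diff_distrib)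
      also have "\<dots> = (\<integral>z. u G z * e i z \<partial>gibbs b G) - (\<integral>z. U G * e i z \<partial>gibbs b G)"
        using i by (intro Bochner_Integration.integral_diff integrable_gibbs) auto
      finally show ?thesis by (simp add: E_def)
    qed
    have "X G = (\<Sum>i\<in>I. (q i)\<^sup>2 * E i G * A i G + (q i * b i) * (\<integral>z. (u G z - U G) * e i z \<partial>gibbs b G) * A i G)"
      unfolding X_def D_def by (intro sum.cong refl) (simp only: cov[symmetric], simp add: power2_eq_square algebra_simps)
    also have "\<dots> = (\<Sum>i\<in>I. (q i)\<^sup>2 * E i G * A i G) + (\<Sum>i\<in>I. c i * (\<integral>z. (u G z - U G) * e i z \<partial>gibbs b G) * A i G)"
      by (simp add: sum.distrib qb)
    also have "(\<Sum>i\<in>I. c i * (\<integral>z. (u G z - U G) * e i z \<partial>gibbs b G) * A i G)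
       = (\<integral>zs. f zs * (\<integral>z. (u G z - U G) * (\<Sum>i\<in>I. c i * e i (zs j) * e i z) \<partial>gibbs b G) \<partial>replicas n b G)"
      unfolding A_def by (rule kernel_integral[OF j fb, symmetric]) auto
    also have "(\<Sum>i\<in>I. (q i)\<^sup>2 * E i G * A i G)
       = (\<integral>zs. f zs * (\<integral>z. (\<Sum>i\<in>I. (q i)\<^sup>2 * e i (zs j) * e i z) \<partial>gibbs b G) \<partial>replicas n b G)"
      by (rule kE)
    finally have XG: "X G = (\<integral>zs. f zs * (\<integral>z. (\<Sum>i\<in>I. (q i)\<^sup>2 * e i (zs j) * e i z) \<partial>gibbs b G) \<partial>replicas n b G)
       + (\<integral>zs. f zs * (\<integral>z. (u G z - U G) * (\<Sum>i\<in>I. c i * e i (zs j) * e i z) \<partial>gibbs b G) \<partial>replicas n b G)" .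
    have le: "\<bar>\<integral>zs. f zs * (\<integral>z. w z * (\<Sum>i\<in>I. a i * e i (zs j) * e i z) \<partial>gibbs b G) \<partial>replicas n b G\<bar> \<le> K * (\<integral>z. \<bar>w z\<bar> \<partial>gibbs b G)"
      if w: "bounded_measurable M w" and K: "\<And>z z'. z \<in> space M \<Longrightarrow> z' \<in> space M \<Longrightarrow> \<bar>\<Sum>i\<in>I. a i * e i z * e i z'\<bar> \<le> K" for w a K
    proof (rule abs_integral_replicas_le)
      have "(\<integral>z. w z * (\<Sum>i\<in>I. a i * x i * e i z) \<partial>gibbs b G) = (\<Sum>i\<in>I. x i * (a i * (\<integral>z. w z * e i z \<partial>gibbs b G)))" for x
      proof -
        have "(\<integral>z. w z * (\<Sum>i\<in>I. a i * x i * e i z) \<partial>gibbs b G) = (\<integral>z. (\<Sum>i\<in>I. x i * a i * (w z * e i z)) \<partial>gibbs b G)"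
          by (intro Bochner_Integration.integral_cong refl) (simp add: sum_distrib_left mult_ac)
        also have "\<dots> = (\<Sum>i\<in>I. \<integral>z. x i * a i * (w z * e i z) \<partial>gibbs b G)"
          using w by (intro Bochner_Integration.integral_sum integrable_gibbs) auto
        finally show ?thesis by (simp add: mult.assoc)
      qed
      note lin = this
      show "(\<lambda>zs. f zs * (\<integral>z. w z * (\<Sum>i\<in>I. a i * e i (zs j) * e i z) \<partial>gibbs b G)) \<in> borel_measurable (PiM {..<n} (\<lambda>_. M))"
        unfolding lin using j
        by (intro bounded_measurableD bounded_measurable_mult bounded_measurable_sum fb bounded_measurable_component bounded_measurable_const bounded_measurable_e)
      fix zs assume zs: "zs \<in> space (PiM {..<n} (\<lambda>_. M))"
      note zj = space_productD[OF zs j]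
      have "\<bar>\<integral>z. w z * (\<Sum>i\<in>I. a i * e i (zs j) * e i z) \<partial>gibbs b G\<bar> \<le> (\<integral>z. \<bar>w z * (\<Sum>i\<in>I. a i * e i (zs j) * e i z)\<bar> \<partial>gibbs b G)"
        by (rule integral_abs_bound)
      also have "\<dots> \<le> (\<integral>z. K * \<bar>w z\<bar> \<partial>gibbs b G)"
      proof (rule integral_mono)
        fix z assume "z \<in> space (gibbs b G)"
        then have z: "z \<in> space M" by simp
        show "\<bar>w z * (\<Sum>i\<in>I. a i * e i (zs j) * e i z)\<bar> \<le> K * \<bar>w z\<bar>"
          using mult_left_mono[OF K[OF zj z], of "\<bar>w z\<bar>"] by (simp add: abs_mult mult.commute)
      qed (use w in \<open>auto intro!: integrable_gibbs\<close>)
      also have "\<dots> = K * (\<integral>z. \<bar>w z\<bar> \<partial>gibbs b G)" by simp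
      finally have "\<bar>f zs\<bar> * \<bar>\<integral>z. w z * (\<Sum>i\<in>I. a i * e i (zs j) * e i z) \<partial>gibbs b G\<bar> \<le> 1 * (K * (\<integral>z. \<bar>w z\<bar> \<partial>gibbs b G))"
        using f1[OF zs] by (intro mult_mono) auto
      then show "\<bar>f zs * (\<integral>z. w z * (\<Sum>i\<in>I. a i * e i (zs j) * e i z) \<partial>gibbs b G)\<bar> \<le> K * (\<integral>z. \<bar>w z\<bar> \<partial>gibbs b G)"
        by (simp add: abs_mult)
    qed
    interpret gb: prob_space "gibbs b G" by (rule prob_space_gibbs)
    have "\<bar>\<integral>zs. f zs * (\<integral>z. (\<Sum>i\<in>I. (q i)\<^sup>2 * e i (zs j) * e i z) \<partial>gibbs b G) \<partial>replicas n b G\<bar> \<le> \<kappa>"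
      using le[of "\<lambda>_. 1" "\<lambda>i. (q i)\<^sup>2" \<kappa>] \<kappa> gb.prob_space unfolding q_def by simp
    moreover have "\<bar>\<integral>zs. f zs * (\<integral>z. (u G z - U G) * (\<Sum>i\<in>I. c i * e i (zs j) * e i z) \<partial>gibbs b G) \<partial>replicas n b G\<bar> \<le> \<Lambda> * \<tau> G"
      unfolding \<tau>_def by (rule le) (use \<Lambda> in auto)
    ultimately show ?thesis unfolding XG by linarith
  qed
  have \<tau>le: "\<bar>\<tau> G\<bar> \<le> 2 * Q G" for G
    unfolding \<tau>_def
  proof (rule abs_integral_gibbs_le)
    show "(\<lambda>z. \<bar>u G z - U G\<bar>) \<in> borel_measurable M" by (intro bounded_measurableD) auto
    fix z assume "z \<in> space M"
    from uQ[OF this, of G] UQ[of G] show "\<bar>\<bar>u G z - U G\<bar>\<bar> \<le> 2 * Q G" by linarith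
  qed
  have i\<tau>: "integrable (gauss I) \<tau>"
  proof (rule Bochner_Integration.integrable_bound)
    show "integrable (gauss I) (\<lambda>G. 2 * Q G)" using iQ by simp
    show "AE G in gauss I. norm (\<tau> G) \<le> norm (2 * Q G)"
      using \<tau>le by (intro AE_I2) (metis abs_ge_self order_trans real_norm_def)
  qed simp
  have Xm[measurable]: "X \<in> borel_measurable (gauss I)" unfolding X_def by measurable
  have ihX: "integrable (gauss I) (\<lambda>G. h' (U G) * X G)"
  proof (rule Bochner_Integration.integrable_bound)
    show "integrable (gauss I) (\<lambda>G. L * (\<kappa> + \<Lambda> * \<tau> G))" using i\<tau> by simp
    show "AE G in gauss I. norm (h' (U G) * X G) \<le> norm (L * (\<kappa> + \<Lambda> * \<tau> G))"
    proof (intro AE_I2)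
      fix G
      have "\<bar>h' (U G)\<bar> * \<bar>X G\<bar> \<le> L * (\<kappa> + \<Lambda> * \<tau> G)" by (intro mult_mono h Xle) (use L0 in auto)
      then have "\<bar>h' (U G) * X G\<bar> \<le> L * (\<kappa> + \<Lambda> * \<tau> G)" by (simp add: abs_mult)
      then show "norm (h' (U G) * X G) \<le> norm (L * (\<kappa> + \<Lambda> * \<tau> G))"
        unfolding real_norm_def using abs_ge_self order_trans by blast
    qed
  qed measurable
  have i1: "integrable (gauss I) (\<lambda>G. h (U G) * (\<integral>zs. f zs * u G (zs j) \<partial>replicas n b G))"
    unfolding Aq[symmetric] using ibp(1) by (intro Bochner_Integration.integrable_sum integrable_mult_right)
  have i2: "integrable (gauss I) (\<lambda>G. h' (U G) * X G + h (U G) * Y G)"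
  proof -
    have "integrable (gauss I) (\<lambda>G. \<Sum>i\<in>I. q i * (h' (U G) * D i G * A i G + h (U G) * B i G))"
      using ibp(2) by (intro Bochner_Integration.integrable_sum integrable_mult_right)
    then show ?thesis by (simp add: distrib_left sum.distrib Xq Bq)
  qed
  have i3: "integrable (gauss I) (\<lambda>G. h (U G) * Y G)"
    using Bochner_Integration.integrable_diff[OF i2 ihX] by simp
  have main: "(\<integral>G. h (U G) * (\<integral>zs. f zs * u G (zs j) \<partial>replicas n b G) \<partial>gauss I)
     = (\<integral>G. h' (U G) * X G \<partial>gauss I) + (\<integral>G. h (U G) * Y G \<partial>gauss I)"
  proof -
    have "(\<integral>G. h (U G) * (\<integral>zs. f zs * u G (zs j) \<partial>replicas n b G) \<partial>gauss I)
      = (\<Sum>i\<in>I. q i * (\<integral>G. G i * (h (U G) * A i G) \<partial>gauss I))"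
      unfolding Aq[symmetric] using ibp(1) by (subst Bochner_Integration.integral_sum) auto
    also have "\<dots> = (\<integral>G. (\<Sum>i\<in>I. q i * (h' (U G) * D i G * A i G + h (U G) * B i G)) \<partial>gauss I)"
      using ibp(2,3) by (subst Bochner_Integration.integral_sum) auto
    also have "\<dots> = (\<integral>G. h' (U G) * X G + h (U G) * Y G \<partial>gauss I)"
      by (simp add: distrib_left sum.distrib Xq Bq)
    finally show ?thesis using ihX i3 by simp
  qed
  define V where "V = (\<lambda>G. (\<integral>zs. f zs * u G (zs j) \<partial>replicas n b G) - U G * (\<integral>zs. f zs \<partial>replicas n b G))"
  have Vle: "\<bar>V G\<bar> \<le> \<tau> G" for G
  proof -
    interpret rp: prob_space "replicas n b G" by (rule prob_space_replicas)
    have uc: "bounded_measurable (PiM {..<n} (\<lambda>_. M)) (\<lambda>zs. u G (zs j))"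
      using j by (intro bounded_measurable_component) auto
    have "V G = (\<integral>zs. f zs * u G (zs j) - U G * f zs \<partial>replicas n b G)"
      unfolding V_def using fb uc
      by (subst Bochner_Integration.integral_diff) (auto intro!: integrable_replicas)
    also have "\<dots> = (\<integral>zs. f zs * (u G (zs j) - U G) \<partial>replicas n b G)"
      by (simp add: algebra_simps)
    also have "\<bar>\<dots>\<bar> \<le> (\<integral>zs. \<bar>f zs * (u G (zs j) - U G)\<bar> \<partial>replicas n b G)" by (rule integral_abs_bound)
    also have "\<dots> \<le> (\<integral>zs. \<bar>u G (zs j) - U G\<bar> \<partial>replicas n b G)"
    proof (rule integral_mono)
      fix zs assume "zs \<in> space (replicas n b G)"
      then show "\<bar>f zs * (u G (zs j) - U G)\<bar> \<le> \<bar>u G (zs j) - U G\<bar>"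
        using mult_right_mono[OF f1[of zs], of "\<bar>u G (zs j) - U G\<bar>"] by (simp add: abs_mult)
    qed (use fb uc in \<open>auto intro!: integrable_replicas\<close>)
    also have "\<dots> = \<tau> G" unfolding \<tau>_def 
      by (rule integral_replica_component[OF j]) (intro bounded_measurableD, auto)
    finally show ?thesis .
  qed
  have i4: "integrable (gauss I) (\<lambda>G. h (U G) * (U G * (\<integral>zs. f zs \<partial>replicas n b G)))"
  proof (rule Bochner_Integration.integrable_bound[OF iQ])
    have [measurable]: "(\<lambda>G. \<integral>zs. f zs \<partial>replicas n b G) \<in> borel_measurable (gauss I)"
      by (intro measurable_replicas_G f)
    show "(\<lambda>G. h (U G) * (U G * (\<integral>zs. f zs \<partial>replicas n b G))) \<in> borel_measurable (gauss I)" by measurable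
    show "AE G in gauss I. norm (h (U G) * (U G * (\<integral>zs. f zs \<partial>replicas n b G))) \<le> norm (Q G)"
    proof (intro AE_I2)
      fix G
      have "\<bar>\<integral>zs. f zs \<partial>replicas n b G\<bar> \<le> 1" by (intro abs_integral_replicas_le f f1)
      then have "\<bar>h (U G)\<bar> * (\<bar>U G\<bar> * \<bar>\<integral>zs. f zs \<partial>replicas n b G\<bar>) \<le> 1 * (Q G * 1)"
        by (intro mult_mono h(2) UQ) (auto simp: Q0)
      then show "norm (h (U G) * (U G * (\<integral>zs. f zs \<partial>replicas n b G))) \<le> norm (Q G)"
        using Q0[of G] by (simp add: abs_mult)
    qed
  qed
  have "(\<integral>G. h (U G) * (Y G - U G * (\<integral>zs. f zs \<partial>replicas n b G)) \<partial>gauss I)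
     = (\<integral>G. h (U G) * Y G \<partial>gauss I) - (\<integral>G. h (U G) * (U G * (\<integral>zs. f zs \<partial>replicas n b G)) \<partial>gauss I)"
    using i3 i4 by (simp add: right_diff_distrib)
  also have "\<dots> = (\<integral>G. h (U G) * V G \<partial>gauss I) - (\<integral>G. h' (U G) * X G \<partial>gauss I)"
    using i1 i4 main unfolding V_def by (simp add: right_diff_distrib)
  finally have eq: "(\<integral>G. h (U G) * (Y G - U G * (\<integral>zs. f zs \<partial>replicas n b G)) \<partial>gauss I)
     = (\<integral>G. h (U G) * V G \<partial>gauss I) - (\<integral>G. h' (U G) * X G \<partial>gauss I)" .
  have "\<bar>\<integral>G. h (U G) * V G \<partial>gauss I\<bar> \<le> (\<integral>G. \<tau> G \<partial>gauss I)"
  proof -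
    have "integrable (gauss I) (\<lambda>G. h (U G) * V G)"
      unfolding V_def right_diff_distrib using i1 i4 by (intro Bochner_Integration.integrable_diff)
    then have "(\<integral>G. \<bar>h (U G) * V G\<bar> \<partial>gauss I) \<le> (\<integral>G. \<tau> G \<partial>gauss I)"
    proof (intro integral_mono integrable_abs i\<tau>)
      fix G
      have "\<bar>h (U G)\<bar> * \<bar>V G\<bar> \<le> 1 * \<tau> G" by (intro mult_mono h(2) Vle) auto
      then show "\<bar>h (U G) * V G\<bar> \<le> \<tau> G" by (simp add: abs_mult)
    qed
    then show ?thesis using integral_abs_bound[of "gauss I" "\<lambda>G. h (U G) * V G"] by linarith
  qed
  moreover have "\<bar>\<integral>G. h' (U G) * X G \<partial>gauss I\<bar> \<le> L * (\<kappa> + \<Lambda> * (\<integral>G. \<tau> G \<partial>gauss I))"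
  proof -
    have "(\<integral>G. \<bar>h' (U G) * X G\<bar> \<partial>gauss I) \<le> (\<integral>G. L * (\<kappa> + \<Lambda> * \<tau> G) \<partial>gauss I)"
    proof (intro integral_mono integrable_abs ihX)
      show "integrable (gauss I) (\<lambda>G. L * (\<kappa> + \<Lambda> * \<tau> G))" using i\<tau> by simp
      fix G
      have "\<bar>h' (U G)\<bar> * \<bar>X G\<bar> \<le> L * (\<kappa> + \<Lambda> * \<tau> G)" by (intro mult_mono h Xle) (use L0 in auto)
      then show "\<bar>h' (U G) * X G\<bar> \<le> L * (\<kappa> + \<Lambda> * \<tau> G)" by (simp add: abs_mult)
    qed
    also have "\<dots> = L * (\<kappa> + \<Lambda> * (\<integral>G. \<tau> G \<partial>gauss I))" using i\<tau> by (simp add: \<Gamma>.prob_space)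
    finally show ?thesis using integral_abs_bound[of "gauss I" "\<lambda>G. h' (U G) * X G"] by linarith
  qed
  moreover have "(1 + L * \<Lambda>) * (\<integral>G. \<tau> G \<partial>gauss I) + L * \<kappa>
     = (\<integral>G. \<tau> G \<partial>gauss I) + L * (\<kappa> + \<Lambda> * (\<integral>G. \<tau> G \<partial>gauss I))"
    by (simp add: algebra_simps)
  ultimately have "\<bar>\<integral>G. h (U G) * (Y G - U G * (\<integral>zs. f zs \<partial>replicas n b G)) \<partial>gauss I\<bar>
     \<le> (1 + L * \<Lambda>) * (\<integral>G. \<tau> G \<partial>gauss I) + L * \<kappa>"
    unfolding eq by linarith
  then show ?thesis unfolding Y_def \<tau>_def .
qed

lemma variance_gibbs:
  assumes k: "bounded_measurable M k"
  shows "(\<integral>z. (k z - (\<integral>z. k z \<partial>gibbs b G))\<^sup>2 \<partial>gibbs b G) = (\<integral>z. k z * k z \<partial>gibbs b G) - (\<integral>z. k z \<partial>gibbs b G)\<^sup>2"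
proof -
  interpret gb: prob_space "gibbs b G" by (rule prob_space_gibbs)
  show ?thesis
    using gb.variance_eq[of k] k by (simp add: integrable_gibbs power2_eq_square bounded_measurable_mult)
qed

section \<open>Thermal fluctuations\<close>

text \<open>
  The derivative in \<open>t\<close> of the mean of \<open>g\<close> is \<open>s\<close> times its variance, so the integral of the variance over
  \<open>[0, 1]\<close> is the increment of the mean divided by \<open>s\<close>. By Gaussian integration by parts the expected
  mean is \<open>s * t\<close> times a quantity between 0 and 1: the kernel on the diagonal minus its average over two
  replicas, the latter being a sum of squares.
\<close>

lemma thermal_fluctuations:
  fixes b :: "'i \<Rightarrow> real" and s :: real
  assumes I': "I' \<subseteq> I" and s: "s > 0"
    and kern: "\<And>z. z \<in> space M \<Longrightarrow> (\<Sum>i\<in>I'. (e i z)\<^sup>2) \<le> 1"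
  defines "b' \<equiv> \<lambda>t i. if i \<in> I' then s * t else b i"
    and "g \<equiv> ham (\<lambda>i. if i \<in> I' then 1 else 0)"
  shows "(\<integral>\<^sup>+t. (\<integral>\<^sup>+G. ennreal (\<integral>z. (g G z - (\<integral>z. g G z \<partial>gibbs (b' t) G))\<^sup>2 \<partial>gibbs (b' t) G) \<partial>gauss I) * indicator {0..1} t \<partial>lborel) \<le> 1"
proof -
  interpret \<Gamma>: prob_space "gauss I" by (rule prob_space_gauss)
  interpret PS: pair_sigma_finite lborel "gauss I" ..
  define m where "m = (\<lambda>t G. \<integral>z. g G z \<partial>gibbs (b' t) G)"
  define v where "v = (\<lambda>t G. \<integral>z. (g G z - m t G)\<^sup>2 \<partial>gibbs (b' t) G)"
  have gb[intro!]: "bounded_measurable M (g G)" for G unfolding g_def by auto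
  let ?N = "borel \<Otimes>\<^sub>M gauss I :: (real \<times> ('i \<Rightarrow> real)) measure"
  have b'm: "(\<lambda>\<omega>. b' (fst \<omega>) i) \<in> borel_measurable ?N" for i
    unfolding b'_def by (cases "i \<in> I'") auto
  have Gm: "(\<lambda>\<omega>. snd \<omega> i) \<in> borel_measurable ?N" if "i \<in> I" for i
    using that by measurable
  have gm[measurable]: "(\<lambda>x. g (snd (fst x)) (snd x)) \<in> borel_measurable (?N \<Otimes>\<^sub>M M)"
    unfolding g_def by (rule measurable_ham[where G=snd, OF _ Gm]) auto
  have mm[measurable]: "(\<lambda>\<omega>. m (fst \<omega>) (snd \<omega>)) \<in> borel_measurable ?N"
    unfolding m_def by (rule measurable_integral_gibbs[OF b'm Gm gm])
  have vm[measurable]: "(\<lambda>\<omega>. v (fst \<omega>) (snd \<omega>)) \<in> borel_measurable ?N"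
    unfolding v_def by (rule measurable_integral_gibbs[OF b'm Gm]) measurable
  have v0: "0 \<le> v t G" for t G unfolding v_def by (intro integral_nonneg_AE) auto
  have dm: "((\<lambda>t. m t G / s) has_real_derivative v t G) (at t)" for t G
  proof -
    have eq: "gibbs (b' t) G = tilted_measure M (\<lambda>z. ham (\<lambda>i. if i \<in> I' then 0 else b i) G z + t * (s * g G z))" for t
      unfolding gibbs_def g_def ham_def b'_def
      by (intro arg_cong[where f="tilted_measure M"] ext)
         (auto simp: sum_distrib_left sum.distrib[symmetric] intro!: sum.cong)
    have "((\<lambda>t. m t G) has_real_derivative
        (\<integral>z. g G z * (s * g G z) \<partial>gibbs (b' t) G) - m t G * (\<integral>z. s * g G z \<partial>gibbs (b' t) G)) (at t)"
      unfolding m_def eq by (rule tilted_has_derivative) auto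
    moreover have "(\<integral>z. g G z * (s * g G z) \<partial>gibbs (b' t) G) = s * (\<integral>z. g G z * g G z \<partial>gibbs (b' t) G)"
      by (subst integral_mult_right_zero[symmetric]) (simp add: mult_ac)
    moreover have "v t G = (\<integral>z. g G z * g G z \<partial>gibbs (b' t) G) - (m t G)\<^sup>2"
      unfolding v_def m_def by (rule variance_gibbs[OF gb])
    ultimately have "((\<lambda>t. m t G) has_real_derivative s * v t G) (at t)"
      by (simp add: m_def power2_eq_square right_diff_distrib mult.left_commute)
    then show ?thesis using DERIV_cdivide[of "\<lambda>t. m t G" "s * v t G" t UNIV s] s by simp
  qed
  have ftc: "(\<integral>\<^sup>+t. ennreal (v t G) * indicator {0..1} t \<partial>lborel) = ennreal (m 1 G / s - m 0 G / s)" if G: "G \<in> space (gauss I)" for G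
  proof (rule nn_integral_FTC_Icc)
    have "(\<lambda>t. (t, G)) \<in> measurable borel ?N" using G by measurable
    from measurable_compose[OF this vm] show "(\<lambda>t. v t G) \<in> borel_measurable borel" by simp
    show "((\<lambda>t. m t G / s) has_real_derivative v t G) (at t)" for t by (rule dm)
  qed (use v0 in auto)
  have mono: "m 0 G / s \<le> m 1 G / s" for G
  proof (rule DERIV_nonneg_imp_nondecreasing[of 0 1 "\<lambda>t. m t G / s"])
    show "\<exists>y. ((\<lambda>t. m t G / s) has_real_derivative y) (at t) \<and> 0 \<le> y" for t
      using dm v0 by blast
  qed simp
  have Em: "integrable (gauss I) (m t) \<and> 0 \<le> (\<integral>G. m t G \<partial>gauss I) \<and> (\<integral>G. m t G \<partial>gauss I) \<le> s * t" if t: "0 \<le> t" for t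
  proof -
    define E where "E = (\<lambda>i G. \<integral>z. e i z \<partial>gibbs (b' t) G)"
    define W where "W = (\<lambda>i G. (\<integral>z. e i z * e i z \<partial>gibbs (b' t) G) - E i G * E i G)"
    have mE: "m t G = (\<Sum>i\<in>I'. G i * E i G)" for G
    proof -
      have "m t G = (\<integral>z. (\<Sum>i\<in>I'. G i * e i z) \<partial>gibbs (b' t) G)"
        unfolding m_def g_def ham_def using I' finite_I
        by (intro Bochner_Integration.integral_cong refl sum.mono_neutral_cong_right) auto
      also have "\<dots> = (\<Sum>i\<in>I'. \<integral>z. G i * e i z \<partial>gibbs (b' t) G)"
        using I' by (intro Bochner_Integration.integral_sum integrable_mult_right integrable_gibbs) auto
      finally show ?thesis unfolding E_def by simp
    qed
    have [measurable]: "E i \<in> borel_measurable (gauss I)" if "i \<in> I" for i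
      unfolding E_def using that by (intro measurable_gibbs_G' e_measurable)
    have [measurable]: "(\<lambda>G. \<integral>z. e i z * e i z \<partial>gibbs (b' t) G) \<in> borel_measurable (gauss I)" if "i \<in> I" for i
      using that by (intro measurable_gibbs_G') measurable
    have [measurable]: "W i \<in> borel_measurable (gauss I)" if "i \<in> I" for i
      unfolding W_def using that by measurable
    have E1: "\<bar>E i G\<bar> \<le> 1" if "i \<in> I" for i G
      unfolding E_def using that by (intro abs_integral_gibbs_le e_measurable e_le_1)
    have S1: "\<bar>\<integral>z. e i z * e i z \<partial>gibbs (b' t) G\<bar> \<le> 1" if i: "i \<in> I" for i G
    proof (rule abs_integral_gibbs_le)
      show "(\<lambda>z. e i z * e i z) \<in> borel_measurable M" using i by measurable
      fix z assume "z \<in> space M"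
      from mult_mono[OF e_le_1[OF i this] e_le_1[OF i this]] show "\<bar>e i z * e i z\<bar> \<le> 1" by (simp add: abs_mult)
    qed
    have W2: "\<bar>W i G\<bar> \<le> 2" if i: "i \<in> I" for i G
    proof -
      have "\<bar>E i G * E i G\<bar> \<le> 1" using mult_mono[OF E1[OF i, of G] E1[OF i, of G]] by (simp add: abs_mult)
      then show ?thesis using S1[OF i, of G] unfolding W_def by linarith
    qed
    have W0: "0 \<le> W i G" if i: "i \<in> I" for i G
    proof -
      have "0 \<le> (\<integral>z. (e i z - E i G)\<^sup>2 \<partial>gibbs (b' t) G)" by (intro integral_nonneg_AE) auto
      also have "\<dots> = W i G" unfolding W_def E_def
        by (subst variance_gibbs[OF bounded_measurable_e[OF i]]) (simp add: power2_eq_square)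
      finally show ?thesis .
    qed
    have W1: "(\<Sum>i\<in>I'. W i G) \<le> 1" for G
    proof -
      have "(\<Sum>i\<in>I'. W i G) \<le> (\<Sum>i\<in>I'. \<integral>z. e i z * e i z \<partial>gibbs (b' t) G)"
        unfolding W_def by (intro sum_mono) auto
      also have "\<dots> = (\<integral>z. (\<Sum>i\<in>I'. e i z * e i z) \<partial>gibbs (b' t) G)"
        using I' by (intro Bochner_Integration.integral_sum[symmetric] integrable_gibbs) auto
      also have "\<dots> \<le> 1"
      proof -
        have "bounded_measurable M (\<lambda>z. \<Sum>i\<in>I'. e i z * e i z)" using I' by auto
        then have "\<bar>\<integral>z. (\<Sum>i\<in>I'. e i z * e i z) \<partial>gibbs (b' t) G\<bar> \<le> 1"
          using kern by (intro abs_integral_gibbs_le bounded_measurableD) (auto simp: power2_eq_square sum_nonneg)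
        then show ?thesis by linarith
      qed
      finally show ?thesis .
    qed
    have der: "((\<lambda>t'. E i (G(i := t'))) has_real_derivative (b' t i * W i (G(i := t')))) (at t')" if "i \<in> I" for i G t'
      using gibbs_has_derivative[OF that bounded_measurable_e[OF that], of "b' t" G t'] unfolding E_def W_def by simp
    have ibp: "integrable (gauss I) (\<lambda>G. G i * E i G)" "integrable (gauss I) (\<lambda>G. b' t i * W i G)"
      "(\<integral>G. G i * E i G \<partial>gauss I) = (\<integral>G. b' t i * W i G \<partial>gauss I)" if i: "i \<in> I" for i
    proof -
      have b: "\<bar>b' t i * W i G\<bar> \<le> 2 * \<bar>b' t i\<bar> + 0 * (\<Sum>j\<in>I. \<bar>G j\<bar>)" for G
        using mult_left_mono[OF W2[OF i, of G], of "\<bar>b' t i\<bar>"] by (simp add: abs_mult)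
      have m: "E i \<in> borel_measurable (gauss I)" "(\<lambda>G. b' t i * W i G) \<in> borel_measurable (gauss I)"
        using i by measurable
      show "integrable (gauss I) (\<lambda>G. G i * E i G)" "integrable (gauss I) (\<lambda>G. b' t i * W i G)"
      "(\<integral>G. G i * E i G \<partial>gauss I) = (\<integral>G. b' t i * W i G \<partial>gauss I)"
        by (rule gauss_ibp[OF finite_I i m der[OF i] E1[OF i] b])+
    qed
    have iW: "integrable (gauss I) (W i)" if "i \<in> I" for i
      using that W2 by (intro \<Gamma>.integrable_const_bound[where B=2]) auto
    have int: "integrable (gauss I) (m t)"
      unfolding mE[abs_def] using ibp(1) I' by (intro Bochner_Integration.integrable_sum) auto
    have "(\<integral>G. m t G \<partial>gauss I) = (\<Sum>i\<in>I'. \<integral>G. G i * E i G \<partial>gauss I)"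
      unfolding mE using ibp(1) I' by (intro Bochner_Integration.integral_sum) auto
    also have "\<dots> = (\<Sum>i\<in>I'. s * t * (\<integral>G. W i G \<partial>gauss I))"
      using I' ibp(3) by (intro sum.cong refl) (auto simp: b'_def)
    also have "\<dots> = s * t * (\<integral>G. (\<Sum>i\<in>I'. W i G) \<partial>gauss I)"
      using I' iW by (subst Bochner_Integration.integral_sum) (auto simp: sum_distrib_left)
    finally have eq: "(\<integral>G. m t G \<partial>gauss I) = s * t * (\<integral>G. (\<Sum>i\<in>I'. W i G) \<partial>gauss I)" .
    have a0: "0 \<le> (\<integral>G. (\<Sum>i\<in>I'. W i G) \<partial>gauss I)"
      using W0 I' by (intro integral_nonneg_AE AE_I2 sum_nonneg) auto
    have "(\<integral>G. (\<Sum>i\<in>I'. W i G) \<partial>gauss I) \<le> (\<integral>G. 1 \<partial>gauss I)"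
      using W1 iW I' by (intro integral_mono) auto
    then have a1: "(\<integral>G. (\<Sum>i\<in>I'. W i G) \<partial>gauss I) \<le> 1" by (simp add: \<Gamma>.prob_space)
    show ?thesis unfolding eq using int a0 mult_left_mono[OF a1, of "s * t"] s t by simp
  qed
  have vm': "(\<lambda>(t, G). ennreal (v t G) * indicator {0..1} t) \<in> borel_measurable (lborel \<Otimes>\<^sub>M gauss I)"
  proof -
    have "(\<lambda>\<omega>. v (fst \<omega>) (snd \<omega>)) \<in> borel_measurable (lborel \<Otimes>\<^sub>M gauss I)"
      using vm by (simp cong: measurable_cong_sets sets_pair_measure_cong)
    then show ?thesis unfolding case_prod_beta by measurable
  qed
  have "(\<integral>\<^sup>+t. (\<integral>\<^sup>+G. ennreal (v t G) \<partial>gauss I) * indicator {0..1} t \<partial>lborel)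
     = (\<integral>\<^sup>+t. (\<integral>\<^sup>+G. ennreal (v t G) * indicator {0..1} t \<partial>gauss I) \<partial>lborel)"
    by (intro nn_integral_cong) (auto split: split_indicator)
  also have "\<dots> = (\<integral>\<^sup>+G. (\<integral>\<^sup>+t. ennreal (v t G) * indicator {0..1} t \<partial>lborel) \<partial>gauss I)"
    using PS.Fubini'[OF vm'] by simp
  also have "\<dots> = (\<integral>\<^sup>+G. ennreal (m 1 G / s - m 0 G / s) \<partial>gauss I)"
    by (intro nn_integral_cong ftc)
  also have "\<dots> = ennreal (\<integral>G. m 1 G / s - m 0 G / s \<partial>gauss I)"
    using Em[of 1] Em[of 0] mono by (intro nn_integral_eq_integral AE_I2) auto
  also have "(\<integral>G. m 1 G / s - m 0 G / s \<partial>gauss I) = (\<integral>G. m 1 G \<partial>gauss I) / s - (\<integral>G. m 0 G \<partial>gauss I) / s"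
    using Em[of 1] Em[of 0] by simp
  finally have "(\<integral>\<^sup>+t. (\<integral>\<^sup>+G. ennreal (v t G) \<partial>gauss I) * indicator {0..1} t \<partial>lborel)
     = ennreal ((\<integral>G. m 1 G \<partial>gauss I) / s - (\<integral>G. m 0 G \<partial>gauss I) / s)" .
  moreover have "(\<integral>G. m 1 G \<partial>gauss I) / s - (\<integral>G. m 0 G \<partial>gauss I) / s \<le> 1"
    using Em[of 1] Em[of 0] s by (simp add: field_simps)
  ultimately have "(\<integral>\<^sup>+t. (\<integral>\<^sup>+G. ennreal (v t G) \<partial>gauss I) * indicator {0..1} t \<partial>lborel) \<le> 1"
    by simp
  then show ?thesis unfolding v_def m_def .
qed

section \<open>Adding and pairing replicas\<close>

lemma integral_replicas_insert:
  fixes k :: "(nat \<Rightarrow> 'a) \<Rightarrow> real"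
  assumes J: "finite J" "l \<notin> J" and k: "bounded_measurable (PiM (insert l J) (\<lambda>_. M)) k"
  shows "(\<integral>zs. k zs \<partial>PiM (insert l J) (\<lambda>_. gibbs b G)) = (\<integral>zs. (\<integral>z. k (zs(l := z)) \<partial>gibbs b G) \<partial>PiM J (\<lambda>_. gibbs b G))"
proof -
  interpret gb: prob_space "gibbs b G" by (rule prob_space_gibbs)
  interpret P: product_sigma_finite "\<lambda>_::nat. gibbs b G" by standard
  interpret PP: prob_space "PiM (insert l J) (\<lambda>_. gibbs b G)" by (intro prob_space_PiM prob_space_gibbs)
  have s: "sets (PiM (insert l J) (\<lambda>_. gibbs b G)) = sets (PiM (insert l J) (\<lambda>_. M))"
    by (intro sets_PiM_cong) auto
  have "bounded_measurable (PiM (insert l J) (\<lambda>_. gibbs b G)) k"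
    using k sets_eq_imp_space_eq[OF s] by (simp add: bounded_measurable_def measurable_cong_sets[OF s refl])
  then show ?thesis by (intro P.product_integral_insert J PP.integrable_bounded_measurable)
qed

lemma integral_replicas_Suc:
  fixes k :: "(nat \<Rightarrow> 'a) \<Rightarrow> real"
  assumes "bounded_measurable (PiM {..<Suc n} (\<lambda>_. M)) k"
  shows "(\<integral>zs. k zs \<partial>replicas (Suc n) b G) = (\<integral>zs. (\<integral>z. k (zs(n := z)) \<partial>gibbs b G) \<partial>replicas n b G)"
  using integral_replicas_insert[of "{..<n}" n k b G] assms unfolding replicas_def by (simp add: lessThan_Suc)

lemma integral_replicas_pair:
  fixes F :: "'a \<Rightarrow> 'a \<Rightarrow> real"
  assumes jl: "j < n" "l < n" "j \<noteq> l" and F: "bounded_measurable (M \<Otimes>\<^sub>M M) (\<lambda>x. F (fst x) (snd x))"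
  shows "(\<integral>zs. F (zs j) (zs l) \<partial>replicas n b G) = (\<integral>z. (\<integral>z'. F z z' \<partial>gibbs b G) \<partial>gibbs b G)"
proof -
  interpret gb: prob_space "gibbs b G" by (rule prob_space_gibbs)
  define J where "J = {..<n} - {l}"
  have J: "finite J" "l \<notin> J" "{..<n} = insert l J" "j \<in> J" using jl by (auto simp: J_def)
  have "(\<lambda>zs. (zs j, zs l)) \<in> measurable (PiM (insert l J) (\<lambda>_. M)) (M \<Otimes>\<^sub>M M)"
    using J by (intro measurable_Pair measurable_component_singleton) auto
  from bounded_measurable_compose[OF F this]
  have k: "bounded_measurable (PiM (insert l J) (\<lambda>_. M)) (\<lambda>zs. F (zs j) (zs l))" by simp
  have Fm: "(\<lambda>x. F (fst x) (snd x)) \<in> borel_measurable (M \<Otimes>\<^sub>M M)" using F by (rule bounded_measurableD)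
  have Fm': "(\<lambda>x. F (fst x) (snd x)) \<in> borel_measurable (gibbs b G \<Otimes>\<^sub>M gibbs b G)"
    using Fm by (simp cong: measurable_cong_sets sets_pair_measure_cong)
  have "(\<integral>zs. F (zs j) (zs l) \<partial>replicas n b G) = (\<integral>zs. (\<integral>z. F (zs j) z \<partial>gibbs b G) \<partial>PiM J (\<lambda>_. gibbs b G))"
    using integral_replicas_insert[OF J(1,2) k] jl J unfolding replicas_def by simp
  also have "\<dots> = (\<integral>z. (\<integral>z'. F z z' \<partial>gibbs b G) \<partial>distr (PiM J (\<lambda>_. gibbs b G)) (gibbs b G) (\<lambda>zs. zs j))"
    using J Fm' by (intro integral_distr[symmetric] gb.borel_measurable_lebesgue_integral) (auto simp: case_prod_beta)
  also have "distr (PiM J (\<lambda>_. gibbs b G)) (gibbs b G) (\<lambda>zs. zs j) = gibbs b G"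
    using J by (intro distr_PiM_component prob_space_gibbs)
  finally show ?thesis .
qed

end

section \<open>A smooth threshold\<close>

text \<open>
  A smooth version of the indicator of \<open>t \<ge> \<delta>\<close>, namely the logistic function with steepness \<open>1 / \<theta>\<close>. The
  last two inequalities are those that the sharp indicator satisfies with \<open>\<theta> = 0\<close>.
\<close>

lemma soft_threshold:
  fixes \<delta> \<theta> :: real
  assumes \<theta>: "0 < \<theta>" and \<delta>: "0 \<le> \<delta>"
  obtains H H' :: "real \<Rightarrow> real" where
    "\<And>t. (H has_real_derivative H' t) (at t)" "\<And>t. 0 \<le> H t" "\<And>t. H t \<le> 1" "\<And>t. \<bar>H' t\<bar> \<le> 1 / \<theta>"
    "H' \<in> borel_measurable borel"
    "\<And>t. \<delta> * H t - \<theta> \<le> t * H t" "\<And>t. t * (1 - H t) \<le> \<delta> + \<theta>"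
proof
  let ?E = "\<lambda>t. exp (- (t - \<delta>) / \<theta>)"
  let ?H = "\<lambda>t. 1 / (1 + ?E t)"
  let ?H' = "\<lambda>t. ?E t / \<theta> / (1 + ?E t)\<^sup>2"
  have pos: "0 < 1 + ?E t" for t by (simp add: add_pos_pos)
  show "(?H has_real_derivative ?H' t) (at t)" for t
    using pos[of t] \<theta> by (auto intro!: derivative_eq_intros simp: power2_eq_square)
  show "0 \<le> ?H t" "?H t \<le> 1" for t using pos[of t] by auto
  show "\<bar>?H' t\<bar> \<le> 1 / \<theta>" for t
  proof -
    have "?E t \<le> (1 + ?E t)\<^sup>2" by (simp add: power2_eq_square algebra_simps)
    then have "?E t / (1 + ?E t)\<^sup>2 \<le> 1" using pos[of t] by simp
    then have "?E t / (1 + ?E t)\<^sup>2 / \<theta> \<le> 1 / \<theta>" using \<theta> by (intro divide_right_mono) auto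
    moreover have "0 \<le> ?H' t" using \<theta> by simp
    ultimately show ?thesis by (simp add: mult.commute)
  qed
  show "?H' \<in> borel_measurable borel" by measurable
  have le: "x \<le> \<theta> * (1 + exp (x / \<theta>))" for x
  proof -
    have "x / \<theta> \<le> exp (x / \<theta>)" using exp_ge_add_one_self[of "x / \<theta>"] by linarith
    then have "x \<le> \<theta> * exp (x / \<theta>)" using \<theta> by (simp add: field_simps)
    then show ?thesis using \<theta> by (simp add: algebra_simps)
  qed
  show "\<delta> * ?H t - \<theta> \<le> t * ?H t" for t
  proof -
    have "(\<delta> - t) * ?H t \<le> \<theta>"
      using le[of "\<delta> - t"] pos[of t] by (simp add: pos_divide_le_eq)
    then show ?thesis by (simp add: algebra_simps diff_divide_distrib)
  qed
  show "t * (1 - ?H t) \<le> \<delta> + \<theta>" for t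
  proof -
    have 1: "1 - ?H t = 1 / (1 + exp ((t - \<delta>) / \<theta>))"
    proof -
      have "exp ((t - \<delta>) / \<theta>) * ?E t = exp 0" unfolding exp_add[symmetric] using \<theta> by (simp add: field_simps)
      moreover have "1 - 1 / (1 + y) = 1 / (1 + x)" if "x * y = 1" "0 < x" "0 < y" for x y :: real
        using that by (simp add: field_simps)
      ultimately show ?thesis by simp
    qed
    have p: "0 < 1 + exp ((t - \<delta>) / \<theta>)" by (simp add: add_pos_pos)
    have "(t - \<delta>) * (1 - ?H t) \<le> \<theta>"
      unfolding 1 using le[of "t - \<delta>"] p by (simp add: pos_divide_le_eq)
    moreover have "\<delta> * (1 - ?H t) \<le> \<delta> * 1" using \<delta> pos[of t] by (intro mult_left_mono) auto
    moreover have "t * w = (t - \<delta>) * w + \<delta> * w" for w by (simp add: algebra_simps)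
    ultimately show ?thesis by (metis add.commute add_mono mult_1_right)
  qed
qed

section \<open>Negative overlaps are rare\<close>

definition bounded_on_overlaps :: "(real \<Rightarrow> real) \<Rightarrow> bool" where
  "bounded_on_overlaps p \<longleftrightarrow> p \<in> borel_measurable borel \<and> (\<exists>K. \<forall>r. \<bar>r\<bar> \<le> 1 \<longrightarrow> \<bar>p r\<bar> \<le> K)"

lemma bounded_on_overlaps_continuous:
  assumes "continuous_on UNIV p" shows "bounded_on_overlaps p"
proof -
  have "bounded (p ` {-1..1})"
    using assms by (intro compact_imp_bounded compact_continuous_image continuous_on_subset[OF assms]) auto
  then obtain K where "\<forall>r\<in>{-1..1}. \<bar>p r\<bar> \<le> K" unfolding bounded_iff by auto
  then have "\<forall>r. \<bar>r\<bar> \<le> 1 \<longrightarrow> \<bar>p r\<bar> \<le> K" by (auto simp: abs_le_iff)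
  then show ?thesis
    unfolding bounded_on_overlaps_def using assms borel_measurable_continuous_onI by blast
qed

lemma bounded_on_overlaps_indicator [intro!]:
  "A \<in> sets borel \<Longrightarrow> bounded_on_overlaps (indicator A)"
  unfolding bounded_on_overlaps_def by (auto intro!: exI[of _ 1] split: split_indicator)

text \<open>
  The kernel \<open>R\<close> is the scalar product of unit vectors; the double sum in the last axiom is then the squared
  norm of the sum of the vectors.
\<close>

locale gaussian_overlap = gaussian_gibbs M I e
  for M :: "'a measure" and I :: "'i set" and e :: "'i \<Rightarrow> 'a \<Rightarrow> real" +
  fixes R :: "'a \<Rightarrow> 'a \<Rightarrow> real"
  assumes R_measurable [measurable]: "(\<lambda>x. R (fst x) (snd x)) \<in> borel_measurable (M \<Otimes>\<^sub>M M)"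
    and R_sym: "z \<in> space M \<Longrightarrow> z' \<in> space M \<Longrightarrow> R z z' = R z' z"
    and R_refl: "z \<in> space M \<Longrightarrow> R z z = 1"
    and R_le: "z \<in> space M \<Longrightarrow> z' \<in> space M \<Longrightarrow> \<bar>R z z'\<bar> \<le> 1"
    and R_psd: "(\<And>l. l < (n :: nat) \<Longrightarrow> zs l \<in> space M) \<Longrightarrow> 0 \<le> (\<Sum>j<n. \<Sum>l<n. R (zs j) (zs l))"
begin

lemma measure_gibbs_space [simp]: "measure (gibbs b G) (space M) = 1"
  using prob_space.prob_space[OF prob_space_gibbs, of b G] by simp

lemma measure_replicas_space [simp]:
  "measure (replicas n b G) (space (PiM {..<n} (\<lambda>_. M))) = 1"
  using prob_space.prob_space[OF prob_space_replicas, of n b G] by simp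

definition overlap_mean :: "('i \<Rightarrow> real) \<Rightarrow> ('i \<Rightarrow> real) \<Rightarrow> (real \<Rightarrow> real) \<Rightarrow> real" where
  "overlap_mean b G p = (\<integral>zs. p (R (zs 0) (zs 1)) \<partial>replicas 2 b G)"

lemma bounded_overlap:
  assumes p: "bounded_on_overlaps p"
  shows "bounded_measurable (M \<Otimes>\<^sub>M M) (\<lambda>x. p (R (fst x) (snd x)))"
proof -
  obtain K where K: "\<And>r. \<bar>r\<bar> \<le> 1 \<Longrightarrow> \<bar>p r\<bar> \<le> K" and [measurable]: "p \<in> borel_measurable borel"
    using p unfolding bounded_on_overlaps_def by auto
  show ?thesis
    by (rule bounded_measurableI[where B=K]) (measurable, auto simp: space_pair_measure intro!: K R_le)
qed

lemma bounded_overlap_replicas: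
  assumes p: "bounded_on_overlaps p" and jl: "j < n" "l < n"
  shows "bounded_measurable (PiM {..<n} (\<lambda>_. M)) (\<lambda>zs. p (R (zs j) (zs l)))"
proof -
  have "(\<lambda>zs. (zs j, zs l)) \<in> measurable (PiM {..<n} (\<lambda>_. M)) (M \<Otimes>\<^sub>M M)"
    using jl by (intro measurable_Pair measurable_component_singleton) auto
  from bounded_measurable_compose[OF bounded_overlap[OF p] this] show ?thesis by simp
qed

lemma bounded_overlap_gibbs:
  assumes p: "bounded_on_overlaps p" and z: "z \<in> space M"
  shows "bounded_measurable M (\<lambda>z'. p (R z z'))"
proof -
  have "(\<lambda>z'. (z, z')) \<in> measurable M (M \<Otimes>\<^sub>M M)" using z by measurable
  from bounded_measurable_compose[OF bounded_overlap[OF p] this] show ?thesis by simp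
qed

lemma bounded_overlap_integral:
  assumes p: "bounded_on_overlaps p" and j: "j < n"
  shows "bounded_measurable (PiM {..<n} (\<lambda>_. M)) (\<lambda>zs. \<integral>z. p (R (zs j) z) \<partial>gibbs b G)"
proof -
  interpret gb: prob_space "gibbs b G" by (rule prob_space_gibbs)
  obtain K where K: "\<And>r. \<bar>r\<bar> \<le> 1 \<Longrightarrow> \<bar>p r\<bar> \<le> K"
    using p unfolding bounded_on_overlaps_def by auto
  have "(\<lambda>x. p (R (fst x) (snd x))) \<in> borel_measurable (M \<Otimes>\<^sub>M gibbs b G)"
    using bounded_measurableD[OF bounded_overlap[OF p]]
    by (simp cong: measurable_cong_sets sets_pair_measure_cong)
  then have "(\<lambda>z. \<integral>z'. p (R z z') \<partial>gibbs b G) \<in> borel_measurable M"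
    by (intro gb.borel_measurable_lebesgue_integral) (simp add: case_prod_beta)
  then have "bounded_measurable M (\<lambda>z. \<integral>z'. p (R z z') \<partial>gibbs b G)"
  proof (rule bounded_measurableI)
    fix z assume z: "z \<in> space M"
    then show "\<bar>\<integral>z'. p (R z z') \<partial>gibbs b G\<bar> \<le> K"
      using bounded_measurableD[OF bounded_overlap_gibbs[OF p z]]
      by (intro abs_integral_gibbs_le) (auto intro!: K R_le)
  qed
  then show ?thesis using j by (intro bounded_measurable_component)
qed

lemma bounded_replicas_gauss:
  fixes f :: "(nat \<Rightarrow> 'a) \<Rightarrow> real"
  assumes f: "bounded_measurable (PiM {..<n} (\<lambda>_. M)) f"
  shows "bounded_measurable (gauss I) (\<lambda>G. \<integral>zs. f zs \<partial>replicas n b G)"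
proof -
  obtain B where B: "\<And>zs. zs \<in> space (PiM {..<n} (\<lambda>_. M)) \<Longrightarrow> \<bar>f zs\<bar> \<le> B" using f by (metis bounded_measurableE)
  show ?thesis
    using f by (intro bounded_measurableI[where B=B] measurable_replicas_G abs_integral_replicas_le B) auto
qed

lemma bounded_overlap_mean: "bounded_on_overlaps p \<Longrightarrow> bounded_measurable (gauss I) (\<lambda>G. overlap_mean b G p)"
  unfolding overlap_mean_def by (intro bounded_replicas_gauss bounded_overlap_replicas) auto

lemma overlap_mean_pair:
  assumes p: "bounded_on_overlaps p" and jl: "j < n" "l < n" "j \<noteq> l"
  shows "(\<integral>zs. p (R (zs j) (zs l)) \<partial>replicas n b G) = overlap_mean b G p"
  unfolding overlap_mean_def
  using integral_replicas_pair[OF jl bounded_overlap[OF p], where b=b and G=G]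
    integral_replicas_pair[OF _ _ _ bounded_overlap[OF p], where b=b and G=G and j=0 and l=1 and n=2] by simp

lemma overlap_mean_mono:
  assumes "bounded_on_overlaps p" "bounded_on_overlaps q" and le: "\<And>r. \<bar>r\<bar> \<le> 1 \<Longrightarrow> p r \<le> q r"
  shows "overlap_mean b G p \<le> overlap_mean b G q"
  unfolding overlap_mean_def
  by (rule integral_mono) 
     (auto intro!: integrable_replicas bounded_overlap_replicas assms R_le space_productD[of _ 2])

lemma integrable_mean_ham: "integrable (gauss I) (\<lambda>G. \<integral>z. ham q G z \<partial>gibbs b G)"
proof (rule Bochner_Integration.integrable_bound)
  show "integrable (gauss I) (\<lambda>G. \<Sum>i\<in>I. \<bar>q i\<bar> * \<bar>G i\<bar>)"
    by (intro Bochner_Integration.integrable_sum integrable_mult_right integrable_gauss_component)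
  show "(\<lambda>G. \<integral>z. ham q G z \<partial>gibbs b G) \<in> borel_measurable (gauss I)"
    by (rule measurable_gibbs_G) measurable
  show "AE G in gauss I. norm (\<integral>z. ham q G z \<partial>gibbs b G) \<le> norm (\<Sum>i\<in>I. \<bar>q i\<bar> * \<bar>G i\<bar>)"
  proof (intro AE_I2)
    fix G
    have "\<bar>\<integral>z. ham q G z \<partial>gibbs b G\<bar> \<le> (\<Sum>i\<in>I. \<bar>q i\<bar> * \<bar>G i\<bar>)"
      by (intro abs_integral_gibbs_le ham_abs_le bounded_measurableD) auto
    then show "norm (\<integral>z. ham q G z \<partial>gibbs b G) \<le> norm (\<Sum>i\<in>I. \<bar>q i\<bar> * \<bar>G i\<bar>)" by simp
  qed
qed

text \<open>
  The identity \<open>weighted_ghirlanda_guerra\<close> for a kernel that is a function of the overlap. The constant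
  term of \<open>\<psi>\<close> is not produced by any Gaussian field; it cancels because \<open>n\<close> old replicas are compared with
  \<open>n\<close> times one new replica. The diagonal contributes the term \<open>\<psi> 1\<close>.
\<close>

lemma overlap_identity:
  fixes b c :: "'i \<Rightarrow> real" and h h' \<psi> :: "real \<Rightarrow> real" and f :: "(nat \<Rightarrow> 'a) \<Rightarrow> real"
  assumes b: "\<And>i. i \<in> I \<Longrightarrow> b i \<noteq> 0"
    and \<psi>: "bounded_on_overlaps \<psi>"
    and \<Psi>: "\<And>z z'. z \<in> space M \<Longrightarrow> z' \<in> space M \<Longrightarrow> (\<Sum>i\<in>I. c i * e i z * e i z') = \<psi> (R z z') - k0"
    and \<Lambda>: "\<And>z z'. z \<in> space M \<Longrightarrow> z' \<in> space M \<Longrightarrow> \<bar>\<psi> (R z z') - k0\<bar> \<le> \<Lambda>"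
    and \<kappa>: "\<And>z z'. z \<in> space M \<Longrightarrow> z' \<in> space M \<Longrightarrow> \<bar>\<Sum>i\<in>I. (c i / b i)\<^sup>2 * e i z * e i z'\<bar> \<le> \<kappa>"
    and h: "\<And>t. (h has_real_derivative h' t) (at t)" "\<And>t. \<bar>h t\<bar> \<le> 1" "\<And>t. \<bar>h' t\<bar> \<le> L"
    and h': "h' \<in> borel_measurable borel"
    and f: "f \<in> borel_measurable (PiM {..<n} (\<lambda>_. M))"
    and f1: "\<And>zs. zs \<in> space (PiM {..<n} (\<lambda>_. M)) \<Longrightarrow> \<bar>f zs\<bar> \<le> 1"
    and j: "j < n"
  defines "u \<equiv> ham (\<lambda>i. c i / b i)"
    and "U \<equiv> \<lambda>G. \<integral>z. ham (\<lambda>i. c i / b i) G z \<partial>gibbs b G"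
  shows "\<bar>\<integral>G. h (U G) * ((\<psi> 1 - U G) * (\<integral>zs. f zs \<partial>replicas n b G)
          + (\<integral>zs. f zs * (\<Sum>l\<in>{..<n}-{j}. \<psi> (R (zs j) (zs l))) \<partial>replicas n b G)
          - n * (\<integral>zs. f zs * (\<integral>z. \<psi> (R (zs j) z) \<partial>gibbs b G) \<partial>replicas n b G)) \<partial>gauss I\<bar>
     \<le> (1 + L * \<Lambda>) * (\<integral>G. (\<integral>z. \<bar>u G z - U G\<bar> \<partial>gibbs b G) \<partial>gauss I) + L * \<kappa>"
proof -
  have fb: "bounded_measurable (PiM {..<n} (\<lambda>_. M)) f" using f f1 by (rule bounded_measurableI)
  have eq: "(\<integral>zs. f zs * ((\<Sum>l<n. (\<Sum>i\<in>I. c i * e i (zs j) * e i (zs l))) - n * (\<integral>z. (\<Sum>i\<in>I. c i * e i (zs j) * e i z) \<partial>gibbs b G)) \<partial>replicas n b G)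
    = \<psi> 1 * (\<integral>zs. f zs \<partial>replicas n b G)
          + (\<integral>zs. f zs * (\<Sum>l\<in>{..<n}-{j}. \<psi> (R (zs j) (zs l))) \<partial>replicas n b G)
          - n * (\<integral>zs. f zs * (\<integral>z. \<psi> (R (zs j) z) \<partial>gibbs b G) \<partial>replicas n b G)" for G
  proof -
    interpret gb: prob_space "gibbs b G" by (rule prob_space_gibbs)
    have pt: "(\<Sum>l<n. (\<Sum>i\<in>I. c i * e i (zs j) * e i (zs l))) - n * (\<integral>z. (\<Sum>i\<in>I. c i * e i (zs j) * e i z) \<partial>gibbs b G)
       = \<psi> 1 + (\<Sum>l\<in>{..<n}-{j}. \<psi> (R (zs j) (zs l))) - n * (\<integral>z. \<psi> (R (zs j) z) \<partial>gibbs b G)"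
      if zs: "zs \<in> space (PiM {..<n} (\<lambda>_. M))" for zs
    proof -
      note zj = space_productD[OF zs j]
      have "(\<Sum>l<n. (\<Sum>i\<in>I. c i * e i (zs j) * e i (zs l))) = (\<Sum>l<n. \<psi> (R (zs j) (zs l)) - k0)"
        using zs by (intro sum.cong refl \<Psi> zj) (auto dest: space_productD)
      also have "\<dots> = \<psi> 1 + (\<Sum>l\<in>{..<n}-{j}. \<psi> (R (zs j) (zs l))) - n * k0"
        using j R_refl[OF zj] by (simp add: sum_subtractf sum.remove[of "{..<n}" j])
      finally have 1: "(\<Sum>l<n. (\<Sum>i\<in>I. c i * e i (zs j) * e i (zs l))) = \<psi> 1 + (\<Sum>l\<in>{..<n}-{j}. \<psi> (R (zs j) (zs l))) - n * k0" .
      have "(\<integral>z. (\<Sum>i\<in>I. c i * e i (zs j) * e i z) \<partial>gibbs b G) = (\<integral>z. \<psi> (R (zs j) z) - k0 \<partial>gibbs b G)"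
        using zj by (intro Bochner_Integration.integral_cong refl \<Psi>) auto
      also have "\<dots> = (\<integral>z. \<psi> (R (zs j) z) \<partial>gibbs b G) - k0"
        using bounded_overlap_gibbs[OF \<psi> zj] gb.prob_space by (simp add: integrable_gibbs)
      finally have 2: "(\<integral>z. (\<Sum>i\<in>I. c i * e i (zs j) * e i z) \<partial>gibbs b G) = (\<integral>z. \<psi> (R (zs j) z) \<partial>gibbs b G) - k0" .
      show ?thesis unfolding 1 2 by (simp add: algebra_simps)
    qed
    have b1: "bounded_measurable (PiM {..<n} (\<lambda>_. M)) (\<lambda>zs. f zs * (\<Sum>l\<in>{..<n}-{j}. \<psi> (R (zs j) (zs l))))"
      using j by (intro bounded_measurable_mult bounded_measurable_sum fb bounded_overlap_replicas \<psi>) auto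
    have b2: "bounded_measurable (PiM {..<n} (\<lambda>_. M)) (\<lambda>zs. f zs * (\<integral>z. \<psi> (R (zs j) z) \<partial>gibbs b G))"
      by (intro bounded_measurable_mult fb bounded_overlap_integral \<psi> j)
    have "(\<integral>zs. f zs * ((\<Sum>l<n. (\<Sum>i\<in>I. c i * e i (zs j) * e i (zs l))) - n * (\<integral>z. (\<Sum>i\<in>I. c i * e i (zs j) * e i z) \<partial>gibbs b G)) \<partial>replicas n b G)
      = (\<integral>zs. (\<psi> 1 * f zs + f zs * (\<Sum>l\<in>{..<n}-{j}. \<psi> (R (zs j) (zs l)))) - n * (f zs * (\<integral>z. \<psi> (R (zs j) z) \<partial>gibbs b G)) \<partial>replicas n b G)"
      by (intro Bochner_Integration.integral_cong refl) (subst pt, simp, simp add: algebra_simps)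
    also have "\<dots> = (\<integral>zs. \<psi> 1 * f zs + f zs * (\<Sum>l\<in>{..<n}-{j}. \<psi> (R (zs j) (zs l))) \<partial>replicas n b G) - (\<integral>zs. n * (f zs * (\<integral>z. \<psi> (R (zs j) z) \<partial>gibbs b G)) \<partial>replicas n b G)"
      by (intro Bochner_Integration.integral_diff integrable_replicas bounded_measurable_add bounded_measurable_mult[OF bounded_measurable_const] fb b1 b2)
    also have "(\<integral>zs. \<psi> 1 * f zs + f zs * (\<Sum>l\<in>{..<n}-{j}. \<psi> (R (zs j) (zs l))) \<partial>replicas n b G)
       = (\<integral>zs. \<psi> 1 * f zs \<partial>replicas n b G) + (\<integral>zs. f zs * (\<Sum>l\<in>{..<n}-{j}. \<psi> (R (zs j) (zs l))) \<partial>replicas n b G)"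
      by (intro Bochner_Integration.integral_add integrable_replicas bounded_measurable_mult[OF bounded_measurable_const] fb b1)
    finally show ?thesis by simp
  qed
  have "\<bar>\<integral>G. h (U G) * ((\<integral>zs. f zs * ((\<Sum>l<n. (\<Sum>i\<in>I. c i * e i (zs j) * e i (zs l))) - n * (\<integral>z. (\<Sum>i\<in>I. c i * e i (zs j) * e i z) \<partial>gibbs b G)) \<partial>replicas n b G)
       - U G * (\<integral>zs. f zs \<partial>replicas n b G)) \<partial>gauss I\<bar>
     \<le> (1 + L * \<Lambda>) * (\<integral>G. (\<integral>z. \<bar>u G z - U G\<bar> \<partial>gibbs b G) \<partial>gauss I) + L * \<kappa>"
    unfolding u_def U_def
    by (rule weighted_ghirlanda_guerra[OF b _ \<kappa> h h' f f1 j]) (simp_all add: \<Psi> \<Lambda>)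
  then show ?thesis unfolding eq by (simp add: algebra_simps)
qed

text \<open>
  The error \<open>err\<close> bounds the defect in \<open>overlap_identity\<close> for weights with derivative at most \<open>1 / \<theta>\<close>. The
  function \<open>\<psi>\<close> need only separate overlaps below \<open>\<alpha>\<close> from those above \<open>\<beta>\<close>, since overlaps in between
  are assumed rare. With \<open>B n\<close> the weighted probability that all overlaps among \<open>n\<close> replicas are at most
  \<open>\<beta>\<close>, the identity gives \<open>B (n + 1) \<ge> \<delta> * B n - D\<close>, and positive semidefiniteness gives \<open>B m = 0\<close>. Hence
  the total weight \<open>B 1\<close> is small. Where the weight is small the label \<open>y\<close> is below \<open>\<delta>\<close>, and the identity
  with the complementary weight bounds the probability of an overlap below \<open>\<alpha>\<close> there.
\<close>

theorem negative_overlap_bound: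
  fixes b c :: "'i \<Rightarrow> real" and \<psi> :: "real \<Rightarrow> real" and m :: nat
    and \<alpha> \<beta> \<delta> \<epsilon> \<theta> \<kappa> \<Lambda> k0 err :: real
  assumes b: "\<And>i. i \<in> I \<Longrightarrow> b i \<noteq> 0"
    and \<psi>c: "continuous_on UNIV \<psi>"
    and \<Psi>: "\<And>z z'. z \<in> space M \<Longrightarrow> z' \<in> space M \<Longrightarrow> (\<Sum>i\<in>I. c i * e i z * e i z') = \<psi> (R z z') - k0"
    and \<Lambda>: "\<And>z z'. z \<in> space M \<Longrightarrow> z' \<in> space M \<Longrightarrow> \<bar>\<psi> (R z z') - k0\<bar> \<le> \<Lambda>"
    and \<kappa>: "\<And>z z'. z \<in> space M \<Longrightarrow> z' \<in> space M \<Longrightarrow> \<bar>\<Sum>i\<in>I. (c i / b i)\<^sup>2 * e i z * e i z'\<bar> \<le> \<kappa>"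
    and \<psi>_ge: "\<And>r. \<bar>r\<bar> \<le> 1 \<Longrightarrow> - \<theta> \<le> \<psi> r" and \<psi>_le: "\<And>r. \<bar>r\<bar> \<le> 1 \<Longrightarrow> \<psi> r \<le> 1 + \<theta>"
    and \<psi>_low: "\<And>r. \<bar>r\<bar> \<le> 1 \<Longrightarrow> r \<le> \<alpha> \<Longrightarrow> \<psi> r \<le> \<theta>"
    and \<psi>_high: "\<And>r. \<bar>r\<bar> \<le> 1 \<Longrightarrow> \<beta> < r \<Longrightarrow> 1 - \<theta> \<le> \<psi> r"
    and zone: "(\<integral>G. overlap_mean b G (indicator {\<alpha><..\<beta>}) \<partial>gauss I) \<le> \<theta>"
    and \<theta>: "0 < \<theta>" "\<theta> \<le> 1" and \<delta>: "0 < \<delta>" "\<delta> \<le> 1"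
    and \<beta>: "\<beta> \<le> - \<epsilon>" and m: "1 < (real m - 1) * \<epsilon>" "1 \<le> m"
  defines "err \<equiv> (1 + 1 / \<theta> * \<Lambda>) * (\<integral>G. (\<integral>z. \<bar>ham (\<lambda>i. c i / b i) G z - (\<integral>z. ham (\<lambda>i. c i / b i) G z \<partial>gibbs b G)\<bar> \<partial>gibbs b G) \<partial>gauss I) + 1 / \<theta> * \<kappa>"
  shows "(\<integral>G. overlap_mean b G (indicator {..\<alpha>}) \<partial>gauss I)
     \<le> \<delta> + 2 * \<theta> + err + 2 * (m * (5 * m * \<theta> + err) / \<delta> ^ (m - 1))"
proof -
  interpret \<Gamma>: prob_space "gauss I" by (rule prob_space_gauss)
  have \<psi>: "bounded_on_overlaps \<psi>" by (rule bounded_on_overlaps_continuous[OF \<psi>c])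
  obtain H H' :: "real \<Rightarrow> real" where H:
    "\<And>t. (H has_real_derivative H' t) (at t)" "\<And>t. 0 \<le> H t" "\<And>t. H t \<le> 1" "\<And>t. \<bar>H' t\<bar> \<le> 1 / \<theta>"
    and H'm[measurable]: "H' \<in> borel_measurable borel"
    and Hlow: "\<And>t. \<delta> * H t - \<theta> \<le> t * H t" and Hup: "\<And>t. t * (1 - H t) \<le> \<delta> + \<theta>"
    using soft_threshold[of \<theta> \<delta>] \<theta> \<delta> by (metis less_imp_le)
  have Hm[measurable]: "H \<in> borel_measurable borel"
    by (intro borel_measurable_continuous_onI continuous_at_imp_continuous_on)
       (use H(1) DERIV_isCont in blast)
  define U where "U = (\<lambda>G. \<integral>z. ham (\<lambda>i. c i / b i) G z \<partial>gibbs b G)"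
  define y where "y = (\<lambda>G. 1 - \<psi> 1 + U G)"
  have iU: "integrable (gauss I) U" unfolding U_def by (rule integrable_mean_ham)
  have iy: "integrable (gauss I) y" unfolding y_def using iU by simp
  have ym[measurable]: "y \<in> borel_measurable (gauss I)" using iy by auto
  have bH: "bounded_measurable (gauss I) (\<lambda>G. H (y G))"
    using H by (intro bounded_measurableI[where B=1] measurable_compose[OF ym Hm]) auto
  have iyq: "integrable (gauss I) (\<lambda>G. y G * q G)" if q: "bounded_measurable (gauss I) q" for q
  proof -
    obtain B where B: "\<And>G. G \<in> space (gauss I) \<Longrightarrow> \<bar>q G\<bar> \<le> B" using q by (metis bounded_measurableE)
    note [measurable] = bounded_measurableD[OF q]
    show ?thesis
    proof (rule Bochner_Integration.integrable_bound)
      show "integrable (gauss I) (\<lambda>G. B * y G)" using iy by simp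
      show "AE G in gauss I. norm (y G * q G) \<le> norm (B * y G)"
      proof (intro AE_I2)
        fix G assume "G \<in> space (gauss I)"
        from B[OF this] have "\<bar>y G\<bar> * \<bar>q G\<bar> \<le> \<bar>y G\<bar> * \<bar>B\<bar>" by (intro mult_left_mono) auto
        then show "norm (y G * q G) \<le> norm (B * y G)" by (simp add: abs_mult mult.commute)
      qed
    qed measurable
  qed
  have GG: "\<bar>\<integral>G. w (y G) * ((1 - y G) * (\<integral>zs. f zs \<partial>replicas n b G)
          + (\<integral>zs. f zs * (\<Sum>l\<in>{..<n}-{j}. \<psi> (R (zs j) (zs l))) \<partial>replicas n b G)
          - n * (\<integral>zs. f zs * (\<integral>z. \<psi> (R (zs j) z) \<partial>gibbs b G) \<partial>replicas n b G)) \<partial>gauss I\<bar> \<le> err"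
    if w: "\<And>t. (w has_real_derivative w' t) (at t)" "\<And>t. \<bar>w t\<bar> \<le> 1" "\<And>t. \<bar>w' t\<bar> \<le> 1 / \<theta>"
      and [measurable]: "w' \<in> borel_measurable borel"
      and f: "f \<in> borel_measurable (PiM {..<n} (\<lambda>_. M))"
      and f1: "\<And>zs. zs \<in> space (PiM {..<n} (\<lambda>_. M)) \<Longrightarrow> \<bar>f zs\<bar> \<le> 1"
      and j: "j < n" for w w' f and n j :: nat
  proof -
    have d: "((\<lambda>t. w (1 - \<psi> 1 + t)) has_real_derivative w' (1 - \<psi> 1 + t)) (at t)" for t
      by (rule DERIV_cong[OF DERIV_chain2[OF w(1)]]) (auto intro!: derivative_eq_intros)
    have m: "(\<lambda>t. w' (1 - \<psi> 1 + t)) \<in> borel_measurable borel" by measurable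
    have e: "\<psi> 1 - U G = 1 - y G" for G by (simp add: y_def)
    show ?thesis
      using overlap_identity[OF b \<psi> \<Psi> \<Lambda> \<kappa> d w(2) w(3) m f f1 j]
      unfolding U_def[symmetric] e unfolding err_def U_def y_def by simp
  qed
  have err0: "0 \<le> err"
    using GG[OF H(1) _ H(4) H'm, of "\<lambda>_. 0" 1 0] H by simp

  \<comment> \<open>\<open>Q n\<close> is the probability that the overlaps among \<open>n\<close> replicas are all at most \<open>\<beta>\<close>; on that event,
     \<open>S n j\<close> collects \<open>\<psi>\<close> of the overlaps of replica \<open>j\<close> with the others, and \<open>P n j\<close> averages \<open>\<psi>\<close> of its
     overlap with a fresh replica.\<close>
  define A where "A = (\<lambda>(n::nat) zs. \<forall>j\<in>{..<n}. \<forall>l\<in>{..<n}. j \<noteq> l \<longrightarrow> R (zs j) (zs l) \<le> \<beta>)"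
  define a where "a = (\<lambda>n zs. of_bool (A n zs) :: real)"
  have am: "(a n) \<in> borel_measurable (PiM {..<k} (\<lambda>_. M))" if "n \<le> k" for n k :: nat
  proof -
    have [measurable]: "(\<lambda>zs. R (zs j) (zs l)) \<in> borel_measurable (PiM {..<k} (\<lambda>_. M))" if "j \<in> {..<n}" "l \<in> {..<n}" for j l
    proof -
      have "(\<lambda>zs. (zs j, zs l)) \<in> measurable (PiM {..<k} (\<lambda>_. M)) (M \<Otimes>\<^sub>M M)"
        using that \<open>n \<le> k\<close> by (intro measurable_Pair measurable_component_singleton) auto
      from measurable_compose[OF this R_measurable] show ?thesis by simp
    qed
    have [measurable]: "Measurable.pred (PiM {..<k} (\<lambda>_. M)) (A n)"
      unfolding A_def by measurable
    show ?thesis unfolding a_def by measurable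
  qed
  have a01: "0 \<le> a n zs" "a n zs \<le> 1" "\<bar>a n zs\<bar> \<le> 1" for n zs by (auto simp: a_def)
  have ab: "bounded_measurable (PiM {..<k} (\<lambda>_. M)) (a n)" if "n \<le> k" for n k :: nat
    by (rule bounded_measurableI[OF am[OF that], where B=1]) (rule a01)
  have a_upd: "a n (zs(n := z)) = a n zs" for n zs z
  proof -
    have "A n (zs(n := z)) = A n zs" unfolding A_def by (intro ball_cong refl) auto
    then show ?thesis by (simp add: a_def)
  qed
  define Q where "Q = (\<lambda>n G. \<integral>zs. a n zs \<partial>replicas n b G)"
  define S where "S = (\<lambda>n j G. \<integral>zs. a n zs * (\<Sum>l\<in>{..<n}-{j}. \<psi> (R (zs j) (zs l))) \<partial>replicas n b G)"
  define P where "P = (\<lambda>n j G. \<integral>zs. a n zs * (\<integral>z. \<psi> (R (zs j) z) \<partial>gibbs b G) \<partial>replicas n b G)"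
  define \<rho> where "\<rho> = (\<lambda>G. overlap_mean b G (indicator {\<alpha><..\<beta>}))"
  have bQ: "bounded_measurable (gauss I) (Q n)" for n
    unfolding Q_def by (intro bounded_replicas_gauss ab) simp
  have bS: "bounded_measurable (gauss I) (S n j)" if "j < n" for n j
    unfolding S_def using that
    by (intro bounded_replicas_gauss bounded_measurable_mult ab bounded_measurable_sum bounded_overlap_replicas \<psi>) auto
  have P_Suc: "P n j G = (\<integral>zs. a n zs * \<psi> (R (zs j) (zs n)) \<partial>replicas (Suc n) b G)" if "j < n" for n j G
  proof -
    have "bounded_measurable (PiM {..<Suc n} (\<lambda>_. M)) (\<lambda>zs. a n zs * \<psi> (R (zs j) (zs n)))"
      using that by (intro bounded_measurable_mult ab bounded_overlap_replicas \<psi>) auto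
    from integral_replicas_Suc[OF this] that show ?thesis unfolding P_def by (simp add: a_upd)
  qed
  have bP: "bounded_measurable (gauss I) (P n j)" if "j < n" for n j
    unfolding P_Suc[OF that, abs_def] using that
    by (intro bounded_replicas_gauss bounded_measurable_mult ab bounded_overlap_replicas \<psi>) auto
  have b\<rho>: "bounded_measurable (gauss I) \<rho>" unfolding \<rho>_def by (intro bounded_overlap_mean) auto
  have Q_Suc: "Q n G = (\<integral>zs. a n zs \<partial>replicas (Suc n) b G)" for n G
  proof -
    interpret gb: prob_space "gibbs b G" by (rule prob_space_gibbs)
    show ?thesis
    using integral_replicas_Suc[OF ab[of n "Suc n"], of b G] unfolding Q_def by (simp add: a_upd gb.prob_space)
  qed
  have Q01: "0 \<le> Q n G" "Q n G \<le> 1" for n G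
  proof -
    show "0 \<le> Q n G" unfolding Q_def by (intro integral_nonneg_AE) (simp add: a01)
    have "\<bar>Q n G\<bar> \<le> 1" unfolding Q_def by (intro abs_integral_replicas_le am a01) simp
    then show "Q n G \<le> 1" by simp
  qed
  have \<rho>0: "0 \<le> \<rho> G" for G unfolding \<rho>_def overlap_mean_def by (intro integral_nonneg_AE) simp

  have S_le: "S n j G \<le> n * \<theta> + 2 * (n * \<rho> G)" if j: "j < n" for n j G
  proof -
    interpret rp: prob_space "replicas n b G" by (rule prob_space_replicas)
    have bi: "bounded_measurable (PiM {..<n} (\<lambda>_. M)) (\<lambda>zs. indicator {\<alpha><..\<beta>} (R (zs j) (zs l)))" if "l < n" for l
      using j that by (intro bounded_overlap_replicas) auto
    have "S n j G \<le> (\<integral>zs. (\<Sum>l\<in>{..<n}-{j}. \<theta> + 2 * indicator {\<alpha><..\<beta>} (R (zs j) (zs l))) \<partial>replicas n b G)"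
      unfolding S_def
    proof (rule integral_mono)
      show "integrable (replicas n b G) (\<lambda>zs. a n zs * (\<Sum>l\<in>{..<n}-{j}. \<psi> (R (zs j) (zs l))))"
        using j by (intro integrable_replicas bounded_measurable_mult ab bounded_measurable_sum bounded_overlap_replicas \<psi>) auto
      show "integrable (replicas n b G) (\<lambda>zs. \<Sum>l\<in>{..<n}-{j}. \<theta> + 2 * indicator {\<alpha><..\<beta>} (R (zs j) (zs l)))"
        by (intro integrable_replicas bounded_measurable_sum bounded_measurable_add bounded_measurable_mult[OF bounded_measurable_const] bi) auto
      fix zs assume "zs \<in> space (replicas n b G)"
      then have zs: "zs \<in> space (PiM {..<n} (\<lambda>_. M))" by simp
      show "a n zs * (\<Sum>l\<in>{..<n}-{j}. \<psi> (R (zs j) (zs l))) \<le> (\<Sum>l\<in>{..<n}-{j}. \<theta> + 2 * indicator {\<alpha><..\<beta>} (R (zs j) (zs l)))"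
      proof (cases "A n zs")
        case True
        have "\<psi> (R (zs j) (zs l)) \<le> \<theta> + 2 * indicator {\<alpha><..\<beta>} (R (zs j) (zs l))" if l: "l \<in> {..<n}-{j}" for l
        proof -
          have r: "\<bar>R (zs j) (zs l)\<bar> \<le> 1" using l j by (intro R_le space_productD[OF zs]) auto
          have "R (zs j) (zs l) \<le> \<beta>" using True l j unfolding A_def by auto
          then show ?thesis
            using \<psi>_low[OF r] \<psi>_le[OF r] \<theta> by (cases "R (zs j) (zs l) \<le> \<alpha>") auto
        qed
        then have "(\<Sum>l\<in>{..<n}-{j}. \<psi> (R (zs j) (zs l))) \<le> (\<Sum>l\<in>{..<n}-{j}. \<theta> + 2 * indicator {\<alpha><..\<beta>} (R (zs j) (zs l)))"
          by (rule sum_mono)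
        then show ?thesis using True unfolding a_def by simp
      next
        case False
        then show ?thesis using \<theta> unfolding a_def by (auto intro!: sum_nonneg)
      qed
    qed
    also have "\<dots> = (\<Sum>l\<in>{..<n}-{j}. \<integral>zs. \<theta> + 2 * indicator {\<alpha><..\<beta>} (R (zs j) (zs l)) \<partial>replicas n b G)"
      by (intro Bochner_Integration.integral_sum integrable_replicas bounded_measurable_add bounded_measurable_mult[OF bounded_measurable_const] bi) auto
    also have "\<dots> = (\<Sum>l\<in>{..<n}-{j}. \<theta> + 2 * \<rho> G)"
    proof (rule sum.cong[OF refl])
      fix l assume l: "l \<in> {..<n}-{j}"
      have "(\<integral>zs. indicator {\<alpha><..\<beta>} (R (zs j) (zs l)) \<partial>replicas n b G) = \<rho> G"
        unfolding \<rho>_def using l j by (intro overlap_mean_pair) auto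
      then show "(\<integral>zs. \<theta> + 2 * indicator {\<alpha><..\<beta>} (R (zs j) (zs l)) \<partial>replicas n b G) = \<theta> + 2 * \<rho> G"
        using l by (subst Bochner_Integration.integral_add)
           (auto simp: rp.prob_space intro!: integrable_replicas bounded_measurable_mult[OF bounded_measurable_const] bi)
    qed
    also have "\<dots> \<le> real n * (\<theta> + 2 * \<rho> G)"
    proof -
      have "card ({..<n}-{j}) \<le> n" using card_mono[of "{..<n}" "{..<n}-{j}"] by auto
      then show ?thesis using \<theta> \<rho>0[of G] by (simp add: mult_right_mono)
    qed
    finally show ?thesis by (simp add: algebra_simps)
  qed

  have Q_step: "Q n G - (\<Sum>j<n. P n j G) - n * \<theta> \<le> Q (Suc n) G" for n G
  proof -
    interpret rp: prob_space "replicas (Suc n) b G" by (rule prob_space_replicas)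
    have b1: "bounded_measurable (PiM {..<Suc n} (\<lambda>_. M)) (\<lambda>zs. a n zs * \<psi> (R (zs j) (zs n)))" if "j < n" for j
      using that by (intro bounded_measurable_mult ab bounded_overlap_replicas \<psi>) auto
    have b2: "bounded_measurable (PiM {..<Suc n} (\<lambda>_. M)) (\<lambda>zs. \<Sum>j<n. a n zs * \<psi> (R (zs j) (zs n)))"
      by (intro bounded_measurable_sum b1) auto
    have "Q n G - (\<Sum>j<n. P n j G) - n * \<theta> = (\<integral>zs. a n zs - (\<Sum>j<n. a n zs * \<psi> (R (zs j) (zs n))) - n * \<theta> \<partial>replicas (Suc n) b G)"
    proof -
      have "(\<Sum>j<n. P n j G) = (\<integral>zs. (\<Sum>j<n. a n zs * \<psi> (R (zs j) (zs n))) \<partial>replicas (Suc n) b G)"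
        using b1 by (subst Bochner_Integration.integral_sum) (auto simp: P_Suc intro!: integrable_replicas)
      then show ?thesis
        unfolding Q_Suc using ab[of n "Suc n"] b2
        by (simp add: integrable_replicas rp.prob_space)
    qed
    also have "\<dots> \<le> (\<integral>zs. a (Suc n) zs \<partial>replicas (Suc n) b G)"
    proof (rule integral_mono)
      show "integrable (replicas (Suc n) b G) (\<lambda>zs. a n zs - (\<Sum>j<n. a n zs * \<psi> (R (zs j) (zs n))) - n * \<theta>)"
        using ab[of n "Suc n"] b2 by (intro integrable_replicas bounded_measurable_diff bounded_measurable_const) auto
      show "integrable (replicas (Suc n) b G) (a (Suc n))" by (intro integrable_replicas ab) simp
      fix zs assume "zs \<in> space (replicas (Suc n) b G)"
      then have zs: "zs \<in> space (PiM {..<Suc n} (\<lambda>_. M))" by simp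
      have r: "\<bar>R (zs j) (zs n)\<bar> \<le> 1" if "j < n" for j
        using that by (intro R_le space_productD[OF zs]) auto
      have nonneg: "0 \<le> \<psi> (R (zs j) (zs n)) + \<theta>" if "j < n" for j using \<psi>_ge[OF r[OF that]] by linarith
      show "a n zs - (\<Sum>j<n. a n zs * \<psi> (R (zs j) (zs n))) - n * \<theta> \<le> a (Suc n) zs"
      proof (cases "A n zs")
        case False
        then have "a n zs = 0" by (simp add: a_def)
        moreover have "0 \<le> real n * \<theta>" using \<theta> by simp
        ultimately show ?thesis using a01(1)[of "Suc n" zs] by simp
      next
        case An: True
        have sum: "(\<Sum>j<n. \<psi> (R (zs j) (zs n))) + n * \<theta> = (\<Sum>j<n. \<psi> (R (zs j) (zs n)) + \<theta>)"
          by (simp add: sum.distrib)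
        show ?thesis
        proof (cases "\<exists>j<n. \<beta> < R (zs j) (zs n)")
          case True
          then obtain j where j: "j < n" "\<beta> < R (zs j) (zs n)" by auto
          have "1 \<le> \<psi> (R (zs j) (zs n)) + \<theta>" using \<psi>_high[OF r[OF j(1)] j(2)] by linarith
          also have "\<dots> \<le> (\<Sum>j<n. \<psi> (R (zs j) (zs n)) + \<theta>)"
            using j nonneg by (intro member_le_sum) auto
          finally have "1 \<le> (\<Sum>j<n. \<psi> (R (zs j) (zs n))) + n * \<theta>" using sum by simp
          then show ?thesis using An by (simp add: a_def)
        next
          case False
          have "A (Suc n) zs"
            unfolding A_def
          proof (intro ballI impI)
            fix j l assume jl: "j \<in> {..<Suc n}" "l \<in> {..<Suc n}" "j \<noteq> l"
            consider "j < n" "l < n" | "j = n" "l < n" | "j < n" "l = n" using jl by force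
            then show "R (zs j) (zs l) \<le> \<beta>"
            proof cases
              case 1 then show ?thesis using An jl unfolding A_def by auto
            next
              case 2
              then have "R (zs j) (zs l) = R (zs l) (zs n)"
                by (simp only:) (intro R_sym space_productD[OF zs], auto)
              then show ?thesis using False 2 by force
            next
              case 3 then show ?thesis using False by force
            qed
          qed
          moreover have "0 \<le> (\<Sum>j<n. \<psi> (R (zs j) (zs n))) + n * \<theta>"
            unfolding sum using nonneg by (intro sum_nonneg) auto
          ultimately show ?thesis using An by (simp add: a_def)
        qed
      qed
    qed
    finally show ?thesis unfolding Q_def .
  qed

  define B where "B = (\<lambda>n. \<integral>G. H (y G) * Q n G \<partial>gauss I)"
  define D where "D = 5 * m * \<theta> + err"
  have D0: "0 \<le> D" unfolding D_def using \<theta> err0 by simp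
  have iHQ: "integrable (gauss I) (\<lambda>G. H (y G) * Q n G)" for n
    by (intro \<Gamma>.integrable_bounded_measurable bounded_measurable_mult bH bQ)
  have iHyQ: "integrable (gauss I) (\<lambda>G. H (y G) * (y G * Q n G))" for n
    using iyq[OF bounded_measurable_mult[OF bH bQ[of n]]] by (simp add: mult_ac)
  have iHS: "integrable (gauss I) (\<lambda>G. H (y G) * S n j G)" if "j < n" for n j
    using that by (intro \<Gamma>.integrable_bounded_measurable bounded_measurable_mult bH bS)
  have iHP: "integrable (gauss I) (\<lambda>G. H (y G) * P n j G)" if "j < n" for n j
    using that by (intro \<Gamma>.integrable_bounded_measurable bounded_measurable_mult bH bP)
  have B_step: "\<delta> * B n - D \<le> B (Suc n)" if n: "1 \<le> n" "n \<le> m" for n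
  proof -
    have HS: "(\<integral>G. H (y G) * S n j G \<partial>gauss I) \<le> 3 * (n * \<theta>)" if j: "j < n" for j
    proof -
      have "(\<integral>G. H (y G) * S n j G \<partial>gauss I) \<le> (\<integral>G. n * \<theta> + 2 * (n * \<rho> G) \<partial>gauss I)"
      proof (rule integral_mono[OF iHS[OF j]])
        show "integrable (gauss I) (\<lambda>G. n * \<theta> + 2 * (n * \<rho> G))"
          by (intro \<Gamma>.integrable_bounded_measurable bounded_measurable_add bounded_measurable_mult bounded_measurable_const b\<rho>)
        fix G
        have "H (y G) * S n j G \<le> H (y G) * (n * \<theta> + 2 * (n * \<rho> G))"
          by (intro mult_left_mono S_le j H)
        also have "\<dots> \<le> 1 * (n * \<theta> + 2 * (n * \<rho> G))"
          using \<theta> \<rho>0[of G] by (intro mult_right_mono H) auto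
        finally show "H (y G) * S n j G \<le> n * \<theta> + 2 * (n * \<rho> G)" by simp
      qed
      also have "\<dots> = n * \<theta> + 2 * (n * (\<integral>G. \<rho> G \<partial>gauss I))"
        using \<Gamma>.integrable_bounded_measurable[OF b\<rho>] by (simp add: \<Gamma>.prob_space)
      also have "\<dots> \<le> n * \<theta> + 2 * (n * \<theta>)" using mult_left_mono[OF zone, of "real n"] unfolding \<rho>_def by (simp add: mult.commute)
      finally show ?thesis by linarith
    qed
    \<comment> \<open>This is the identity for the indicator \<open>a n\<close>: a fresh replica rises above \<open>\<beta>\<close> relative to \<open>zs j\<close> with
       probability about \<open>1 - y\<close> divided by \<open>n\<close>, so the union bound over \<open>j\<close> costs \<open>1 - y\<close> in total.\<close>
    have HP: "n * (\<integral>G. H (y G) * P n j G \<partial>gauss I) \<le> B n - (\<integral>G. H (y G) * (y G * Q n G) \<partial>gauss I) + 3 * (n * \<theta>) + err" if j: "j < n" for j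
    proof -
      have "\<bar>\<integral>G. H (y G) * ((1 - y G) * Q n G + S n j G - n * P n j G) \<partial>gauss I\<bar> \<le> err"
        unfolding Q_def S_def P_def
        by (rule GG[OF H(1) _ H(4) H'm am[OF order_refl] a01(3) j]) (simp add: H)
      also have "(\<integral>G. H (y G) * ((1 - y G) * Q n G + S n j G - n * P n j G) \<partial>gauss I)
         = (\<integral>G. (H (y G) * Q n G - H (y G) * (y G * Q n G)) + H (y G) * S n j G - n * (H (y G) * P n j G) \<partial>gauss I)"
        by (intro Bochner_Integration.integral_cong refl) (simp add: algebra_simps)
      also have "\<dots> = (\<integral>G. H (y G) * Q n G \<partial>gauss I) - (\<integral>G. H (y G) * (y G * Q n G) \<partial>gauss I)
          + (\<integral>G. H (y G) * S n j G \<partial>gauss I) - n * (\<integral>G. H (y G) * P n j G \<partial>gauss I)"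
        using iHQ iHyQ iHS[OF j] iHP[OF j] by simp
      finally show ?thesis using HS[OF j] unfolding B_def by linarith
    qed
    have sumP: "(\<Sum>j<n. \<integral>G. H (y G) * P n j G \<partial>gauss I) \<le> B n - (\<integral>G. H (y G) * (y G * Q n G) \<partial>gauss I) + 3 * (n * \<theta>) + err" (is "_ \<le> ?X")
    proof -
      have "n * (\<Sum>j<n. \<integral>G. H (y G) * P n j G \<partial>gauss I) \<le> (\<Sum>j<n. ?X)"
        unfolding sum_distrib_left using HP by (intro sum_mono) auto
      then have "n * (\<Sum>j<n. \<integral>G. H (y G) * P n j G \<partial>gauss I) \<le> n * ?X" by simp
      then show ?thesis using n by simp
    qed
    have yH: "\<delta> * B n - \<theta> \<le> (\<integral>G. H (y G) * (y G * Q n G) \<partial>gauss I)"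
    proof -
      have "\<delta> * B n - \<theta> = (\<integral>G. \<delta> * (H (y G) * Q n G) - \<theta> \<partial>gauss I)"
        unfolding B_def using iHQ[of n] by (simp add: \<Gamma>.prob_space)
      also have "\<dots> \<le> (\<integral>G. H (y G) * (y G * Q n G) \<partial>gauss I)"
      proof (rule integral_mono[OF _ iHyQ])
        show "integrable (gauss I) (\<lambda>G. \<delta> * (H (y G) * Q n G) - \<theta>)" using iHQ[of n] by simp
        fix G
        have "(\<delta> * H (y G) - \<theta>) * Q n G \<le> (y G * H (y G)) * Q n G" using Hlow Q01 by (intro mult_right_mono)
        moreover have "\<theta> * Q n G \<le> \<theta> * 1" using \<theta> Q01 by (intro mult_left_mono) auto
        ultimately show "\<delta> * (H (y G) * Q n G) - \<theta> \<le> H (y G) * (y G * Q n G)" by (simp add: algebra_simps)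
      qed
      finally show ?thesis .
    qed
    have "B n - (\<Sum>j<n. \<integral>G. H (y G) * P n j G \<partial>gauss I) - n * \<theta>
       = (\<integral>G. H (y G) * Q n G - (\<Sum>j<n. H (y G) * P n j G) - n * \<theta> \<partial>gauss I)"
    proof -
      have "integrable (gauss I) (\<lambda>G. \<Sum>j<n. H (y G) * P n j G)"
        using iHP by (intro Bochner_Integration.integrable_sum) auto
      moreover have "(\<integral>G. (\<Sum>j<n. H (y G) * P n j G) \<partial>gauss I) = (\<Sum>j<n. \<integral>G. H (y G) * P n j G \<partial>gauss I)"
        using iHP by (intro Bochner_Integration.integral_sum) auto
      ultimately show ?thesis
        unfolding B_def using iHQ[of n] by (simp add: \<Gamma>.prob_space)
    qed
    also have "\<dots> \<le> B (Suc n)"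
      unfolding B_def
    proof (rule integral_mono[OF _ iHQ])
      show "integrable (gauss I) (\<lambda>G. H (y G) * Q n G - (\<Sum>j<n. H (y G) * P n j G) - n * \<theta>)"
        using iHP by (intro Bochner_Integration.integrable_diff Bochner_Integration.integrable_sum iHQ iHP \<Gamma>.integrable_const) auto
      fix G
      have "H (y G) * (Q n G - (\<Sum>j<n. P n j G) - n * \<theta>) \<le> H (y G) * Q (Suc n) G"
        by (intro mult_left_mono Q_step H)
      moreover have "H (y G) * (n * \<theta>) \<le> 1 * (n * \<theta>)" using \<theta> by (intro mult_right_mono H) auto
      ultimately show "H (y G) * Q n G - (\<Sum>j<n. H (y G) * P n j G) - n * \<theta> \<le> H (y G) * Q (Suc n) G"
        by (simp add: algebra_simps sum_distrib_left)
    qed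
    finally have "\<delta> * B n - \<theta> - 4 * (n * \<theta>) - err \<le> B (Suc n)" using sumP yH by linarith
    moreover have "\<theta> + 4 * (n * \<theta>) \<le> 5 * m * \<theta>"
    proof -
      have "\<theta> \<le> m * \<theta>" "n * \<theta> \<le> m * \<theta>" using n \<theta> by auto
      then show ?thesis by linarith
    qed
    ultimately show ?thesis unfolding D_def by linarith
  qed
  have B_ge: "\<delta> ^ n * B 1 - n * D \<le> B (Suc n)" if "n < m" for n
    using that
  proof (induction n)
    case 0 then show ?case by simp
  next
    case (Suc n)
    then have IH: "\<delta> ^ n * B 1 - n * D \<le> B (Suc n)" by simp
    have "\<delta> * (\<delta> ^ n * B 1 - n * D) \<le> \<delta> * B (Suc n)" using IH \<delta> by (intro mult_left_mono) auto
    moreover have "\<delta> * (n * D) \<le> 1 * (n * D)" using \<delta> D0 by (intro mult_right_mono) auto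
    moreover have "\<delta> * B (Suc n) - D \<le> B (Suc (Suc n))" using Suc by (intro B_step) auto
    ultimately show ?case by (simp add: algebra_simps)
  qed
  have Qm: "Q m G = 0" for G
  proof -
    have "a m zs = 0" if zs: "zs \<in> space (PiM {..<m} (\<lambda>_. M))" for zs
    proof (rule ccontr)
      assume "a m zs \<noteq> 0"
      then have A: "A m zs" by (simp add: a_def split: if_splits)
      have "0 \<le> (\<Sum>j<m. \<Sum>l<m. R (zs j) (zs l))" by (intro R_psd space_productD[OF zs])
      also have "\<dots> \<le> (\<Sum>j<m. 1 + (real m - 1) * - \<epsilon>)"
      proof (rule sum_mono)
        fix j assume j: "j \<in> {..<m}"
        have "(\<Sum>l<m. R (zs j) (zs l)) = R (zs j) (zs j) + (\<Sum>l\<in>{..<m}-{j}. R (zs j) (zs l))"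
          using j by (simp add: sum.remove)
        also have "R (zs j) (zs j) = 1" using j by (intro R_refl space_productD[OF zs]) auto
        also have "(\<Sum>l\<in>{..<m}-{j}. R (zs j) (zs l)) \<le> (\<Sum>l\<in>{..<m}-{j}. - \<epsilon>)"
        proof (rule sum_mono)
          fix l assume l: "l \<in> {..<m}-{j}"
          then have "R (zs j) (zs l) \<le> \<beta>" using A j unfolding A_def by auto
          then show "R (zs j) (zs l) \<le> - \<epsilon>" using \<beta> by linarith
        qed
        also have "\<dots> = (real m - 1) * - \<epsilon>" using j m(2) by (simp add: of_nat_diff)
        finally show "(\<Sum>l<m. R (zs j) (zs l)) \<le> 1 + (real m - 1) * - \<epsilon>" by simp
      qed
      also have "\<dots> = real m * (1 - (real m - 1) * \<epsilon>)" by simp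
      also have "\<dots> < 0" using m by (intro mult_pos_neg) auto
      finally show False by simp
    qed
    then have "Q m G = (\<integral>zs. 0 \<partial>replicas m b G)"
      unfolding Q_def by (intro Bochner_Integration.integral_cong refl) simp
    then show ?thesis by simp
  qed
  have Q1: "Q 1 G = 1" for G
  proof -
    interpret rp: prob_space "replicas 1 b G" by (rule prob_space_replicas)
    have "a 1 = (\<lambda>_. 1)" by (auto simp: a_def A_def fun_eq_iff)
    then have "Q 1 G = (\<integral>zs. 1 \<partial>replicas 1 b G)" unfolding Q_def by simp
    also have "\<dots> = 1" using rp.prob_space by simp
    finally show ?thesis .
  qed
  have EH: "(\<integral>G. H (y G) \<partial>gauss I) \<le> m * D / \<delta> ^ (m - 1)"
  proof -
    have "\<delta> ^ (m - 1) * B 1 - real (m - 1) * D \<le> B (Suc (m - 1))" using m(2) by (intro B_ge) auto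
    also have "B (Suc (m - 1)) = 0" using m(2) unfolding B_def by (simp add: Qm)
    finally have "\<delta> ^ (m - 1) * B 1 \<le> real (m - 1) * D" by simp
    also have "\<dots> \<le> m * D" using D0 by (intro mult_right_mono) auto
    finally have "B 1 \<le> m * D / \<delta> ^ (m - 1)" using \<delta> by (simp add: pos_le_divide_eq mult.commute)
    then show ?thesis unfolding B_def unfolding Q1 by simp
  qed

  define V where "V = (\<lambda>G. overlap_mean b G \<psi>)"
  have bV: "bounded_measurable (gauss I) V" unfolding V_def by (rule bounded_overlap_mean[OF \<psi>])
  have bH': "bounded_measurable (gauss I) (\<lambda>G. 1 - H (y G))"
    by (intro bounded_measurable_diff bounded_measurable_const bH)
  have V1: "(\<integral>zs. 1 * (\<integral>z. \<psi> (R (zs 0) z) \<partial>gibbs b G) \<partial>replicas 1 b G) = V G" for G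
  proof -
    have "bounded_measurable (PiM {..<Suc 1} (\<lambda>_. M)) (\<lambda>zs. \<psi> (R (zs 0) (zs 1)))"
      by (intro bounded_overlap_replicas \<psi>) auto
    from integral_replicas_Suc[OF this, of b G] show ?thesis
      unfolding V_def overlap_mean_def by (simp add: numeral_2_eq_2)
  qed
  have "\<bar>\<integral>G. (1 - H (y G)) * ((1 - y G) - V G) \<partial>gauss I\<bar> \<le> err"
  proof -
    have R1: "prob_space (replicas 1 b G)" for G by (rule prob_space_replicas)
    have d1: "((\<lambda>t. 1 - H t) has_real_derivative - H' t) (at t)" for t
      by (rule DERIV_cong[OF DERIV_diff[OF DERIV_const H(1)]]) simp
    have d2: "\<bar>1 - H t\<bar> \<le> 1" for t using H(2,3)[of t] by auto
    have d3: "\<bar>- H' t\<bar> \<le> 1 / \<theta>" for t using H(4)[of t] by simp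
    have "\<bar>\<integral>G. (1 - H (y G)) * ((1 - y G) * (\<integral>zs. 1 \<partial>replicas 1 b G)
          + (\<integral>zs. 1 * (\<Sum>l\<in>{..<1}-{0}. \<psi> (R (zs 0) (zs l))) \<partial>replicas 1 b G)
          - real 1 * (\<integral>zs. 1 * (\<integral>z. \<psi> (R (zs 0) z) \<partial>gibbs b G) \<partial>replicas 1 b G)) \<partial>gauss I\<bar> \<le> err"
      by (rule GG[OF d1 d2 d3]) auto
    moreover have e: "{..<1::nat} - {0} = {}" by auto
    ultimately show ?thesis unfolding V1 e using prob_space.prob_space[OF R1] by simp
  qed
  also have "(\<integral>G. (1 - H (y G)) * ((1 - y G) - V G) \<partial>gauss I)
     = (\<integral>G. (1 - H (y G)) * (1 - V G) \<partial>gauss I) - (\<integral>G. y G * (1 - H (y G)) \<partial>gauss I)"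
  proof -
    have "integrable (gauss I) (\<lambda>G. (1 - H (y G)) * (1 - V G))"
      by (intro \<Gamma>.integrable_bounded_measurable bounded_measurable_mult bH' bounded_measurable_diff bounded_measurable_const bV)
    from Bochner_Integration.integral_diff[OF this iyq[OF bH']] show ?thesis
      by (simp add: algebra_simps)
  qed
  finally have low: "(\<integral>G. (1 - H (y G)) * (1 - V G) \<partial>gauss I) \<le> (\<integral>G. y G * (1 - H (y G)) \<partial>gauss I) + err" by linarith
  have "(\<integral>G. y G * (1 - H (y G)) \<partial>gauss I) \<le> (\<integral>G. \<delta> + \<theta> \<partial>gauss I)"
    using Hup by (intro integral_mono iyq[OF bH']) auto
  then have low': "(\<integral>G. (1 - H (y G)) * (1 - V G) \<partial>gauss I) \<le> \<delta> + \<theta> + err"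
    using low by (simp add: \<Gamma>.prob_space)
  have V_ge: "- \<theta> \<le> V G" for G
  proof -
    interpret rp: prob_space "replicas 2 b G" by (rule prob_space_replicas)
    have "overlap_mean b G (\<lambda>_. - \<theta>) \<le> V G"
      unfolding V_def by (intro overlap_mean_mono \<psi> \<psi>_ge bounded_on_overlaps_continuous) auto
    then show ?thesis by (simp add: overlap_mean_def rp.prob_space)
  qed
  have "(\<integral>G. H (y G) * (1 - V G) \<partial>gauss I) \<le> (\<integral>G. 2 * H (y G) \<partial>gauss I)"
  proof (rule integral_mono)
    fix G
    have "H (y G) * (1 - V G) \<le> H (y G) * 2" using V_ge[of G] \<theta> by (intro mult_left_mono H) auto
    then show "H (y G) * (1 - V G) \<le> 2 * H (y G)" by simp
  qed (intro \<Gamma>.integrable_bounded_measurable bounded_measurable_mult bH bounded_measurable_diff bounded_measurable_const bV)+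
  then have high: "(\<integral>G. H (y G) * (1 - V G) \<partial>gauss I) \<le> 2 * (m * D / \<delta> ^ (m - 1))" using EH by simp
  have ind: "overlap_mean b G (indicator {..\<alpha>}) \<le> 1 - V G + \<theta>" for G
  proof -
    interpret rp: prob_space "replicas 2 b G" by (rule prob_space_replicas)
    have "overlap_mean b G (indicator {..\<alpha>}) \<le> overlap_mean b G (\<lambda>r. 1 - \<psi> r + \<theta>)"
    proof (rule overlap_mean_mono)
      show "bounded_on_overlaps (\<lambda>r. 1 - \<psi> r + \<theta>)"
        by (intro bounded_on_overlaps_continuous continuous_intros \<psi>c)
      fix r :: real assume r: "\<bar>r\<bar> \<le> 1"
      show "indicator {..\<alpha>} r \<le> 1 - \<psi> r + \<theta>"
        using \<psi>_low[OF r] \<psi>_le[OF r] by (auto split: split_indicator)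
    qed auto
    also have "\<dots> = 1 - V G + \<theta>"
    proof -
      have "integrable (replicas 2 b G) (\<lambda>zs. \<psi> (R (zs 0) (zs 1)))"
        by (intro integrable_replicas bounded_overlap_replicas \<psi>) auto
      then show ?thesis unfolding overlap_mean_def V_def by (simp add: rp.prob_space)
    qed
    finally show ?thesis .
  qed
  have "(\<integral>G. overlap_mean b G (indicator {..\<alpha>}) \<partial>gauss I) \<le> (\<integral>G. ((1 - H (y G)) * (1 - V G) + H (y G) * (1 - V G)) + \<theta> \<partial>gauss I)"
  proof (rule integral_mono)
    show "overlap_mean b G (indicator {..\<alpha>}) \<le> ((1 - H (y G)) * (1 - V G) + H (y G) * (1 - V G)) + \<theta>" for G
      using ind[of G] by (simp add: algebra_simps)
    show "integrable (gauss I) (\<lambda>G. overlap_mean b G (indicator {..\<alpha>}))"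
      by (intro \<Gamma>.integrable_bounded_measurable bounded_overlap_mean) auto
  qed (intro \<Gamma>.integrable_bounded_measurable bounded_measurable_add bounded_measurable_mult bH' bH bounded_measurable_diff bounded_measurable_const bV)
  also have "\<dots> = (\<integral>G. (1 - H (y G)) * (1 - V G) \<partial>gauss I) + (\<integral>G. H (y G) * (1 - V G) \<partial>gauss I) + \<theta>"
  proof -
    have "integrable (gauss I) (\<lambda>G. (1 - H (y G)) * (1 - V G))" "integrable (gauss I) (\<lambda>G. H (y G) * (1 - V G))"
      by (intro \<Gamma>.integrable_bounded_measurable bounded_measurable_mult bH' bH bounded_measurable_diff bounded_measurable_const bV)+
    then show ?thesis by (simp add: \<Gamma>.prob_space)
  qed
  finally show ?thesis using low' high unfolding D_def by linarith
qed

end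

section \<open>Polynomial thresholds\<close>

text \<open>
  The piecewise linear function that rises from 0 at \<open>a\<close> to 1 at \<open>b\<close>.
\<close>

definition ramp :: "real \<Rightarrow> real \<Rightarrow> real \<Rightarrow> real" where
  "ramp a b r = max 0 (min 1 ((r - a) / (b - a)))"

lemma polynomial_ramp:
  assumes "0 < \<theta>" "a < b"
  obtains c :: "nat \<Rightarrow> real" and N where
    "\<And>d r. N \<le> d \<Longrightarrow> \<bar>r\<bar> \<le> 1 \<Longrightarrow> \<bar>(\<Sum>p\<le>d. c p * r ^ p) - ramp a b r\<bar> \<le> \<theta>"
proof -
  have "continuous_on {-1..1} (ramp a b)"
    unfolding ramp_def using assms by (intro continuous_intros) auto
  then obtain g where g: "real_polynomial_function g" "\<And>r. r \<in> {-1..1} \<Longrightarrow> \<bar>ramp a b r - g r\<bar> < \<theta>"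
    using Stone_Weierstrass_real_polynomial_function[of "{-1..1}" "ramp a b" \<theta>] assms by auto
  from g(1) obtain c N where c: "g = (\<lambda>r. \<Sum>p\<le>N. c p * r ^ p)"
    unfolding real_polynomial_function_iff_sum by auto
  show ?thesis
  proof
    fix d r assume d: "N \<le> d" and r: "\<bar>r::real\<bar> \<le> 1"
    have "(\<Sum>p\<le>d. (if p \<le> N then c p else 0) * r ^ p) = (\<Sum>p\<le>N. c p * r ^ p)"
      using d by (intro sum.mono_neutral_cong_right) auto
    then show "\<bar>(\<Sum>p\<le>d. (if p \<le> N then c p else 0) * r ^ p) - ramp a b r\<bar> \<le> \<theta>"
      using g(2)[of r] r unfolding c by (auto simp: abs_le_iff)
  qed
qed

lemma sum_indicator_adjacent:
  fixes a :: "nat \<Rightarrow> real"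
  assumes "\<And>k. a k \<le> a (Suc k)"
  shows "(\<Sum>k<K. indicator {a k<..a (Suc k)} r) = (indicator {a 0<..a K} r :: real)"
proof (induction K)
  case (Suc K)
  have "a 0 \<le> a K" using assms by (induction K) (auto intro: order_trans)
  then have "indicator {a 0<..a K} r + indicator {a K<..a (Suc K)} r = (indicator {a 0<..a (Suc K)} r :: real)"
    using assms[of K] by (auto split: split_indicator)
  then show ?case using Suc by simp
qed simp

section \<open>Perturbations of all degrees\<close>

text \<open>
  The fields of degree \<open>p\<close> have covariance \<open>R ^ p\<close> for \<open>p\<close> from 1 to \<open>d\<close>, so that every polynomial in \<open>R\<close> of
  degree at most \<open>d\<close> without constant term is a kernel \<open>\<Sum>i\<in>I. c i * e i z * e i z'\<close>.
\<close>

locale mixed_p_spin = gaussian_overlap M I e R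
  for M :: "'a measure" and I :: "'i set" and e :: "'i \<Rightarrow> 'a \<Rightarrow> real" and R :: "'a \<Rightarrow> 'a \<Rightarrow> real" +
  fixes deg :: "'i \<Rightarrow> nat" and d :: nat
  assumes deg: "i \<in> I \<Longrightarrow> deg i \<in> {1..d}"
    and kernel: "p \<in> {1..d} \<Longrightarrow> z \<in> space M \<Longrightarrow> z' \<in> space M \<Longrightarrow>
      (\<Sum>i\<in>{i\<in>I. deg i = p}. e i z * e i z') = R z z' ^ p"
begin

definition strength :: "(nat \<Rightarrow> real) \<Rightarrow> 'i \<Rightarrow> real" where
  "strength \<beta> i = \<beta> (deg i)"

definition pure_field :: "nat \<Rightarrow> ('i \<Rightarrow> real) \<Rightarrow> 'a \<Rightarrow> real" where
  "pure_field p = ham (\<lambda>i. if i \<in> {i\<in>I. deg i = p} then 1 else 0)"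

text \<open>
  An integral with values in \<open>[0, \<infinity>]\<close>, so that its average over the strengths can be computed without
  first establishing integrability.
\<close>

definition fluctuation :: "(nat \<Rightarrow> real) \<Rightarrow> nat \<Rightarrow> ennreal" where
  "fluctuation \<beta> p = (\<integral>\<^sup>+G. ennreal (\<integral>z. (pure_field p G z - (\<integral>z. pure_field p G z \<partial>gibbs (strength \<beta>) G))\<^sup>2 \<partial>gibbs (strength \<beta>) G) \<partial>gauss I)"

lemma sum_by_degree:
  fixes f :: "'i \<Rightarrow> real"
  shows "(\<Sum>i\<in>I. f i) = (\<Sum>p\<in>{1..d}. \<Sum>i\<in>{i\<in>I. deg i = p}. f i)"
  using finite_I deg by (intro sum.group[symmetric]) auto

lemma kernel_by_degree:
  assumes "z \<in> space M" "z' \<in> space M"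
  shows "(\<Sum>i\<in>I. w (deg i) * e i z * e i z') = (\<Sum>p\<in>{1..d}. w p * R z z' ^ p)"
proof -
  have "(\<Sum>i\<in>I. w (deg i) * e i z * e i z') = (\<Sum>p\<in>{1..d}. \<Sum>i\<in>{i\<in>I. deg i = p}. w (deg i) * e i z * e i z')"
    by (rule sum_by_degree)
  also have "\<dots> = (\<Sum>p\<in>{1..d}. w p * (\<Sum>i\<in>{i\<in>I. deg i = p}. e i z * e i z'))"
    by (intro sum.cong refl) (simp add: sum_distrib_left mult.assoc)
  also have "\<dots> = (\<Sum>p\<in>{1..d}. w p * R z z' ^ p)"
    using assms by (intro sum.cong refl) (simp add: kernel)
  finally show ?thesis .
qed

lemma ham_by_degree: "ham (\<lambda>i. w (deg i)) G z = (\<Sum>p\<in>{1..d}. w p * pure_field p G z)"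
proof -
  have "ham (\<lambda>i. w (deg i)) G z = (\<Sum>p\<in>{1..d}. \<Sum>i\<in>{i\<in>I. deg i = p}. w (deg i) * G i * e i z)"
    unfolding ham_def by (rule sum_by_degree)
  also have "\<dots> = (\<Sum>p\<in>{1..d}. w p * (\<Sum>i\<in>{i\<in>I. deg i = p}. G i * e i z))"
    by (intro sum.cong refl) (simp add: sum_distrib_left mult.assoc)
  also have "\<dots> = (\<Sum>p\<in>{1..d}. w p * pure_field p G z)"
    unfolding pure_field_def ham_def using finite_I
    by (intro sum.cong refl arg_cong2[where f="(*)"] sum.mono_neutral_cong_left) auto
  finally show ?thesis .
qed

lemma bounded_measurable_pure_field [intro!]: "bounded_measurable M (pure_field p G)"
  unfolding pure_field_def by auto

lemma ham_cong: "(\<And>i. i \<in> I \<Longrightarrow> b i = b' i) \<Longrightarrow> ham b = ham b'"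
  unfolding ham_def by (intro ext sum.cong) auto

lemma gibbs_cong: "(\<And>i. i \<in> I \<Longrightarrow> b i = b' i) \<Longrightarrow> gibbs b = gibbs b'"
  unfolding gibbs_def using ham_cong[of b b'] by simp

text \<open>
  The elementary inequality \<open>\<bar>s\<bar> \<le> 1 + s ^ 2\<close> passes from absolute deviations to variances; the factor
  \<open>K\<close>, of order \<open>1 / v\<close>, supplies the smallness.
\<close>

lemma abs_fluctuation_le:
  fixes c :: "nat \<Rightarrow> real"
  assumes c: "\<And>p. p \<in> {1..d} \<Longrightarrow> \<bar>c p / \<beta> p\<bar> \<le> K" and K: "0 \<le> K"
  defines "u \<equiv> ham (\<lambda>i. c (deg i) / strength \<beta> i)"
  shows "ennreal (\<integral>G. (\<integral>z. \<bar>u G z - (\<integral>z. u G z \<partial>gibbs (strength \<beta>) G)\<bar> \<partial>gibbs (strength \<beta>) G) \<partial>gauss I)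
     \<le> ennreal K * (of_nat d + (\<Sum>p\<in>{1..d}. fluctuation \<beta> p))"
proof -
  let ?g = "\<lambda>G. gibbs (strength \<beta>) G"
  define m where "m = (\<lambda>p G. \<integral>z. pure_field p G z \<partial>?g G)"
  define v where "v = (\<lambda>p G. \<integral>z. (pure_field p G z - m p G)\<^sup>2 \<partial>?g G)"
  have u: "u G z = (\<Sum>p\<in>{1..d}. c p / \<beta> p * pure_field p G z)" for G z
    unfolding u_def strength_def by (rule ham_by_degree)
  have mm[measurable]: "m p \<in> borel_measurable (gauss I)" for p
    unfolding m_def pure_field_def by (rule measurable_gibbs_G) measurable
  have vm[measurable]: "v p \<in> borel_measurable (gauss I)" for p
    unfolding v_def pure_field_def by (rule measurable_gibbs_G) measurable
  have v0: "0 \<le> v p G" for p G unfolding v_def by (intro integral_nonneg_AE) auto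
  have le: "(\<integral>z. \<bar>u G z - (\<integral>z. u G z \<partial>?g G)\<bar> \<partial>?g G) \<le> K * (\<Sum>p\<in>{1..d}. 1 + v p G)" for G
  proof -
    have U: "(\<integral>z. u G z \<partial>?g G) = (\<Sum>p\<in>{1..d}. c p / \<beta> p * m p G)"
    proof -
      have "(\<integral>z. u G z \<partial>?g G) = (\<Sum>p\<in>{1..d}. \<integral>z. c p / \<beta> p * pure_field p G z \<partial>?g G)"
        unfolding u by (intro Bochner_Integration.integral_sum integrable_mult_right integrable_gibbs) auto
      then show ?thesis by (simp add: m_def)
    qed
    have "(\<integral>z. \<bar>u G z - (\<integral>z. u G z \<partial>?g G)\<bar> \<partial>?g G) \<le> (\<integral>z. (\<Sum>p\<in>{1..d}. K * (1 + (pure_field p G z - m p G)\<^sup>2)) \<partial>?g G)"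
    proof (rule integral_mono)
      show "integrable (?g G) (\<lambda>z. \<bar>u G z - (\<integral>z. u G z \<partial>?g G)\<bar>)"
        unfolding u_def by (intro integrable_gibbs) auto
      show "integrable (?g G) (\<lambda>z. \<Sum>p\<in>{1..d}. K * (1 + (pure_field p G z - m p G)\<^sup>2))"
        by (intro integrable_gibbs) auto
      fix z
      have "\<bar>u G z - (\<integral>z. u G z \<partial>?g G)\<bar> = \<bar>\<Sum>p\<in>{1..d}. c p / \<beta> p * (pure_field p G z - m p G)\<bar>"
        unfolding U unfolding u by (simp add: sum_subtractf right_diff_distrib)
      also have "\<dots> \<le> (\<Sum>p\<in>{1..d}. \<bar>c p / \<beta> p\<bar> * \<bar>pure_field p G z - m p G\<bar>)"
        by (rule order_trans[OF sum_abs]) (simp only: abs_mult order_refl)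
      also have "\<dots> \<le> (\<Sum>p\<in>{1..d}. K * (1 + (pure_field p G z - m p G)\<^sup>2))"
      proof (intro sum_mono mult_mono c K)
        fix p
        show "\<bar>pure_field p G z - m p G\<bar> \<le> 1 + (pure_field p G z - m p G)\<^sup>2"
          using zero_le_power2[of "\<bar>pure_field p G z - m p G\<bar> - 1"] zero_le_power2[of "pure_field p G z - m p G"]
          unfolding power2_diff power2_abs by simp
      qed auto
      finally show "\<bar>u G z - (\<integral>z. u G z \<partial>?g G)\<bar> \<le> (\<Sum>p\<in>{1..d}. K * (1 + (pure_field p G z - m p G)\<^sup>2))" .
    qed
    also have "\<dots> = (\<Sum>p\<in>{1..d}. K * (1 + v p G))"
    proof (subst Bochner_Integration.integral_sum)
      show "(\<Sum>p\<in>{1..d}. \<integral>z. K * (1 + (pure_field p G z - m p G)\<^sup>2) \<partial>?g G) = (\<Sum>p\<in>{1..d}. K * (1 + v p G))"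
      proof (intro sum.cong refl)
        fix p
        have "integrable (?g G) (\<lambda>z. (pure_field p G z - m p G)\<^sup>2)" by (intro integrable_gibbs) auto
        moreover have "integrable (?g G) (\<lambda>z. 1 :: real)" by (intro integrable_gibbs) auto
        ultimately show "(\<integral>z. K * (1 + (pure_field p G z - m p G)\<^sup>2) \<partial>?g G) = K * (1 + v p G)"
          unfolding v_def by simp
      qed
    qed (intro integrable_gibbs, auto)
    finally show ?thesis by (simp add: sum_distrib_left)
  qed
  have int: "integrable (gauss I) (\<lambda>G. \<integral>z. \<bar>u G z - (\<integral>z. u G z \<partial>?g G)\<bar> \<partial>?g G) \<or>
     (\<integral>G. (\<integral>z. \<bar>u G z - (\<integral>z. u G z \<partial>?g G)\<bar> \<partial>?g G) \<partial>gauss I) = 0"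
    using not_integrable_integral_eq by blast
  have "ennreal (\<integral>G. (\<integral>z. \<bar>u G z - (\<integral>z. u G z \<partial>?g G)\<bar> \<partial>?g G) \<partial>gauss I)
     \<le> (\<integral>\<^sup>+G. ennreal (\<integral>z. \<bar>u G z - (\<integral>z. u G z \<partial>?g G)\<bar> \<partial>?g G) \<partial>gauss I)"
    using int by (auto simp: nn_integral_eq_integral integral_nonneg_AE)
  also have "\<dots> \<le> (\<integral>\<^sup>+G. ennreal K * (\<Sum>p\<in>{1..d}. 1 + ennreal (v p G)) \<partial>gauss I)"
  proof (rule nn_integral_mono)
    fix G
    have "ennreal (\<integral>z. \<bar>u G z - (\<integral>z. u G z \<partial>?g G)\<bar> \<partial>?g G) \<le> ennreal (K * (\<Sum>p\<in>{1..d}. 1 + v p G))"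
      using le by (rule ennreal_leI)
    also have "\<dots> = ennreal K * (\<Sum>p\<in>{1..d}. 1 + ennreal (v p G))"
    proof -
      have "(\<Sum>p\<in>{1..d}. 1 + ennreal (v p G)) = (\<Sum>p\<in>{1..d}. ennreal (1 + v p G))"
        by (intro sum.cong refl) (simp add: v0 flip: ennreal_1)
      also have "\<dots> = ennreal (\<Sum>p\<in>{1..d}. 1 + v p G)"
        using v0 by (intro sum_ennreal) (simp add: add_nonneg_nonneg)
      finally show ?thesis using K v0 by (simp add: ennreal_mult sum_nonneg add_nonneg_nonneg)
    qed
    finally show "ennreal (\<integral>z. \<bar>u G z - (\<integral>z. u G z \<partial>?g G)\<bar> \<partial>?g G) \<le> ennreal K * (\<Sum>p\<in>{1..d}. 1 + ennreal (v p G))" .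
  qed
  also have "\<dots> = ennreal K * (\<Sum>p\<in>{1..d}. 1 + (\<integral>\<^sup>+G. ennreal (v p G) \<partial>gauss I))"
  proof -
    interpret \<Gamma>: prob_space "gauss I" by (rule prob_space_gauss)
    have "(\<integral>\<^sup>+G. ennreal K * (\<Sum>p\<in>{1..d}. 1 + ennreal (v p G)) \<partial>gauss I) = ennreal K * (\<Sum>p\<in>{1..d}. \<integral>\<^sup>+G. 1 + ennreal (v p G) \<partial>gauss I)"
      by (subst nn_integral_cmult, measurable, subst nn_integral_sum) auto
    also have "\<dots> = ennreal K * (\<Sum>p\<in>{1..d}. 1 + (\<integral>\<^sup>+G. ennreal (v p G) \<partial>gauss I))"
      by (subst nn_integral_add) (auto simp: \<Gamma>.emeasure_space_1)
    finally show ?thesis .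
  qed
  also have "\<dots> = ennreal K * (of_nat d + (\<Sum>p\<in>{1..d}. fluctuation \<beta> p))"
    by (simp add: sum.distrib fluctuation_def v_def m_def)
  finally show ?thesis .
qed

text \<open>
  The interval from \<open>- \<epsilon>\<close> to \<open>- \<epsilon> / 2\<close> is cut into \<open>K\<close> pieces. For at least one of them the
  probability that the overlap of two replicas falls into it is at most \<open>1 / K\<close>, and the threshold is placed
  there. The choice depends on the measure and on the strengths, but the constants cover all \<open>K\<close>
  polynomials at once.
\<close>

lemma fixed_strength_bound:
  fixes cc :: "nat \<Rightarrow> nat \<Rightarrow> real" and \<beta> :: "nat \<Rightarrow> real" and K m :: nat
    and C \<delta> \<epsilon> \<theta> \<sigma> :: real
  assumes \<beta>: "\<And>p. p \<in> {1..d} \<Longrightarrow> \<sigma> \<le> \<beta> p" and \<sigma>: "1 \<le> \<sigma>"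
    and \<epsilon>: "0 < \<epsilon>" and K: "1 \<le> K" "1 / K \<le> \<theta>"
    and approx: "\<And>k r. k < K \<Longrightarrow> \<bar>r\<bar> \<le> 1 \<Longrightarrow>
       \<bar>(\<Sum>p\<le>d. cc k p * r ^ p) - ramp (- \<epsilon> + k * (\<epsilon> / (2 * K))) (- \<epsilon> + Suc k * (\<epsilon> / (2 * K))) r\<bar> \<le> \<theta>"
    and C: "\<And>k p. k < K \<Longrightarrow> p \<le> d \<Longrightarrow> \<bar>cc k p\<bar> \<le> C"
    and \<theta>: "0 < \<theta>" "\<theta> \<le> 1" and \<delta>: "0 < \<delta>" "\<delta> \<le> 1"
    and m: "1 < (real m - 1) * (\<epsilon> / 2)" "1 \<le> m"
  defines "W \<equiv> (1 + (2 + C) / \<theta>) * C + d * C\<^sup>2 / \<theta>"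
  shows "ennreal (\<integral>G. overlap_mean (strength \<beta>) G (indicator {..- \<epsilon>}) \<partial>gauss I)
     \<le> ennreal (\<delta> + (2 + 10 * (real m)\<^sup>2 / \<delta> ^ (m - 1)) * \<theta>)
       + ennreal ((1 + 2 * real m / \<delta> ^ (m - 1)) * W / \<sigma>) * (1 + of_nat d + (\<Sum>p\<in>{1..d}. fluctuation \<beta> p))"
proof -
  interpret \<Gamma>: prob_space "gauss I" by (rule prob_space_gauss)
  define \<alpha> where "\<alpha> = (\<lambda>k. - \<epsilon> + real k * (\<epsilon> / (2 * K)))"
  have K0: "0 < real K" using K by simp
  have \<alpha>_mono: "\<alpha> k < \<alpha> (Suc k)" for k using \<epsilon> K0 unfolding \<alpha>_def by (simp add: field_simps)
  let ?b = "strength \<beta>"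
  let ?z = "\<lambda>k. \<integral>G. overlap_mean ?b G (indicator {\<alpha> k<..\<alpha> (Suc k)}) \<partial>gauss I"
  have "\<exists>k<K. ?z k \<le> \<theta>"
  proof (rule ccontr)
    assume "\<not> ?thesis"
    then have gt: "\<theta> < ?z k" if "k < K" for k using that by force
    have "(\<Sum>k<K. ?z k) = (\<integral>G. (\<Sum>k<K. overlap_mean ?b G (indicator {\<alpha> k<..\<alpha> (Suc k)})) \<partial>gauss I)"
      by (intro Bochner_Integration.integral_sum[symmetric] \<Gamma>.integrable_bounded_measurable bounded_overlap_mean) auto
    also have "\<dots> \<le> (\<integral>G. 1 \<partial>gauss I)"
    proof (rule integral_mono)
      show "integrable (gauss I) (\<lambda>G. \<Sum>k<K. overlap_mean ?b G (indicator {\<alpha> k<..\<alpha> (Suc k)}))"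
        by (intro \<Gamma>.integrable_bounded_measurable bounded_measurable_sum bounded_overlap_mean) auto
      fix G
      have "(\<Sum>k<K. overlap_mean ?b G (indicator {\<alpha> k<..\<alpha> (Suc k)}))
         = (\<integral>zs. (\<Sum>k<K. indicator {\<alpha> k<..\<alpha> (Suc k)} (R (zs 0) (zs 1))) \<partial>replicas 2 ?b G)"
        unfolding overlap_mean_def
        by (intro Bochner_Integration.integral_sum[symmetric] integrable_replicas bounded_overlap_replicas) auto
      also have "\<dots> = (\<integral>zs. indicator {\<alpha> 0<..\<alpha> K} (R (zs 0) (zs 1)) \<partial>replicas 2 ?b G)"
        using \<alpha>_mono by (simp add: sum_indicator_adjacent less_imp_le)
      also have "\<dots> \<le> \<bar>\<dots>\<bar>" by simp
      also have "\<dots> \<le> 1"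
      proof (rule abs_integral_replicas_le)
        have "bounded_measurable (PiM {..<2::nat} (\<lambda>_. M)) (\<lambda>zs. indicator {\<alpha> 0<..\<alpha> K} (R (zs 0) (zs 1)) :: real)"
          by (intro bounded_overlap_replicas) auto
        then show "(\<lambda>zs. indicator {\<alpha> 0<..\<alpha> K} (R (zs 0) (zs 1)) :: real) \<in> borel_measurable (PiM {..<2::nat} (\<lambda>_. M))"
          by (rule bounded_measurableD)
      qed (simp split: split_indicator)
      finally show "(\<Sum>k<K. overlap_mean ?b G (indicator {\<alpha> k<..\<alpha> (Suc k)})) \<le> 1" .
    qed simp
    finally have "(\<Sum>k<K. ?z k) \<le> 1" by (simp add: \<Gamma>.prob_space)
    moreover have "(\<Sum>k<K. \<theta>) < (\<Sum>k<K. ?z k)"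
      using gt K by (intro sum_strict_mono) (auto simp: lessThan_empty_iff)
    moreover have "1 \<le> (\<Sum>k<K. \<theta>)" using K K0 by (simp add: field_simps)
    ultimately show False by linarith
  qed
  then obtain k where k: "k < K" "?z k \<le> \<theta>" by auto
  define \<psi> where "\<psi> = (\<lambda>r. \<Sum>p\<le>d. cc k p * r ^ p)"
  have \<psi>: "\<bar>\<psi> r - ramp (\<alpha> k) (\<alpha> (Suc k)) r\<bar> \<le> \<theta>" if "\<bar>r\<bar> \<le> 1" for r
    unfolding \<psi>_def \<alpha>_def using approx[OF k(1) that] .
  have ramp01: "0 \<le> ramp a b r" "ramp a b r \<le> 1" for a b r by (auto simp: ramp_def)
  have ramp0: "ramp (\<alpha> k) (\<alpha> (Suc k)) r = 0" if "r \<le> \<alpha> k" for r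
    using that \<alpha>_mono[of k] by (auto simp: ramp_def max_def min_def field_simps)
  have ramp1: "ramp (\<alpha> k) (\<alpha> (Suc k)) r = 1" if "\<alpha> (Suc k) < r" for r
    using that \<alpha>_mono[of k] by (auto simp: ramp_def max_def min_def field_simps)
  have C0: "0 \<le> C" using C[of 0 0] K by linarith
  have bpos: "0 < \<beta> p" if "p \<in> {1..d}" for p using \<beta>[OF that] \<sigma> by linarith
  define c where "c = (\<lambda>i. cc k (deg i))"
  have \<Psi>: "(\<Sum>i\<in>I. c i * e i z * e i z') = \<psi> (R z z') - cc k 0" if "z \<in> space M" "z' \<in> space M" for z z'
  proof -
    have "(\<Sum>i\<in>I. c i * e i z * e i z') = (\<Sum>p\<in>{1..d}. cc k p * R z z' ^ p)"
      unfolding c_def by (rule kernel_by_degree[OF that])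
    moreover have "\<psi> (R z z') = cc k 0 + (\<Sum>p\<in>{1..d}. cc k p * R z z' ^ p)"
      unfolding \<psi>_def by (simp add: atMost_atLeast0 sum.atLeast_Suc_atMost)
    ultimately show ?thesis by simp
  qed
  have \<Lambda>: "\<bar>\<psi> (R z z') - cc k 0\<bar> \<le> 2 + C" if "z \<in> space M" "z' \<in> space M" for z z'
    using \<psi>[OF R_le[OF that]] ramp01[of "\<alpha> k" "\<alpha> (Suc k)" "R z z'"] \<theta> C[OF k(1), of 0] by (simp add: abs_le_iff)
  have q: "\<bar>cc k p / \<beta> p\<bar> \<le> C / \<sigma>" if p: "p \<in> {1..d}" for p
  proof -
    have "\<bar>cc k p\<bar> / \<beta> p \<le> C / \<sigma>" using C[OF k(1), of p] p \<beta>[OF p] \<sigma> C0 by (intro frac_le) auto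
    then show ?thesis using bpos[OF p] by (simp add: abs_divide)
  qed
  define \<kappa> where "\<kappa> = d * (C / \<sigma>)\<^sup>2"
  have \<kappa>: "\<bar>\<Sum>i\<in>I. (c i / ?b i)\<^sup>2 * e i z * e i z'\<bar> \<le> \<kappa>" if z: "z \<in> space M" "z' \<in> space M" for z z'
  proof -
    have "(\<Sum>i\<in>I. (c i / ?b i)\<^sup>2 * e i z * e i z') = (\<Sum>p\<in>{1..d}. (cc k p / \<beta> p)\<^sup>2 * R z z' ^ p)"
      unfolding c_def strength_def by (rule kernel_by_degree[OF z])
    also have "\<bar>\<dots>\<bar> \<le> (\<Sum>p\<in>{1..d}. (C / \<sigma>)\<^sup>2)"
    proof (rule order_trans[OF sum_abs sum_mono])
      fix p assume p: "p \<in> {1..d}"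
      have "\<bar>cc k p / \<beta> p\<bar>\<^sup>2 \<le> (C / \<sigma>)\<^sup>2" using q[OF p] by (intro power_mono) auto
      moreover have "\<bar>R z z'\<bar> ^ p \<le> 1" using R_le[OF z] by (intro power_le_one) auto
      ultimately have "\<bar>cc k p / \<beta> p\<bar>\<^sup>2 * \<bar>R z z'\<bar> ^ p \<le> (C / \<sigma>)\<^sup>2 * 1" by (intro mult_mono) auto
      then show "\<bar>(cc k p / \<beta> p)\<^sup>2 * R z z' ^ p\<bar> \<le> (C / \<sigma>)\<^sup>2" by (simp add: abs_mult power_abs)
    qed
    finally show ?thesis by (simp add: \<kappa>_def)
  qed
  define E\<tau> where "E\<tau> = (\<integral>G. (\<integral>z. \<bar>ham (\<lambda>i. c i / ?b i) G z - (\<integral>z. ham (\<lambda>i. c i / ?b i) G z \<partial>gibbs ?b G)\<bar> \<partial>gibbs ?b G) \<partial>gauss I)"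
  define err where "err = (1 + 1 / \<theta> * (2 + C)) * E\<tau> + 1 / \<theta> * \<kappa>"
  have core: "(\<integral>G. overlap_mean ?b G (indicator {..\<alpha> k}) \<partial>gauss I) \<le> \<delta> + 2 * \<theta> + err + 2 * (m * (5 * m * \<theta> + err) / \<delta> ^ (m - 1))"
    unfolding err_def E\<tau>_def
  proof (rule negative_overlap_bound[OF _ _ \<Psi> \<Lambda> \<kappa> _ _ _ _ k(2) \<theta> \<delta> _ m])
    show "?b i \<noteq> 0" if "i \<in> I" for i using bpos[OF deg[OF that]] by (simp add: strength_def)
    show "continuous_on UNIV \<psi>" unfolding \<psi>_def by (intro continuous_intros)
    show "\<alpha> (Suc k) \<le> - (\<epsilon> / 2)"
    proof -
      have "real (Suc k) * (\<epsilon> / (2 * K)) \<le> K * (\<epsilon> / (2 * K))" using k(1) \<epsilon> by (intro mult_right_mono) auto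
      also have "\<dots> = \<epsilon> / 2" using K0 by simp
      finally show ?thesis unfolding \<alpha>_def by linarith
    qed
    fix r :: real assume r: "\<bar>r\<bar> \<le> 1"
    note b = \<psi>[OF r] ramp01[of "\<alpha> k" "\<alpha> (Suc k)" r]
    show "- \<theta> \<le> \<psi> r" "\<psi> r \<le> 1 + \<theta>" using b by auto
    show "\<psi> r \<le> \<theta>" if "r \<le> \<alpha> k" using b ramp0[OF that] by auto
    show "1 - \<theta> \<le> \<psi> r" if "\<alpha> (Suc k) < r" using b ramp1[OF that] by auto
  qed
  have mono: "overlap_mean ?b G (indicator {..- \<epsilon>}) \<le> overlap_mean ?b G (indicator {..\<alpha> k})" for G
    using \<epsilon> K0 by (intro overlap_mean_mono) (auto split: split_indicator simp: \<alpha>_def intro: order_trans)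
  have "(\<integral>G. overlap_mean ?b G (indicator {..- \<epsilon>}) \<partial>gauss I) \<le> (\<integral>G. overlap_mean ?b G (indicator {..\<alpha> k}) \<partial>gauss I)"
    by (intro integral_mono mono \<Gamma>.integrable_bounded_measurable bounded_overlap_mean) auto
  also note core
  also have "\<delta> + 2 * \<theta> + err + 2 * (m * (5 * m * \<theta> + err) / \<delta> ^ (m - 1))
     = (\<delta> + (2 + 10 * (real m)\<^sup>2 / \<delta> ^ (m - 1)) * \<theta>) + (1 + 2 * real m / \<delta> ^ (m - 1)) * err"
    using \<delta> by (simp add: field_simps power2_eq_square)
  finally have real_bound: "(\<integral>G. overlap_mean ?b G (indicator {..- \<epsilon>}) \<partial>gauss I)
     \<le> (\<delta> + (2 + 10 * (real m)\<^sup>2 / \<delta> ^ (m - 1)) * \<theta>) + (1 + 2 * real m / \<delta> ^ (m - 1)) * err" .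
  have E\<tau>0: "0 \<le> E\<tau>" unfolding E\<tau>_def by (intro integral_nonneg_AE AE_I2) auto
  define F where "F = 1 + of_nat d + (\<Sum>p\<in>{1..d}. fluctuation \<beta> p)"
  have F1: "1 \<le> F" unfolding F_def by (simp add: add.assoc)
  have "ennreal E\<tau> \<le> ennreal (C / \<sigma>) * (of_nat d + (\<Sum>p\<in>{1..d}. fluctuation \<beta> p))"
    unfolding E\<tau>_def c_def using q C0 \<sigma> by (intro abs_fluctuation_le) auto
  also have "\<dots> \<le> ennreal (C / \<sigma>) * F" unfolding F_def by (intro mult_left_mono) (auto simp: add.assoc)
  finally have E\<tau>: "ennreal E\<tau> \<le> ennreal (C / \<sigma>) * F" .
  have err_le: "ennreal err \<le> ennreal (W / \<sigma>) * F"
  proof -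
    have "\<kappa> \<le> d * C\<^sup>2 / \<sigma>"
    proof -
      have "C\<^sup>2 / \<sigma>\<^sup>2 \<le> C\<^sup>2 / \<sigma>" using \<sigma> by (intro divide_left_mono) (auto simp: power2_eq_square)
      then have "real d * (C\<^sup>2 / \<sigma>\<^sup>2) \<le> real d * (C\<^sup>2 / \<sigma>)" by (intro mult_left_mono) auto
      then show ?thesis unfolding \<kappa>_def by (simp add: power_divide)
    qed
    then have "1 / \<theta> * \<kappa> \<le> d * C\<^sup>2 / \<theta> / \<sigma>" using \<theta> \<sigma> by (simp add: field_simps)
    then have \<kappa>_le: "ennreal (1 / \<theta> * \<kappa>) \<le> ennreal (d * C\<^sup>2 / \<theta> / \<sigma>)" by (rule ennreal_leI)
    have c0: "0 \<le> 1 + 1 / \<theta> * (2 + C)" using \<theta> C0 by (intro add_nonneg_nonneg mult_nonneg_nonneg) auto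
    have \<kappa>0: "0 \<le> 1 / \<theta> * \<kappa>" unfolding \<kappa>_def using \<theta> by simp
    have "ennreal err = ennreal (1 + 1 / \<theta> * (2 + C)) * ennreal E\<tau> + ennreal (1 / \<theta> * \<kappa>)"
      unfolding err_def using c0 E\<tau>0 \<kappa>0 by (subst ennreal_plus) (auto simp: ennreal_mult)
    also have "\<dots> \<le> ennreal (1 + 1 / \<theta> * (2 + C)) * (ennreal (C / \<sigma>) * F) + ennreal (d * C\<^sup>2 / \<theta> / \<sigma>) * F"
    proof (intro add_mono mult_left_mono E\<tau>)
      have "ennreal (1 / \<theta> * \<kappa>) \<le> ennreal (d * C\<^sup>2 / \<theta> / \<sigma>) * 1" using \<kappa>_le by simp
      also have "\<dots> \<le> ennreal (d * C\<^sup>2 / \<theta> / \<sigma>) * F" using F1 by (intro mult_left_mono) auto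
      finally show "ennreal (1 / \<theta> * \<kappa>) \<le> ennreal (d * C\<^sup>2 / \<theta> / \<sigma>) * F" .
    qed simp
    also have "\<dots> = ennreal ((1 + 1 / \<theta> * (2 + C)) * (C / \<sigma>) + d * C\<^sup>2 / \<theta> / \<sigma>) * F"
    proof -
      have c1: "0 \<le> C / \<sigma>" and c2: "0 \<le> d * C\<^sup>2 / \<theta> / \<sigma>" using C0 \<sigma> \<theta> by auto
      show ?thesis
        by (simp only: ennreal_plus[OF mult_nonneg_nonneg[OF c0 c1] c2] ennreal_mult[OF c0 c1] distrib_right[where 'a=ennreal] mult.assoc[where 'a=ennreal])
    qed
    also have "(1 + 1 / \<theta> * (2 + C)) * (C / \<sigma>) + d * C\<^sup>2 / \<theta> / \<sigma> = W / \<sigma>"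
      unfolding W_def by (simp add: add_divide_distrib)
    finally show ?thesis .
  qed
  have a0: "0 \<le> 1 + 2 * real m / \<delta> ^ (m - 1)" using \<delta> by (simp add: add_nonneg_nonneg)
  have W0: "0 \<le> W" unfolding W_def using \<theta> C0 by (intro add_nonneg_nonneg mult_nonneg_nonneg divide_nonneg_nonneg) auto
  have err0: "0 \<le> err" unfolding err_def \<kappa>_def using \<theta> C0 E\<tau>0 by (intro add_nonneg_nonneg mult_nonneg_nonneg) auto
  have d0: "0 \<le> \<delta> + (2 + 10 * (real m)\<^sup>2 / \<delta> ^ (m - 1)) * \<theta>" using \<delta> \<theta> by (intro add_nonneg_nonneg mult_nonneg_nonneg) auto
  have "ennreal (\<integral>G. overlap_mean ?b G (indicator {..- \<epsilon>}) \<partial>gauss I)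
     \<le> ennreal ((\<delta> + (2 + 10 * (real m)\<^sup>2 / \<delta> ^ (m - 1)) * \<theta>) + (1 + 2 * real m / \<delta> ^ (m - 1)) * err)"
    by (rule ennreal_leI[OF real_bound])
  also have "\<dots> = ennreal (\<delta> + (2 + 10 * (real m)\<^sup>2 / \<delta> ^ (m - 1)) * \<theta>) + ennreal (1 + 2 * real m / \<delta> ^ (m - 1)) * ennreal err"
    by (simp only: ennreal_plus[OF d0 mult_nonneg_nonneg[OF a0 err0]] ennreal_mult[OF a0 err0])
  also have "\<dots> \<le> ennreal (\<delta> + (2 + 10 * (real m)\<^sup>2 / \<delta> ^ (m - 1)) * \<theta>) + ennreal (1 + 2 * real m / \<delta> ^ (m - 1)) * (ennreal (W / \<sigma>) * F)"
    by (intro add_left_mono mult_left_mono err_le) simp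
  also have "ennreal (1 + 2 * real m / \<delta> ^ (m - 1)) * (ennreal (W / \<sigma>) * F) = ennreal ((1 + 2 * real m / \<delta> ^ (m - 1)) * W / \<sigma>) * F"
  proof -
    have w: "0 \<le> W / \<sigma>" using W0 \<sigma> by simp
    have "(1 + 2 * real m / \<delta> ^ (m - 1)) * W / \<sigma> = (1 + 2 * real m / \<delta> ^ (m - 1)) * (W / \<sigma>)" by simp
    then show ?thesis by (simp only: ennreal_mult[OF a0 w] mult.assoc)
  qed
  finally show ?thesis unfolding F_def .
qed

end

section \<open>Averaging over the strengths\<close>

abbreviation unit_uniform :: "real measure" where
  "unit_uniform \<equiv> uniform_measure lborel {0..1}"

lemma prob_space_unit_uniform: "prob_space unit_uniform"
  by (rule prob_space_uniform_measure) auto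

lemma nn_integral_unit_uniform:
  "f \<in> borel_measurable borel \<Longrightarrow> (\<integral>\<^sup>+t. f t \<partial>unit_uniform) = (\<integral>\<^sup>+t. f t * indicator {0..1} t \<partial>lborel)"
  by (subst nn_integral_uniform_measure) (auto simp: divide_ennreal_def)

lemma measurable_unit_uniform: "measurable N unit_uniform = borel_measurable N"
  by (intro measurable_cong_sets) auto

context mixed_p_spin
begin

lemma measurable_fluctuation:
  assumes [simp]: "p \<in> {1..d}"
  shows "(\<lambda>x. fluctuation (\<lambda>q. s q * x q) p) \<in> borel_measurable (PiM {1..d} (\<lambda>_. unit_uniform))"
proof -
  interpret \<Gamma>: prob_space "gauss I" by (rule prob_space_gauss)
  let ?X = "PiM {1..d} (\<lambda>_. unit_uniform)"
  let ?N = "?X \<Otimes>\<^sub>M gauss I"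
  have b: "(\<lambda>\<omega>. strength (\<lambda>q. s q * fst \<omega> q) i) \<in> borel_measurable ?N" if "i \<in> I" for i
  proof -
    have [measurable]: "(\<lambda>x. x (deg i)) \<in> borel_measurable ?X"
      using measurable_component_singleton[OF deg[OF that], of "\<lambda>_. unit_uniform"] unfolding measurable_unit_uniform .
    show ?thesis unfolding strength_def by measurable
  qed
  have G: "(\<lambda>\<omega>. snd \<omega> i) \<in> borel_measurable ?N" if "i \<in> I" for i
    using that by measurable
  have [measurable]: "(\<lambda>x. pure_field p (snd (fst x)) (snd x)) \<in> borel_measurable (?N \<Otimes>\<^sub>M M)"
    unfolding pure_field_def by (rule measurable_ham[where G=snd, OF _ G]) auto
  have [measurable]: "(\<lambda>\<omega>. \<integral>z. pure_field p (snd \<omega>) z \<partial>gibbs (strength (\<lambda>q. s q * fst \<omega> q)) (snd \<omega>)) \<in> borel_measurable ?N"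
    by (rule measurable_integral_gibbs[where G=snd, OF b G]) measurable
  have "(\<lambda>\<omega>. \<integral>z. (pure_field p (snd \<omega>) z - (\<integral>z. pure_field p (snd \<omega>) z \<partial>gibbs (strength (\<lambda>q. s q * fst \<omega> q)) (snd \<omega>)))\<^sup>2
      \<partial>gibbs (strength (\<lambda>q. s q * fst \<omega> q)) (snd \<omega>)) \<in> borel_measurable ?N"
    by (rule measurable_integral_gibbs[where G=snd, OF b G]) measurable
  then show ?thesis
    unfolding fluctuation_def by (intro \<Gamma>.borel_measurable_nn_integral) (auto simp: case_prod_beta)
qed

text \<open>
  Integrate the \<open>p\<close>-th strength first, with the others fixed, and apply \<open>thermal_fluctuations\<close>.
\<close>

lemma fluctuation_average:
  assumes p: "p \<in> {1..d}" and s: "\<And>q. q \<in> {1..d} \<Longrightarrow> 0 < s q"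
  shows "(\<integral>\<^sup>+x. fluctuation (\<lambda>q. s q * x q) p \<partial>PiM {1..d} (\<lambda>_. unit_uniform)) \<le> 1"
proof -
  interpret u: prob_space unit_uniform by (rule prob_space_unit_uniform)
  interpret P: product_sigma_finite "\<lambda>_::nat. unit_uniform" by standard
  define J where "J = {1..d} - {p}"
  interpret PJ: prob_space "PiM J (\<lambda>_. unit_uniform)" by (intro prob_space_PiM prob_space_unit_uniform)
  have J: "finite J" "p \<notin> J" "{1..d} = insert p J" using p by (auto simp: J_def)
  have "(\<integral>\<^sup>+x. fluctuation (\<lambda>q. s q * x q) p \<partial>PiM {1..d} (\<lambda>_. unit_uniform))
    = (\<integral>\<^sup>+x. (\<integral>\<^sup>+t. fluctuation (\<lambda>q. s q * (x(p := t)) q) p \<partial>unit_uniform) \<partial>PiM J (\<lambda>_. unit_uniform))"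
    unfolding J(3)
    by (rule P.product_nn_integral_insert[OF J(1,2) measurable_fluctuation[OF p, of s, unfolded J(3)]])
  also have "\<dots> \<le> (\<integral>\<^sup>+x. 1 \<partial>PiM J (\<lambda>_. unit_uniform))"
  proof (rule nn_integral_mono)
    fix x assume x: "x \<in> space (PiM J (\<lambda>_. unit_uniform))"
    let ?b = "\<lambda>t i. if i \<in> {i\<in>I. deg i = p} then s p * t else s (deg i) * x (deg i)"
    have upd: "(\<lambda>t. x(p := t)) \<in> measurable borel (PiM {1..d} (\<lambda>_. unit_uniform))"
      using measurable_compose[OF measurable_Pair1'[OF x, of unit_uniform] measurable_add_dim[of p J "\<lambda>_. unit_uniform"]] J(3) by simp
    have m: "(\<lambda>t. fluctuation (\<lambda>q. s q * (x(p := t)) q) p) \<in> borel_measurable borel"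
      using measurable_compose[OF upd measurable_fluctuation[OF p, of s]] by simp
    have g: "gibbs (strength (\<lambda>q. s q * (x(p := t)) q)) = gibbs (?b t)" for t
      by (rule gibbs_cong) (auto simp: strength_def)
    have "(\<integral>\<^sup>+t. fluctuation (\<lambda>q. s q * (x(p := t)) q) p \<partial>unit_uniform)
       = (\<integral>\<^sup>+t. fluctuation (\<lambda>q. s q * (x(p := t)) q) p * indicator {0..1} t \<partial>lborel)"
      by (rule nn_integral_unit_uniform[OF m])
    also have "\<dots> \<le> 1"
      unfolding fluctuation_def g pure_field_def
    proof (rule thermal_fluctuations)
      show "{i\<in>I. deg i = p} \<subseteq> I" by auto
      show "0 < s p" using s p by simp
      fix z assume z: "z \<in> space M"
      show "(\<Sum>i\<in>{i\<in>I. deg i = p}. (e i z)\<^sup>2) \<le> 1"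
        using kernel[OF p z z] R_refl[OF z] by (simp add: power2_eq_square)
    qed
    finally show "(\<integral>\<^sup>+t. fluctuation (\<lambda>q. s q * (x(p := t)) q) p \<partial>unit_uniform) \<le> 1" .
  qed
  also have "\<dots> = 1" using PJ.emeasure_space_1 by simp
  finally show ?thesis .
qed

text \<open>
  The bound for fixed strengths degenerates as a strength tends to 0. With probability at least
  \<open>1 - d * \<eta>\<close> all uniform variables exceed \<open>\<eta>\<close>; on the complement the trivial bound 1 is used.
\<close>

lemma average_bound:
  fixes s :: "nat \<Rightarrow> real" and \<epsilon> \<eta> \<sigma> A B :: real
  assumes s: "\<And>q. q \<in> {1..d} \<Longrightarrow> \<sigma> \<le> s q * \<eta>" and \<sigma>: "0 < \<sigma>" and \<eta>: "0 < \<eta>"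
    and A: "0 \<le> A" and B: "0 \<le> B"
    and fixed: "\<And>\<beta>. (\<And>q. q \<in> {1..d} \<Longrightarrow> \<sigma> \<le> \<beta> q) \<Longrightarrow>
      ennreal (\<integral>G. overlap_mean (strength \<beta>) G (indicator {..- \<epsilon>}) \<partial>gauss I)
       \<le> ennreal A + ennreal B * (1 + of_nat d + (\<Sum>p\<in>{1..d}. fluctuation \<beta> p))"
  shows "(\<integral>\<^sup>+x. (\<integral>\<^sup>+G. ennreal (overlap_mean (strength (\<lambda>q. s q * x q)) G (indicator {..- \<epsilon>})) \<partial>gauss I)
      \<partial>PiM {1..d} (\<lambda>_. unit_uniform)) \<le> ennreal (d * \<eta> + A + B * (1 + 2 * d))"
proof -
  interpret \<Gamma>: prob_space "gauss I" by (rule prob_space_gauss)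
  interpret u: prob_space unit_uniform by (rule prob_space_unit_uniform)
  let ?X = "PiM {1..d} (\<lambda>_. unit_uniform)"
  interpret X: prob_space ?X by (intro prob_space_PiM prob_space_unit_uniform)
  have s0: "0 < s q" if "q \<in> {1..d}" for q
    using s[OF that] \<sigma> \<eta> by (metis less_le_trans zero_less_mult_pos2)
  have [measurable]: "(\<lambda>x. fluctuation (\<lambda>q. s q * x q) p) \<in> borel_measurable ?X" if "p \<in> {1..d}" for p
    by (rule measurable_fluctuation[OF that])
  have comp: "(\<lambda>x. x q) \<in> borel_measurable ?X" if "q \<in> {1..d}" for q
    using measurable_component_singleton[OF that, of "\<lambda>_. unit_uniform"] unfolding measurable_unit_uniform .
  have [measurable]: "(\<lambda>x. indicator {..<\<eta>} (x q) :: ennreal) \<in> borel_measurable ?X" if "q \<in> {1..d}" for q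
    using comp[OF that] by measurable
  let ?F = "\<lambda>\<beta>. \<integral>G. overlap_mean (strength \<beta>) G (indicator {..- \<epsilon>}) \<partial>gauss I"
  have om01: "0 \<le> overlap_mean b G (indicator {..- \<epsilon>})" "overlap_mean b G (indicator {..- \<epsilon>}) \<le> 1" for b G
  proof -
    show "0 \<le> overlap_mean b G (indicator {..- \<epsilon>})"
      unfolding overlap_mean_def by (intro integral_nonneg_AE) simp
    have "overlap_mean b G (indicator {..- \<epsilon>}) \<le> overlap_mean b G (\<lambda>_. 1)"
      by (intro overlap_mean_mono bounded_on_overlaps_indicator) 
         (auto split: split_indicator intro: bounded_on_overlaps_continuous)
    then show "overlap_mean b G (indicator {..- \<epsilon>}) \<le> 1" by (simp add: overlap_mean_def)
  qed
  have iom: "integrable (gauss I) (\<lambda>G. overlap_mean b G (indicator {..- \<epsilon>}))" for b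
    by (intro \<Gamma>.integrable_bounded_measurable bounded_overlap_mean) auto
  have nn: "(\<integral>\<^sup>+G. ennreal (overlap_mean b G (indicator {..- \<epsilon>})) \<partial>gauss I) = ennreal (\<integral>G. overlap_mean b G (indicator {..- \<epsilon>}) \<partial>gauss I)" for b
    by (intro nn_integral_eq_integral iom) (simp add: om01)
  have F1: "?F \<beta> \<le> 1" for \<beta>
  proof -
    have "?F \<beta> \<le> (\<integral>G. 1 \<partial>gauss I)" by (intro integral_mono iom om01) simp
    then show ?thesis by (simp add: \<Gamma>.prob_space)
  qed
  have "(\<integral>\<^sup>+x. ennreal (?F (\<lambda>q. s q * x q)) \<partial>?X)
     \<le> (\<integral>\<^sup>+x. (\<Sum>q\<in>{1..d}. indicator {..<\<eta>} (x q)) + (ennreal A + ennreal B * (1 + of_nat d + (\<Sum>p\<in>{1..d}. fluctuation (\<lambda>q. s q * x q) p))) \<partial>?X)"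
  proof (rule nn_integral_mono)
    fix x
    show "ennreal (?F (\<lambda>q. s q * x q)) \<le> (\<Sum>q\<in>{1..d}. indicator {..<\<eta>} (x q)) + (ennreal A + ennreal B * (1 + of_nat d + (\<Sum>p\<in>{1..d}. fluctuation (\<lambda>q. s q * x q) p)))"
    proof (cases "\<forall>q\<in>{1..d}. \<eta> \<le> x q")
      case True
      have "\<sigma> \<le> s q * x q" if q: "q \<in> {1..d}" for q
      proof -
        have "s q * \<eta> \<le> s q * x q" using True q s0[OF q] by (intro mult_left_mono) auto
        then show ?thesis using s[OF q] by linarith
      qed
      then have "ennreal (?F (\<lambda>q. s q * x q)) \<le> ennreal A + ennreal B * (1 + of_nat d + (\<Sum>p\<in>{1..d}. fluctuation (\<lambda>q. s q * x q) p))"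
        by (rule fixed)
      then show ?thesis by (rule order_trans) (intro add_increasing order_refl zero_le)
    next
      case False
      then obtain q where q: "q \<in> {1..d}" "x q < \<eta>" by force
      have "ennreal (?F (\<lambda>q. s q * x q)) \<le> 1" using F1 by simp
      also have "(1::ennreal) = indicator {..<\<eta>} (x q)" using q by simp
      also have "\<dots> \<le> (\<Sum>q\<in>{1..d}. indicator {..<\<eta>} (x q))"
        using q by (intro member_le_sum) auto
      finally show ?thesis by (rule order_trans) (intro add_increasing2 order_refl zero_le)
    qed
  qed
  also have "\<dots> = (\<Sum>q\<in>{1..d}. \<integral>\<^sup>+x. indicator {..<\<eta>} (x q) \<partial>?X)
      + (ennreal A + ennreal B * (1 + of_nat d + (\<Sum>p\<in>{1..d}. \<integral>\<^sup>+x. fluctuation (\<lambda>q. s q * x q) p \<partial>?X)))"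
  proof -
    let ?I = "\<lambda>x. \<Sum>q\<in>{1..d}. indicator {..<\<eta>} (x q) :: ennreal"
    let ?S = "\<lambda>x. \<Sum>p\<in>{1..d}. fluctuation (\<lambda>q. s q * x q) p"
    have m: "?I \<in> borel_measurable ?X" "?S \<in> borel_measurable ?X" by measurable
    have I: "(\<integral>\<^sup>+x. ?I x \<partial>?X) = (\<Sum>q\<in>{1..d}. \<integral>\<^sup>+x. indicator {..<\<eta>} (x q) \<partial>?X)"
      by (rule nn_integral_sum) measurable
    have S: "(\<integral>\<^sup>+x. ?S x \<partial>?X) = (\<Sum>p\<in>{1..d}. \<integral>\<^sup>+x. fluctuation (\<lambda>q. s q * x q) p \<partial>?X)"
      by (rule nn_integral_sum) measurable
    have c: "(\<integral>\<^sup>+x. a \<partial>?X) = a" for a using X.emeasure_space_1 by simp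
    have "(\<integral>\<^sup>+x. ?I x + (ennreal A + ennreal B * (1 + of_nat d + ?S x)) \<partial>?X)
      = (\<integral>\<^sup>+x. ?I x \<partial>?X) + (\<integral>\<^sup>+x. ennreal A + ennreal B * (1 + of_nat d + ?S x) \<partial>?X)"
      by (rule nn_integral_add) (use m in measurable)
    also have "(\<integral>\<^sup>+x. ennreal A + ennreal B * (1 + of_nat d + ?S x) \<partial>?X)
      = ennreal A + (\<integral>\<^sup>+x. ennreal B * (1 + of_nat d + ?S x) \<partial>?X)"
      by (subst nn_integral_add) (use m c in \<open>measurable, simp\<close>)
    also have "(\<integral>\<^sup>+x. ennreal B * (1 + of_nat d + ?S x) \<partial>?X) = ennreal B * (\<integral>\<^sup>+x. 1 + of_nat d + ?S x \<partial>?X)"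
      by (rule nn_integral_cmult) (use m in measurable)
    also have "(\<integral>\<^sup>+x. 1 + of_nat d + ?S x \<partial>?X) = 1 + of_nat d + (\<integral>\<^sup>+x. ?S x \<partial>?X)"
      by (subst nn_integral_add) (use m c in \<open>measurable, simp\<close>)
    finally show ?thesis unfolding I S .
  qed
  also have "\<dots> \<le> (\<Sum>q\<in>{1..d}. ennreal \<eta>) + (ennreal A + ennreal B * (1 + of_nat d + (\<Sum>p\<in>{1..d}. 1)))"
  proof (intro add_mono sum_mono mult_left_mono fluctuation_average s0 order_refl)
    fix q assume q: "q \<in> {1..d}"
    have "(\<integral>\<^sup>+x. indicator {..<\<eta>} (x q) \<partial>?X) = (\<integral>\<^sup>+t. indicator {..<\<eta>} t \<partial>distr ?X unit_uniform (\<lambda>x. x q))"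
      using q by (intro nn_integral_distr[symmetric]) (auto intro!: borel_measurable_indicator)
    also have "distr ?X unit_uniform (\<lambda>x. x q) = unit_uniform"
      using q by (intro distr_PiM_component prob_space_unit_uniform)
    also have "(\<integral>\<^sup>+t. indicator {..<\<eta>} t \<partial>unit_uniform) = (\<integral>\<^sup>+t. indicator {..<\<eta>} t * indicator {0..1} t \<partial>lborel)"
      by (rule nn_integral_unit_uniform) simp
    also have "\<dots> \<le> (\<integral>\<^sup>+t. indicator {0..\<eta>} t \<partial>lborel)"
      by (intro nn_integral_mono) (auto split: split_indicator)
    also have "\<dots> = ennreal \<eta>" using \<eta> by simp
    finally show "(\<integral>\<^sup>+x. indicator {..<\<eta>} (x q) \<partial>?X) \<le> ennreal \<eta>" .
  qed auto
  also have "\<dots> = ennreal (d * \<eta> + A + B * (1 + 2 * d))"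
  proof -
    have "(1::ennreal) + of_nat d + (\<Sum>p\<in>{1..d}. 1) = ennreal (1 + 2 * d)"
    proof -
      have "ennreal (1 + 2 * d) = ennreal 1 + ennreal (real d) + ennreal (real d)"
        by (simp flip: ennreal_plus del: ennreal_1)
      then show ?thesis by (simp add: ennreal_of_nat_eq_real_of_nat)
    qed
    then show ?thesis
      using A B \<eta> by (simp add: ennreal_of_nat_eq_real_of_nat add.assoc flip: ennreal_mult ennreal_plus)
  qed
  finally show ?thesis unfolding nn .
qed

end

text \<open>
  The constants are chosen in the order \<open>m\<close>, \<open>\<delta>\<close>, \<open>\<theta>\<close>, \<open>K\<close>, polynomials and their degree \<open>d\<close>, \<open>\<eta>\<close>, \<open>\<sigma>\<close>, \<open>v\<close>. Each of
  them depends on the previous ones and on \<open>\<epsilon>\<close> only, which is why \<open>v\<close> and \<open>d\<close> precede the quantification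
  over the measure.
\<close>

theorem finite_disorder_bound:
  fixes \<epsilon> :: real
  assumes \<epsilon>: "0 < \<epsilon>" "\<epsilon> \<le> 1"
  obtains v :: real and d :: nat where "1 \<le> v"
    "\<And>(M :: 'a measure) (I :: 'i set) e R deg. mixed_p_spin M I e R deg d \<Longrightarrow>
      (\<integral>\<^sup>+x. (\<integral>\<^sup>+G. ennreal (gaussian_overlap.overlap_mean M I e R
          (\<lambda>i. v * (1 / 2) ^ deg i * x (deg i)) G (indicator {..- \<epsilon>})) \<partial>gauss I)
        \<partial>PiM {1..d} (\<lambda>_. unit_uniform)) \<le> ennreal \<epsilon>"
proof -
  obtain m' :: nat where m': "2 / \<epsilon> < real m'" using reals_Archimedean2 by blast
  define m where "m = m' + 1"
  have m: "1 < (real m - 1) * (\<epsilon> / 2)" "1 \<le> m" using m' \<epsilon> by (auto simp: m_def field_simps)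
  define \<delta> where "\<delta> = \<epsilon> / 8"
  have \<delta>: "0 < \<delta>" "\<delta> \<le> 1" using \<epsilon> by (auto simp: \<delta>_def)
  define D where "D = 2 + 10 * (real m)\<^sup>2 / \<delta> ^ (m - 1)"
  have D: "2 \<le> D" using \<delta> by (simp add: D_def)
  define \<theta> where "\<theta> = \<epsilon> / (8 * D)"
  have \<theta>: "0 < \<theta>" "\<theta> \<le> 1" using \<epsilon> D by (auto simp: \<theta>_def field_simps)
  obtain K' :: nat where K': "1 / \<theta> < real K'" using reals_Archimedean2 by blast
  define K where "K = K' + 1"
  have K: "1 \<le> K" "1 / K \<le> \<theta>" using K' \<theta> by (auto simp: K_def field_simps)
  define a where "a = (\<lambda>k::nat. - \<epsilon> + real k * (\<epsilon> / (2 * K)))"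
  have "\<exists>c N. \<forall>d\<ge>N. \<forall>r. \<bar>r\<bar> \<le> 1 \<longrightarrow> \<bar>(\<Sum>p\<le>d. c p * r ^ p) - ramp (a k) (a (Suc k)) r\<bar> \<le> \<theta>" for k
  proof -
    have "a k < a (Suc k)" using \<epsilon> K by (simp add: a_def field_simps)
    from polynomial_ramp[OF \<theta>(1) this] show ?thesis by metis
  qed
  then obtain cc N where cc: "\<And>k d r. N k \<le> d \<Longrightarrow> \<bar>r\<bar> \<le> 1 \<Longrightarrow> \<bar>(\<Sum>p\<le>d. cc k p * r ^ p) - ramp (a k) (a (Suc k)) r\<bar> \<le> \<theta>"
    by metis
  define d where "d = 1 + (\<Sum>k<K. N k)"
  have d: "1 \<le> d" by (simp add: d_def)
  have Nd: "N k \<le> d" if "k < K" for k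
    using member_le_sum[of k "{..<K}" N] that by (simp add: d_def)
  define C where "C = (\<Sum>k<K. \<Sum>p\<le>d. \<bar>cc k p\<bar>)"
  have C: "\<bar>cc k p\<bar> \<le> C" if "k < K" "p \<le> d" for k p
  proof -
    have "\<bar>cc k p\<bar> \<le> (\<Sum>p\<le>d. \<bar>cc k p\<bar>)" using that by (intro member_le_sum) auto
    also have "\<dots> \<le> C" unfolding C_def using that by (intro member_le_sum) (auto intro!: sum_nonneg)
    finally show ?thesis .
  qed
  have C0: "0 \<le> C" unfolding C_def by (intro sum_nonneg) auto
  define W where "W = (1 + (2 + C) / \<theta>) * C + d * C\<^sup>2 / \<theta>"
  define Y where "Y = (1 + 2 * real m / \<delta> ^ (m - 1)) * W"
  have W0: "0 \<le> W" unfolding W_def using \<theta> C0 by (intro add_nonneg_nonneg mult_nonneg_nonneg divide_nonneg_nonneg) auto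
  have Y0: "0 \<le> Y" unfolding Y_def using W0 \<delta> by (intro mult_nonneg_nonneg add_nonneg_nonneg) auto
  define \<eta> where "\<eta> = \<epsilon> / (4 * d)"
  have \<eta>: "0 < \<eta>" "\<eta> \<le> 1" using \<epsilon> d by (auto simp: \<eta>_def field_simps)
  \<comment> \<open>The three contributions to the final bound are \<open>\<epsilon> / 4\<close> from small strengths, \<open>\<delta> + D * \<theta> = \<epsilon> / 4\<close>, and at
     most \<open>\<epsilon> / 2\<close> from the fluctuations thanks to this choice of \<open>\<sigma>\<close>.\<close>
  define \<sigma> where "\<sigma> = 1 + 2 * (1 + 2 * real d) * Y / \<epsilon>"
  have \<sigma>: "1 \<le> \<sigma>" using Y0 \<epsilon> by (simp add: \<sigma>_def)
  define v where "v = 2 ^ d / \<eta> * \<sigma>"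
  have v: "1 \<le> v"
  proof -
    have "1 * 1 \<le> (2 ^ d / \<eta>) * \<sigma>"
    proof (intro mult_mono \<sigma>)
      have "\<eta> \<le> 2 ^ d" using \<eta> one_le_power[of "2::real" d] by linarith
      then show "1 \<le> 2 ^ d / \<eta>" using \<eta> by simp
    qed (use \<eta> in auto)
    then show ?thesis by (simp add: v_def)
  qed
  have "(\<integral>\<^sup>+x. (\<integral>\<^sup>+G. ennreal (gaussian_overlap.overlap_mean M I e R
          (\<lambda>i. v * (1 / 2) ^ deg i * x (deg i)) G (indicator {..- \<epsilon>})) \<partial>gauss I)
        \<partial>PiM {1..d} (\<lambda>_. unit_uniform)) \<le> ennreal \<epsilon>"
    if "mixed_p_spin M I e R deg d" for M :: "'a measure" and I :: "'i set" and e R deg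
  proof -
    interpret mixed_p_spin M I e R deg d by fact
    define s where "s = (\<lambda>q::nat. v * (1 / 2) ^ q)"
    have "(\<integral>\<^sup>+x. (\<integral>\<^sup>+G. ennreal (overlap_mean (strength (\<lambda>q. s q * x q)) G (indicator {..- \<epsilon>})) \<partial>gauss I)
      \<partial>PiM {1..d} (\<lambda>_. unit_uniform)) \<le> ennreal (d * \<eta> + (\<delta> + D * \<theta>) + Y / \<sigma> * (1 + 2 * d))"
    proof (rule average_bound)
      fix q assume q: "q \<in> {1..d}"
      have "(1 / 2) ^ d \<le> ((1 / 2) ^ q :: real)" using q by (intro power_decreasing) auto
      then have "v * (1 / 2) ^ d * \<eta> \<le> v * (1 / 2) ^ q * \<eta>"
        using v \<eta> by (intro mult_right_mono mult_left_mono) auto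
      moreover have "v * (1 / 2) ^ d * \<eta> = \<sigma>" using \<eta> by (simp add: v_def power_divide)
      ultimately show "\<sigma> \<le> s q * \<eta>" by (simp add: s_def)
    next
      fix \<beta> assume \<beta>: "\<And>q. q \<in> {1..d} \<Longrightarrow> \<sigma> \<le> \<beta> q"
      show "ennreal (\<integral>G. overlap_mean (strength \<beta>) G (indicator {..- \<epsilon>}) \<partial>gauss I)
       \<le> ennreal (\<delta> + D * \<theta>) + ennreal (Y / \<sigma>) * (1 + of_nat d + (\<Sum>p\<in>{1..d}. fluctuation \<beta> p))"
        unfolding D_def Y_def W_def
        by (rule fixed_strength_bound[OF \<beta> \<sigma> \<epsilon>(1) K _ C \<theta> \<delta> m])
           (use cc[OF Nd] in \<open>auto simp: a_def\<close>)
    qed (use \<sigma> \<eta> \<delta> D \<theta> Y0 in auto)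
    also have "\<dots> \<le> ennreal \<epsilon>"
    proof (rule ennreal_leI)
      have 1: "d * \<eta> = \<epsilon> / 4" using d by (simp add: \<eta>_def)
      have 2: "D * \<theta> = \<epsilon> / 8" using D by (simp add: \<theta>_def)
      have 3: "Y / \<sigma> * (1 + 2 * d) \<le> \<epsilon> / 2"
      proof -
        have "2 * (1 + 2 * real d) * Y \<le> \<sigma> * \<epsilon>" using \<epsilon> by (simp add: \<sigma>_def field_simps)
        then show ?thesis using \<sigma> by (simp add: field_simps)
      qed
      show "d * \<eta> + (\<delta> + D * \<theta>) + Y / \<sigma> * (1 + 2 * d) \<le> \<epsilon>"
        using 1 2 3 by (simp add: \<delta>_def)
    qed
    finally show ?thesis unfolding strength_def[abs_def] s_def .
  qed
  with v show thesis by (rule that)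
qed

section \<open>Resampling finitely many coordinates\<close>

text \<open>
  If \<open>x\<close> and \<open>y\<close> are independent with product laws, the result again has the product law. Drawing \<open>y\<close>
  first expresses conditioning on the coordinates outside \<open>K\<close>.
\<close>

definition resample :: "'i set \<Rightarrow> 'i set \<Rightarrow> ('i \<Rightarrow> 'a) \<Rightarrow> ('i \<Rightarrow> 'a) \<Rightarrow> 'i \<Rightarrow> 'a" where
  "resample K J x y = (\<lambda>i\<in>J. if i \<in> K then x i else y i)"

lemma measurable_resample:
  assumes "K \<subseteq> J"
  shows "(\<lambda>p. resample K J (fst p) (snd p)) \<in> measurable (PiM K M \<Otimes>\<^sub>M PiM J M) (PiM J M)"
  unfolding resample_def
proof (rule measurable_restrict)
  fix i assume i: "i \<in> J"
  show "(\<lambda>p. if i \<in> K then fst p i else snd p i) \<in> measurable (PiM K M \<Otimes>\<^sub>M PiM J M) (M i)"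
  proof (cases "i \<in> K")
    case True
    then show ?thesis
      by (simp add: measurable_compose[OF measurable_fst measurable_component_singleton])
  next
    case False
    then show ?thesis using i
      by (simp add: measurable_compose[OF measurable_snd measurable_component_singleton])
  qed
qed

lemma distr_resample:
  assumes M: "\<And>i. prob_space (M i)" and KJ: "K \<subseteq> J"
  shows "distr (PiM K M \<Otimes>\<^sub>M PiM J M) (PiM J M) (\<lambda>p. resample K J (fst p) (snd p)) = PiM J M"
proof (rule measure_eqI_PiM_infinite[symmetric])
  interpret PJ: prob_space "PiM J M" by (intro prob_space_PiM M)
  show "finite_measure (PiM J M)" by unfold_locales
  fix A L assume L: "finite L" "L \<subseteq> J" and A: "\<And>i. i \<in> L \<Longrightarrow> A i \<in> sets (M i)"
  let ?T = "\<lambda>p. resample K J (fst p) (snd p)"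
  let ?E = "prod_emb J M L (Pi\<^sub>E L A)"
  have pre: "?T -` ?E \<inter> space (PiM K M \<Otimes>\<^sub>M PiM J M) = prod_emb K M (L \<inter> K) (Pi\<^sub>E (L \<inter> K) A) \<times> prod_emb J M (L - K) (Pi\<^sub>E (L - K) A)"
  proof (intro set_eqI)
    have emb: "w \<in> prod_emb J' M L' (Pi\<^sub>E L' A) \<longleftrightarrow> w \<in> space (PiM J' M) \<and> (\<forall>i\<in>L'. w i \<in> A i)" if "L' \<subseteq> J'" for w J' L'
      using that by (auto simp: prod_emb_def space_PiM PiE_iff)
    fix p :: "('a \<Rightarrow> 'b) \<times> ('a \<Rightarrow> 'b)"
    have T: "?T p i = (if i \<in> K then fst p i else snd p i)" if "i \<in> L" for i
      using L that by (auto simp: resample_def)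
    have "p \<in> ?T -` ?E \<inter> space (PiM K M \<Otimes>\<^sub>M PiM J M)
      \<longleftrightarrow> p \<in> space (PiM K M \<Otimes>\<^sub>M PiM J M) \<and> (\<forall>i\<in>L. ?T p i \<in> A i)"
      using measurable_space[OF measurable_resample[OF KJ, of M]] L by (auto simp: emb)
    also have "\<dots> \<longleftrightarrow> p \<in> space (PiM K M \<Otimes>\<^sub>M PiM J M) \<and> (\<forall>i\<in>L\<inter>K. fst p i \<in> A i) \<and> (\<forall>i\<in>L-K. snd p i \<in> A i)"
      by (auto simp: T)
    also have "\<dots> \<longleftrightarrow> p \<in> prod_emb K M (L \<inter> K) (Pi\<^sub>E (L \<inter> K) A) \<times> prod_emb J M (L - K) (Pi\<^sub>E (L - K) A)"
    proof -
      have "L - K \<subseteq> J" using L by auto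
      then show ?thesis by (auto simp: emb space_pair_measure mem_Times_iff)
    qed
    finally show "p \<in> ?T -` ?E \<inter> space (PiM K M \<Otimes>\<^sub>M PiM J M)
      \<longleftrightarrow> p \<in> prod_emb K M (L \<inter> K) (Pi\<^sub>E (L \<inter> K) A) \<times> prod_emb J M (L - K) (Pi\<^sub>E (L - K) A)" .
  qed
  have "emeasure (distr (PiM K M \<Otimes>\<^sub>M PiM J M) (PiM J M) ?T) ?E
     = emeasure (PiM K M \<Otimes>\<^sub>M PiM J M) (prod_emb K M (L \<inter> K) (Pi\<^sub>E (L \<inter> K) A) \<times> prod_emb J M (L - K) (Pi\<^sub>E (L - K) A))"
    unfolding pre[symmetric] using L A by (intro emeasure_distr measurable_resample KJ sets_PiM_I) auto
  also have "\<dots> = emeasure (PiM K M) (prod_emb K M (L \<inter> K) (Pi\<^sub>E (L \<inter> K) A)) * emeasure (PiM J M) (prod_emb J M (L - K) (Pi\<^sub>E (L - K) A))"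
    using L A by (intro PJ.emeasure_pair_measure_Times sets_PiM_I) auto
  also have "\<dots> = (\<Prod>i\<in>L\<inter>K. emeasure (M i) (A i)) * (\<Prod>i\<in>L-K. emeasure (M i) (A i))"
    using L A by (intro arg_cong2[where f="(*)"] emeasure_PiM_emb M) auto
  also have "\<dots> = (\<Prod>i\<in>L. emeasure (M i) (A i))"
    using L(1) by (subst prod.union_disjoint[symmetric]) (auto intro!: prod.cong)
  also have "\<dots> = emeasure (PiM J M) ?E"
    using L A by (intro emeasure_PiM_emb[symmetric] M) auto
  finally show "emeasure (PiM J M) ?E = emeasure (distr (PiM K M \<Otimes>\<^sub>M PiM J M) (PiM J M) ?T) ?E" by simp
qed auto

lemma nn_integral_resample:
  assumes M: "\<And>i. prob_space (M i)" and KJ: "K \<subseteq> J" and F: "F \<in> borel_measurable (PiM J M)"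
  shows "(\<integral>\<^sup>+y. F y \<partial>PiM J M) = (\<integral>\<^sup>+y. (\<integral>\<^sup>+x. F (resample K J x y) \<partial>PiM K M) \<partial>PiM J M)"
proof -
  interpret PJ: prob_space "PiM J M" by (intro prob_space_PiM M)
  interpret PK: prob_space "PiM K M" by (intro prob_space_PiM M)
  interpret PP: pair_sigma_finite "PiM K M" "PiM J M" ..
  have "(\<integral>\<^sup>+y. F y \<partial>PiM J M) = (\<integral>\<^sup>+p. F (resample K J (fst p) (snd p)) \<partial>(PiM K M \<Otimes>\<^sub>M PiM J M))"
    by (subst distr_resample[OF M KJ, symmetric]) (intro nn_integral_distr measurable_resample KJ, simp add: F)
  also have "\<dots> = (\<integral>\<^sup>+y. (\<integral>\<^sup>+x. F (resample K J x y) \<partial>PiM K M) \<partial>PiM J M)"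
    using measurable_compose[OF measurable_resample[OF KJ] F]
    by (subst PP.nn_integral_snd[symmetric]) auto
  finally show ?thesis .
qed

section \<open>Second moments of Gaussian sums\<close>

lemma std_gauss_affine_square:
  "(\<integral>\<^sup>+t. ennreal ((a * t + s)\<^sup>2) \<partial>std_gauss) = ennreal (a\<^sup>2) + ennreal (s\<^sup>2)"
proof -
  interpret prob_space std_gauss by (rule prob_space_std_gauss)
  have i2: "has_bochner_integral std_gauss (\<lambda>t. t\<^sup>2) 1"
    using std_normal_moment_even[of 1] by (intro has_bochner_integral_density) (auto simp: power2_eq_square)
  have i1: "has_bochner_integral std_gauss (\<lambda>t. t) 0"
    using std_normal_moment_odd[of 0] by (intro has_bochner_integral_density) auto
  have i0: "has_bochner_integral std_gauss (\<lambda>t. s\<^sup>2) (s\<^sup>2)"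
    using prob_space by (simp add: has_bochner_integral_iff)
  have "has_bochner_integral std_gauss (\<lambda>t. a\<^sup>2 * t\<^sup>2 + 2 * a * s * t + s\<^sup>2) (a\<^sup>2 * 1 + 2 * a * s * 0 + s\<^sup>2)"
    by (intro has_bochner_integral_add has_bochner_integral_mult_right i2 i1 i0)
  then have "has_bochner_integral std_gauss (\<lambda>t. (a * t + s)\<^sup>2) (a\<^sup>2 + s\<^sup>2)"
    by (simp add: power2_eq_square algebra_simps)
  then show ?thesis
    by (subst nn_integral_eq_integral) (auto simp: has_bochner_integral_iff)
qed

lemma gauss_linear_second_moment:
  assumes "finite I"
  shows "(\<integral>\<^sup>+G. ennreal ((\<Sum>i\<in>I. G i * a i)\<^sup>2) \<partial>gauss I) = (\<Sum>i\<in>I. ennreal ((a i)\<^sup>2))"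
  using assms
proof (induction I)
  case empty
  interpret prob_space "gauss {} :: ('a \<Rightarrow> real) measure" by (rule prob_space_gauss)
  show ?case by simp
next
  case (insert j I)
  interpret g: prob_space std_gauss by (rule prob_space_std_gauss)
  interpret P: product_sigma_finite "\<lambda>_::'a. std_gauss" by standard
  interpret G: prob_space "gauss I" by (rule prob_space_gauss)
  have m: "(\<lambda>G. ennreal ((\<Sum>i\<in>insert j I. G i * a i)\<^sup>2)) \<in> borel_measurable (gauss (insert j I))"
    by measurable
  have m': "(\<lambda>G. ennreal ((\<Sum>i\<in>I. G i * a i)\<^sup>2)) \<in> borel_measurable (gauss I)"
    by measurable
  have upd: "(\<Sum>i\<in>insert j I. (G(j := t)) i * a i) = a j * t + (\<Sum>i\<in>I. G i * a i)" for G t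
  proof -
    have "(\<Sum>i\<in>I. (G(j := t)) i * a i) = (\<Sum>i\<in>I. G i * a i)" using insert by (intro sum.cong) auto
    then show ?thesis using insert by (simp add: mult.commute)
  qed
  have "(\<integral>\<^sup>+G. ennreal ((\<Sum>i\<in>insert j I. G i * a i)\<^sup>2) \<partial>gauss (insert j I))
     = (\<integral>\<^sup>+G. (\<integral>\<^sup>+t. ennreal ((\<Sum>i\<in>insert j I. (G(j := t)) i * a i)\<^sup>2) \<partial>std_gauss) \<partial>gauss I)"
    by (rule P.product_nn_integral_insert[OF insert.hyps m])
  also have "\<dots> = (\<integral>\<^sup>+G. ennreal ((a j)\<^sup>2) + ennreal ((\<Sum>i\<in>I. G i * a i)\<^sup>2) \<partial>gauss I)"
    unfolding upd std_gauss_affine_square ..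
  also have "\<dots> = ennreal ((a j)\<^sup>2) + (\<Sum>i\<in>I. ennreal ((a i)\<^sup>2))"
    by (subst nn_integral_add) (use insert.IH m' in \<open>simp_all add: G.emeasure_space_1\<close>)
  finally show ?case unfolding sum.insert[OF insert.hyps] .
qed

text \<open>
  Bounding the first moment by the second keeps the estimate independent of the number of terms; for the
  homogeneous parts on the sphere the coefficients have squares summing to 1.
\<close>

lemma gauss_linear_abs_le:
  assumes I: "finite I" "I \<subseteq> J" and a: "(\<Sum>i\<in>I. (a i)\<^sup>2) \<le> 1"
  shows "(\<integral>\<^sup>+G. ennreal \<bar>\<Sum>i\<in>I. G i * a i\<bar> \<partial>gauss J) \<le> 1"
proof -
  interpret G: prob_space "gauss I" by (rule prob_space_gauss)
  interpret P: product_prob_space "\<lambda>_. std_gauss" J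
    by (auto simp: product_prob_space_def product_prob_space_axioms_def product_sigma_finite_def
        prob_space_std_gauss prob_space_imp_sigma_finite)
  have r: "(\<lambda>G. restrict G I) \<in> measurable (gauss J) (gauss I)"
    using I(2) by (rule measurable_restrict_subset)
  have m: "(\<lambda>G. ennreal \<bar>\<Sum>i\<in>I. G i * a i\<bar>) \<in> borel_measurable (gauss I)"
    "(\<lambda>G. ennreal ((\<Sum>i\<in>I. G i * a i)\<^sup>2)) \<in> borel_measurable (gauss I)"
    by measurable
  have "(\<integral>\<^sup>+G. ennreal \<bar>\<Sum>i\<in>I. G i * a i\<bar> \<partial>gauss J) = (\<integral>\<^sup>+G. ennreal \<bar>\<Sum>i\<in>I. (restrict G I) i * a i\<bar> \<partial>gauss J)"
    by (intro nn_integral_cong) (simp cong: sum.cong)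
  also have "\<dots> = (\<integral>\<^sup>+G. ennreal \<bar>\<Sum>i\<in>I. G i * a i\<bar> \<partial>distr (gauss J) (gauss I) (\<lambda>G. restrict G I))"
    by (rule nn_integral_distr[OF r, symmetric]) (use m in simp)
  also have "distr (gauss J) (gauss I) (\<lambda>G. restrict G I) = gauss I"
    by (rule P.distr_PiM_restrict_finite[OF I])
  also have "(\<integral>\<^sup>+G. ennreal \<bar>\<Sum>i\<in>I. G i * a i\<bar> \<partial>gauss I) \<le> (\<integral>\<^sup>+G. ennreal (1/2) + ennreal (1/2) * ennreal ((\<Sum>i\<in>I. G i * a i)\<^sup>2) \<partial>gauss I)"
  proof (rule nn_integral_mono)
    fix G
    let ?s = "\<Sum>i\<in>I. G i * a i"
    have "\<bar>?s\<bar> \<le> 1/2 + 1/2 * ?s\<^sup>2"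
      using zero_le_power2[of "\<bar>?s\<bar> - 1"] unfolding power2_diff power2_abs by simp
    then have "ennreal \<bar>?s\<bar> \<le> ennreal (1/2 + 1/2 * ?s\<^sup>2)" by (rule ennreal_leI)
    also have "\<dots> = ennreal (1/2) + ennreal (1/2 * ?s\<^sup>2)" by (rule ennreal_plus) auto
    also have "ennreal (1/2 * ?s\<^sup>2) = ennreal (1/2) * ennreal (?s\<^sup>2)" by (rule ennreal_mult) auto
    finally show "ennreal \<bar>?s\<bar> \<le> ennreal (1/2) + ennreal (1/2) * ennreal (?s\<^sup>2)" .
  qed
  also have "\<dots> = ennreal (1/2) + ennreal (1/2) * (\<Sum>i\<in>I. ennreal ((a i)\<^sup>2))"
    using m(2) I by (simp add: nn_integral_add nn_integral_cmult gauss_linear_second_moment G.emeasure_space_1)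
  also have "\<dots> = ennreal (1/2 + 1/2 * (\<Sum>i\<in>I. (a i)\<^sup>2))"
  proof -
    let ?S = "\<Sum>i\<in>I. (a i)\<^sup>2"
    have S: "0 \<le> ?S" by (intro sum_nonneg) auto
    have "ennreal (1/2 + 1/2 * ?S) = ennreal (1/2) + ennreal (1/2 * ?S)" using S by (intro ennreal_plus) auto
    also have "ennreal (1/2 * ?S) = ennreal (1/2) * ennreal ?S" using S by (intro ennreal_mult) auto
    also have "ennreal ?S = (\<Sum>i\<in>I. ennreal ((a i)\<^sup>2))" by (intro sum_ennreal[symmetric]) auto
    finally show ?thesis by simp
  qed
  also have "\<dots> \<le> 1" using a by simp
  finally show ?thesis .
qed

section \<open>Iterated tilts and pairs\<close>

lemma tilted_cong_AE:
  assumes [measurable]: "g \<in> borel_measurable M" "h \<in> borel_measurable M" and eq: "AE z in M. g z = h z"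
  shows "tilted_measure M g = tilted_measure M h"
proof -
  have "(\<integral>z. exp (g z) \<partial>M) = (\<integral>z. exp (h z) \<partial>M)"
    using eq by (intro integral_cong_AE) auto
  then show ?thesis
    unfolding tilted_measure_def using eq by (intro density_cong) auto
qed

text \<open>
  Allows the tail of the series, which need not be bounded, to be absorbed into the reference measure
  before the bounded low-degree part is treated.
\<close>

lemma (in prob_space) tilted_tilted:
  assumes g[measurable]: "g \<in> borel_measurable M" and i: "integrable M (\<lambda>z. exp (g z))"
    and h[measurable]: "h \<in> borel_measurable M"
  shows "tilted_measure (tilted_measure M g) h = tilted_measure M (\<lambda>z. g z + h z)"
proof -
  have Z: "(\<integral>z. exp (g z) \<partial>M) > 0"
    using i integral_less_AE_space[of "\<lambda>_. 0" "\<lambda>z. exp (g z)"] emeasure_space_1 by simp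
  have e: "(\<integral>z. exp (h z) \<partial>tilted_measure M g) = (\<integral>z. exp (g z + h z) \<partial>M) / (\<integral>z. exp (g z) \<partial>M)"
    by (subst integral_tilted) (auto simp: exp_add mult.commute)
  have "tilted_measure (tilted_measure M g) h
     = density (density M (\<lambda>z. ennreal (exp (g z) / (\<integral>z. exp (g z) \<partial>M)))) (\<lambda>z. ennreal (exp (h z) / (\<integral>z. exp (h z) \<partial>tilted_measure M g)))"
    by (simp add: tilted_measure_def)
  also have "\<dots> = density M (\<lambda>z. ennreal (exp (g z) / (\<integral>z. exp (g z) \<partial>M)) * ennreal (exp (h z) / (\<integral>z. exp (h z) \<partial>tilted_measure M g)))"
    by (intro density_density_eq) measurable
  also have "\<dots> = tilted_measure M (\<lambda>z. g z + h z)"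
    unfolding tilted_measure_def[of M "\<lambda>z. g z + h z"]
  proof (intro density_cong AE_I2)
    fix z
    have "0 \<le> (\<integral>z. exp (h z) \<partial>tilted_measure M g)" by (intro integral_nonneg_AE) auto
    then have "ennreal (exp (g z) / (\<integral>z. exp (g z) \<partial>M)) * ennreal (exp (h z) / (\<integral>z. exp (h z) \<partial>tilted_measure M g))
       = ennreal (exp (g z) / (\<integral>z. exp (g z) \<partial>M) * (exp (h z) / (\<integral>z. exp (h z) \<partial>tilted_measure M g)))"
      using Z by (intro ennreal_mult[symmetric]) auto
    also have "exp (g z) / (\<integral>z. exp (g z) \<partial>M) * (exp (h z) / (\<integral>z. exp (h z) \<partial>tilted_measure M g)) = exp (g z + h z) / (\<integral>z. exp (g z + h z) \<partial>M)"
      unfolding e using Z by (simp add: exp_add)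
    finally show "ennreal (exp (g z) / (\<integral>z. exp (g z) \<partial>M)) * ennreal (exp (h z) / (\<integral>z. exp (h z) \<partial>tilted_measure M g))
       = ennreal (exp (g z + h z) / (\<integral>z'. exp (g z' + h z') \<partial>M))" .
  qed measurable
  finally show ?thesis .
qed

lemma (in gaussian_overlap) emeasure_gibbs_pair:
  "emeasure (gibbs b G \<Otimes>\<^sub>M gibbs b G) {(z, z') \<in> space M \<times> space M. R z z' \<le> a}
     = ennreal (overlap_mean b G (indicator {..a}))"
proof -
  interpret gb: prob_space "gibbs b G" by (rule prob_space_gibbs)
  interpret pp: pair_prob_space "gibbs b G" "gibbs b G" ..
  let ?A = "{(z, z') \<in> space M \<times> space M. R z z' \<le> a}"
  have s: "sets (gibbs b G \<Otimes>\<^sub>M gibbs b G) = sets (M \<Otimes>\<^sub>M M)" by (intro sets_pair_measure_cong) auto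
  have eq: "?A = {x \<in> space (M \<Otimes>\<^sub>M M). R (fst x) (snd x) \<le> a}" by (auto simp: space_pair_measure)
  have A: "?A \<in> sets (gibbs b G \<Otimes>\<^sub>M gibbs b G)" unfolding s eq by measurable
  have i: "integrable (gibbs b G \<Otimes>\<^sub>M gibbs b G) (indicator ?A :: _ \<Rightarrow> real)"
    using A by (intro pp.P.integrable_const_bound[where B=1]) auto
  have "emeasure (gibbs b G \<Otimes>\<^sub>M gibbs b G) ?A = ennreal (\<integral>x. indicator ?A x \<partial>(gibbs b G \<Otimes>\<^sub>M gibbs b G))"
    using A by (simp add: pp.P.emeasure_eq_measure)
  also have "(\<integral>x. (indicator ?A x :: real) \<partial>(gibbs b G \<Otimes>\<^sub>M gibbs b G)) = (\<integral>z. (\<integral>z'. indicator ?A (z, z') \<partial>gibbs b G) \<partial>gibbs b G)"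
    by (rule pp.integral_fst'[OF i, symmetric])
  also have "\<dots> = (\<integral>z. (\<integral>z'. indicator {..a} (R z z') \<partial>gibbs b G) \<partial>gibbs b G)"
    by (intro Bochner_Integration.integral_cong refl) (auto simp: indicator_def)
  also have "\<dots> = overlap_mean b G (indicator {..a})"
    unfolding overlap_mean_def
    by (rule integral_replicas_pair[symmetric]) (auto intro!: bounded_overlap)
  finally show ?thesis .
qed

section \<open>Monomials on the sphere\<close>

definition monomial :: "nat list \<Rightarrow> (nat \<Rightarrow> real) \<Rightarrow> real" where
  "monomial is z = (\<Prod>i\<leftarrow>is. z i)"

definition indices :: "nat \<Rightarrow> nat \<Rightarrow> nat list set" where
  "indices N d = (\<Union>p\<in>{1..d}. multi_indices N p)"

lemma finite_multi_indices: "finite (multi_indices N p)"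
  unfolding multi_indices_def using finite_lists_length_eq[of "{1..N}" p] by (simp add: conj_commute)

lemma finite_indices: "finite (indices N d)"
  unfolding indices_def by (auto intro: finite_multi_indices)

lemma sum_multi_indices:
  fixes f :: "nat \<Rightarrow> real"
  shows "(\<Sum>is\<in>multi_indices N p. \<Prod>i\<leftarrow>is. f i) = (\<Sum>i\<in>{1..N}. f i) ^ p"
proof (induction p)
  case 0
  have "multi_indices N 0 = {[]}" by (auto simp: multi_indices_def)
  then show ?case by simp
next
  case (Suc p)
  have eq: "multi_indices N (Suc p) = (\<lambda>(i, is). i # is) ` ({1..N} \<times> multi_indices N p)"
    unfolding multi_indices_def by (auto simp: length_Suc_conv image_iff)
  have "(\<Sum>is\<in>multi_indices N (Suc p). \<Prod>i\<leftarrow>is. f i) = (\<Sum>(i, is)\<in>{1..N} \<times> multi_indices N p. f i * (\<Prod>i\<leftarrow>is. f i))"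
    unfolding eq by (subst sum.reindex) (auto simp: inj_on_def case_prod_beta)
  also have "\<dots> = (\<Sum>i\<in>{1..N}. f i) * (\<Sum>is\<in>multi_indices N p. \<Prod>i\<leftarrow>is. f i)"
    by (simp add: sum.cartesian_product[symmetric] sum_product)
  finally show ?case using Suc by simp
qed

lemma monomial_mult: "monomial is z * monomial is z' = (\<Prod>i\<leftarrow>is. z i * z' i)"
  unfolding monomial_def by (induction "is") (auto simp: algebra_simps)

lemma space_unit_sphere: "z \<in> space (unit_sphere N) \<Longrightarrow> L2_set z {1..N} = 1"
  by (auto simp: unit_sphere_def space_restrict_space)

lemma sphere_coordinate_le:
  assumes "z \<in> space (unit_sphere N)" "i \<in> {1..N}" shows "\<bar>z i\<bar> \<le> 1"
proof -
  have "\<bar>z i\<bar> \<le> L2_set (\<lambda>i. \<bar>z i\<bar>) {1..N}" using assms by (intro member_le_L2_set) auto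
  then show ?thesis using space_unit_sphere[OF assms(1)] by (simp add: L2_set_def)
qed

lemma monomial_le_1:
  assumes z: "z \<in> space (unit_sphere N)" and i: "set is \<subseteq> {1..N}"
  shows "\<bar>monomial is z\<bar> \<le> 1"
  using i
proof (induction "is")
  case (Cons j js)
  then have "\<bar>z j\<bar> * \<bar>monomial js z\<bar> \<le> 1 * 1" using sphere_coordinate_le[OF z] by (intro mult_mono) auto
  then show ?case by (simp add: monomial_def abs_mult)
qed (simp add: monomial_def)

lemma measurable_coordinate:
  assumes "i \<in> {1..N}" shows "(\<lambda>z. z i) \<in> borel_measurable (unit_sphere N)"
  unfolding unit_sphere_def using assms
  by (intro measurable_restrict_space1 measurable_component_singleton)

lemma measurable_monomial:
  assumes "set is \<subseteq> {1..N}" shows "monomial is \<in> borel_measurable (unit_sphere N)"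
  using assms
proof (induction "is")
  case Nil
  then show ?case unfolding monomial_def[abs_def] by simp
next
  case (Cons i "is")
  have "(\<lambda>z. z i * monomial is z) \<in> borel_measurable (unit_sphere N)"
    using Cons by (intro borel_measurable_times measurable_coordinate) auto
  then show ?case by (simp add: monomial_def[abs_def])
qed

lemma sphere_norm: "z \<in> space (unit_sphere N) \<Longrightarrow> (\<Sum>i\<in>{1..N}. z i * z i) = 1"
  using space_unit_sphere[of z N] by (simp add: L2_set_def power2_eq_square)

lemma sum_monomial_squares:
  assumes "z \<in> space (unit_sphere N)"
  shows "(\<Sum>is\<in>multi_indices N p. (monomial is z)\<^sup>2) = 1"
  unfolding power2_eq_square monomial_mult sum_multi_indices sphere_norm[OF assms] by simp

lemma indices_degree: "p \<in> {1..d} \<Longrightarrow> {is \<in> indices N d. length is = p} = multi_indices N p"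
  by (auto simp: indices_def multi_indices_def)

lemma sphere_mixed_p_spin:
  assumes "prob_space M" and sets: "sets M = sets (unit_sphere N)"
  shows "mixed_p_spin M (indices N d) monomial (scalar_prod N) length d"
proof -
  interpret prob_space M by fact
  have sp: "space M = space (unit_sphere N)" by (rule sets_eq_imp_space_eq[OF sets])
  have ms: "measurable M K = measurable (unit_sphere N) K" for K :: "real measure"
    by (rule measurable_cong_sets[OF sets refl])
  have idx: "set is \<subseteq> {1..N}" if "is \<in> indices N d" for "is"
    using that by (auto simp: indices_def multi_indices_def)
  have coord: "(\<lambda>z. z i) \<in> borel_measurable M" if "i \<in> {1..N}" for i
    unfolding ms using that by (rule measurable_coordinate)
  show ?thesis
  proof unfold_locales
    show "finite (indices N d)" by (rule finite_indices)
    show "monomial is \<in> borel_measurable M" if "is \<in> indices N d" for "is"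
      unfolding ms using idx[OF that] by (rule measurable_monomial)
    show "\<bar>monomial is z\<bar> \<le> 1" if "is \<in> indices N d" "z \<in> space M" for "is" z
      using that idx by (intro monomial_le_1) (auto simp: sp)
    show "(\<lambda>x. scalar_prod N (fst x) (snd x)) \<in> borel_measurable (M \<Otimes>\<^sub>M M)"
      unfolding scalar_prod_def
      by (intro borel_measurable_sum borel_measurable_times measurable_compose[OF measurable_fst coord] measurable_compose[OF measurable_snd coord])
    show "scalar_prod N z z' = scalar_prod N z' z" for z z'
      unfolding scalar_prod_def by (simp add: mult.commute)
    show "scalar_prod N z z = 1" if "z \<in> space M" for z
      using that unfolding scalar_prod_def sp by (rule sphere_norm)
    show "\<bar>scalar_prod N z z'\<bar> \<le> 1" if "z \<in> space M" "z' \<in> space M" for z z'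
    proof -
      have "\<bar>scalar_prod N z z'\<bar> \<le> (\<Sum>i\<in>{1..N}. \<bar>z i\<bar> * \<bar>z' i\<bar>)"
        unfolding scalar_prod_def by (rule order_trans[OF sum_abs]) (simp add: abs_mult)
      also have "\<dots> \<le> L2_set z {1..N} * L2_set z' {1..N}" by (rule L2_set_mult_ineq)
      also have "\<dots> = 1" using that unfolding sp by (simp only: space_unit_sphere mult_1_left)
      finally show ?thesis .
    qed
    show "0 \<le> (\<Sum>j<n. \<Sum>l<n. scalar_prod N (zs j) (zs l))" for n :: nat and zs
    proof -
      have "(\<Sum>j<n. \<Sum>l<n. scalar_prod N (zs j) (zs l)) = (\<Sum>j<n. \<Sum>i\<in>{1..N}. \<Sum>l<n. zs j i * zs l i)"
        unfolding scalar_prod_def by (intro sum.cong refl sum.swap)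
      also have "\<dots> = (\<Sum>i\<in>{1..N}. \<Sum>j<n. \<Sum>l<n. zs j i * zs l i)" by (rule sum.swap)
      also have "\<dots> = (\<Sum>i\<in>{1..N}. (\<Sum>j<n. zs j i)\<^sup>2)" by (simp add: power2_eq_square sum_product)
      also have "0 \<le> \<dots>" by (intro sum_nonneg) auto
      finally show ?thesis .
    qed
    show "length is \<in> {1..d}" if "is \<in> indices N d" for "is"
      using that by (auto simp: indices_def multi_indices_def)
    show "(\<Sum>is\<in>{is \<in> indices N d. length is = p}. monomial is z * monomial is z') = scalar_prod N z z' ^ p"
      if "p \<in> {1..d}" for p z z'
      unfolding indices_degree[OF that] monomial_mult sum_multi_indices scalar_prod_def ..
  qed
qed

section \<open>Separating the low degrees\<close>

definition chaos_term :: "nat \<Rightarrow> nat \<Rightarrow> (nat \<Rightarrow> real) \<times> (nat list \<Rightarrow> real) \<Rightarrow> (nat \<Rightarrow> real) \<Rightarrow> real" where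
  "chaos_term N n \<omega> z = (1 / 2) ^ Suc n * fst \<omega> (Suc n) * homogeneous_part N (Suc n) (snd \<omega>) z"

definition chaos_tail :: "nat \<Rightarrow> nat \<Rightarrow> (nat \<Rightarrow> real) \<times> (nat list \<Rightarrow> real) \<Rightarrow> (nat \<Rightarrow> real) \<Rightarrow> real" where
  "chaos_tail N d \<omega> z = (\<Sum>n. chaos_term N (n + d) \<omega> z)"

definition low_strength :: "real \<Rightarrow> (nat \<Rightarrow> real) \<Rightarrow> nat list \<Rightarrow> real" where
  "low_strength v x is = v * (1 / 2) ^ length is * x (length is)"

abbreviation strengths :: "(nat \<Rightarrow> real) measure" where
  "strengths \<equiv> PiM {1..} (\<lambda>_. unit_uniform)"

abbreviation all_indices :: "nat \<Rightarrow> nat list set" where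
  "all_indices N \<equiv> \<Union>p\<in>{1..}. multi_indices N p"

lemma disorder_eq: "disorder N = strengths \<Otimes>\<^sub>M gauss (all_indices N)"
  by (simp add: disorder_def)

lemma random_fun_eq: "random_fun v N \<omega> z = v * (\<Sum>n. chaos_term N n \<omega> z)"
  by (simp add: random_fun_def chaos_term_def)

lemma homogeneous_part_eq: "homogeneous_part N p G z = (\<Sum>is\<in>multi_indices N p. G is * monomial is z)"
  by (simp add: homogeneous_part_def monomial_def)

lemma sum_low_degrees:
  "v * (\<Sum>n<d. chaos_term N n (x, G) z) = gaussian_gibbs.ham (indices N d) monomial (low_strength v x) G z"
  if "gaussian_gibbs M (indices N d) monomial"
proof -
  interpret gaussian_gibbs M "indices N d" monomial by fact
  have "ham (low_strength v x) G z = (\<Sum>p\<in>{1..d}. \<Sum>is\<in>multi_indices N p. low_strength v x is * G is * monomial is z)"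
    unfolding ham_def unfolding indices_def
    by (rule sum.UNION_disjoint) (simp_all add: finite_multi_indices, auto simp: multi_indices_def)
  also have "\<dots> = (\<Sum>p\<in>{1..d}. v * ((1 / 2) ^ p * x p * homogeneous_part N p G z))"
    unfolding homogeneous_part_eq sum_distrib_left
    by (intro sum.cong refl) (auto simp: low_strength_def multi_indices_def)
  also have "\<dots> = v * (\<Sum>p\<in>{1..d}. (1 / 2) ^ p * x p * homogeneous_part N p G z)"
    by (simp add: sum_distrib_left)
  also have "(\<Sum>p\<in>{1..d}. (1 / 2) ^ p * x p * homogeneous_part N p G z) = (\<Sum>n<d. chaos_term N n (x, G) z)"
    unfolding chaos_term_def by (simp add: sum.atLeast1_atMost_eq)
  finally show ?thesis by simp
qed

text \<open>
  The sum of a divergent series is an arbitrary value, so the splitting into low and high degrees is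
  available only at points of convergence. Whether \<open>z\<close> is one does not depend on the low degrees, and only
  they may differ between \<open>\<omega>\<close> and \<open>(x, G)\<close>.
\<close>

lemma random_fun_split:
  assumes "gaussian_gibbs M (indices N d) monomial"
    and summable: "summable (\<lambda>n. chaos_term N n \<omega> z)"
    and agree: "\<And>n. d \<le> n \<Longrightarrow> chaos_term N n (x, G) z = chaos_term N n \<omega> z"
  shows "random_fun v N (x, G) z = v * chaos_tail N d \<omega> z + gaussian_gibbs.ham (indices N d) monomial (low_strength v x) G z"
proof -
  have "summable (\<lambda>n. chaos_term N (n + d) \<omega> z)" using summable by (rule summable_ignore_initial_segment)
  then have "summable (\<lambda>n. chaos_term N (n + d) (x, G) z)" by (simp add: agree)
  then have s: "summable (\<lambda>n. chaos_term N n (x, G) z)"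
    using summable_iff_shift[of "\<lambda>n. chaos_term N n (x, G) z" d] by blast
  show ?thesis
    unfolding random_fun_eq suminf_split_initial_segment[OF s, of d] chaos_tail_def
    by (simp add: agree distrib_left sum_low_degrees[OF assms(1)])
qed

lemma chaos_term_resample:
  assumes "d \<le> n"
  shows "chaos_term N n (resample {1..d} {1..} x' x, resample (indices N d) (all_indices N) G' G) z = chaos_term N n (x, G) z"
proof -
  have "homogeneous_part N (Suc n) (resample (indices N d) (all_indices N) G' G) z = homogeneous_part N (Suc n) G z"
    unfolding homogeneous_part_eq
  proof (intro sum.cong refl)
    fix "is" assume "is \<in> multi_indices N (Suc n)"
    then have "is \<notin> indices N d" "is \<in> all_indices N" using assms by (auto simp: indices_def multi_indices_def)
    then show "resample (indices N d) (all_indices N) G' G is * monomial is z = G is * monomial is z"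
      unfolding resample_def by (simp only: restrict_apply if_True if_False)
  qed
  then show ?thesis using assms unfolding chaos_term_def by (simp add: resample_def)
qed

lemma low_ham_resample:
  assumes "gaussian_gibbs M (indices N d) monomial"
  shows "gaussian_gibbs.ham (indices N d) monomial (low_strength v (resample {1..d} {1..} x' x)) (resample (indices N d) (all_indices N) G' G)
    = gaussian_gibbs.ham (indices N d) monomial (low_strength v x') G'"
proof -
  interpret gaussian_gibbs M "indices N d" monomial by fact
  show ?thesis
    unfolding ham_def
  proof (intro ext sum.cong refl)
    fix z "is" assume i: "is \<in> indices N d"
    then have l: "length is \<in> {1..d}" and a: "is \<in> all_indices N" by (auto simp: indices_def multi_indices_def)
    have "resample (indices N d) (all_indices N) G' G is = G' is"
      unfolding resample_def using i a by (simp only: restrict_apply if_True)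
    moreover have "low_strength v (resample {1..d} {1..} x' x) is = low_strength v x' is"
      unfolding low_strength_def resample_def using l by simp
    ultimately show "low_strength v (resample {1..d} {1..} x' x) is * resample (indices N d) (all_indices N) G' G is * monomial is z
      = low_strength v x' is * G' is * monomial is z" by simp
  qed
qed

section \<open>Convergence of the series\<close>

context
  fixes N :: nat and \<nu> :: "(nat \<Rightarrow> real) measure"
  assumes prob_\<nu>: "prob_space \<nu>" and sets_\<nu>: "sets \<nu> = sets (unit_sphere N)"
begin

lemma prob_space_strengths: "prob_space strengths"
  by (intro prob_space_PiM prob_space_unit_uniform)

lemma prob_space_disorder: "prob_space (disorder N)"
proof -
  interpret x: prob_space strengths by (rule prob_space_strengths)
  interpret g: prob_space "gauss (all_indices N)" by (rule prob_space_gauss)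
  interpret pair_prob_space strengths "gauss (all_indices N)" ..
  show ?thesis unfolding disorder_eq by unfold_locales
qed

lemma space_\<nu>: "space \<nu> = space (unit_sphere N)"
  by (rule sets_eq_imp_space_eq[OF sets_\<nu>])

lemma measurable_strength: "(\<lambda>\<omega>. fst \<omega> (Suc n)) \<in> borel_measurable (disorder N)"
  unfolding disorder_eq
  using measurable_compose[OF measurable_fst measurable_component_singleton[of "Suc n" "{1..}" "\<lambda>_. unit_uniform"], of "gauss (all_indices N)"]
  unfolding measurable_unit_uniform by simp

lemma measurable_gaussian:
  assumes "is \<in> multi_indices N (Suc n)"
  shows "(\<lambda>\<omega>. snd \<omega> is) \<in> borel_measurable (disorder N)"
proof -
  have "is \<in> all_indices N" using assms by auto
  from measurable_compose[OF measurable_snd measurable_component_singleton[OF this, of "\<lambda>_. std_gauss"], of strengths]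
  show ?thesis unfolding disorder_eq by simp
qed

lemma measurable_chaos_term:
  "(\<lambda>x. chaos_term N n (fst x) (snd x)) \<in> borel_measurable (disorder N \<Otimes>\<^sub>M \<nu>)"
proof -
  have m: "monomial is \<in> borel_measurable \<nu>" if "is \<in> multi_indices N (Suc n)" for "is"
    using that measurable_monomial[of "is" N] measurable_cong_sets[OF sets_\<nu> refl]
    by (auto simp: multi_indices_def)
  show ?thesis
    unfolding chaos_term_def homogeneous_part_eq
    by (intro borel_measurable_times borel_measurable_sum borel_measurable_const
        measurable_compose[OF measurable_fst measurable_strength]
        measurable_compose[OF measurable_fst measurable_gaussian] measurable_compose[OF measurable_snd m])
qed

lemma measurable_random_fun:
  "(\<lambda>x. random_fun v N (fst x) (snd x)) \<in> borel_measurable (disorder N \<Otimes>\<^sub>M \<nu>)"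
  unfolding random_fun_eq
  by (intro borel_measurable_times borel_measurable_const borel_measurable_suminf measurable_chaos_term)

lemma measurable_chaos_tail:
  assumes "\<omega> \<in> space (disorder N)" shows "chaos_tail N d \<omega> \<in> borel_measurable \<nu>"
proof -
  have "(\<lambda>x. chaos_tail N d (fst x) (snd x)) \<in> borel_measurable (disorder N \<Otimes>\<^sub>M \<nu>)"
    unfolding chaos_tail_def by (intro borel_measurable_suminf measurable_chaos_term)
  from measurable_compose[OF measurable_Pair1'[OF assms] this] show ?thesis by simp
qed

lemma nn_integral_chaos_term:
  assumes z: "z \<in> space \<nu>"
  shows "(\<integral>\<^sup>+\<omega>. ennreal \<bar>chaos_term N n \<omega> z\<bar> \<partial>disorder N) \<le> ennreal ((1 / 2) ^ Suc n)"
proof -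
  interpret x: prob_space strengths by (rule prob_space_strengths)
  interpret g: prob_space "gauss (all_indices N)" by (rule prob_space_gauss)
  interpret u: prob_space unit_uniform by (rule prob_space_unit_uniform)
  have m: "(\<lambda>\<omega>. ennreal \<bar>chaos_term N n \<omega> z\<bar>) \<in> borel_measurable (strengths \<Otimes>\<^sub>M gauss (all_indices N))"
  proof -
    have "(\<lambda>\<omega>. (\<omega>, z)) \<in> measurable (disorder N) (disorder N \<Otimes>\<^sub>M \<nu>)" using z by measurable
    from measurable_compose[OF this measurable_chaos_term[of n]] show ?thesis unfolding disorder_eq by simp
  qed
  have hom: "(\<integral>\<^sup>+G. ennreal \<bar>homogeneous_part N (Suc n) G z\<bar> \<partial>gauss (all_indices N)) \<le> 1"
    unfolding homogeneous_part_eq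
    using z sum_monomial_squares[of z N "Suc n"]
    by (intro gauss_linear_abs_le finite_multi_indices) (auto simp: space_\<nu>)
  have mh: "(\<lambda>G. ennreal \<bar>homogeneous_part N (Suc n) G z\<bar>) \<in> borel_measurable (gauss (all_indices N))"
  proof -
    have "(\<lambda>G. G is) \<in> borel_measurable (gauss (all_indices N))" if "is \<in> multi_indices N (Suc n)" for "is"
    proof -
      have "is \<in> all_indices N" using that by auto
      from measurable_component_singleton[OF this, of "\<lambda>_. std_gauss"] show ?thesis by simp
    qed
    then have "(\<lambda>G. homogeneous_part N (Suc n) G z) \<in> borel_measurable (gauss (all_indices N))"
      unfolding homogeneous_part_eq by (intro borel_measurable_sum borel_measurable_times borel_measurable_const) auto
    then show ?thesis by measurable
  qed
  have comp: "(\<lambda>x. x (Suc n)) \<in> measurable strengths unit_uniform"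
    by (rule measurable_component_singleton) simp
  have strength: "(\<integral>\<^sup>+x. ennreal \<bar>x (Suc n)\<bar> \<partial>strengths) \<le> 1"
  proof -
    have "(\<integral>\<^sup>+x. ennreal \<bar>x (Suc n)\<bar> \<partial>strengths) = (\<integral>\<^sup>+t. ennreal \<bar>t\<bar> \<partial>distr strengths unit_uniform (\<lambda>x. x (Suc n)))"
      by (rule nn_integral_distr[OF comp, symmetric]) (simp add: borel_measurable_abs)
    also have "distr strengths unit_uniform (\<lambda>x. x (Suc n)) = unit_uniform"
      by (intro distr_PiM_component prob_space_unit_uniform) simp
    also have "(\<integral>\<^sup>+t. ennreal \<bar>t\<bar> \<partial>unit_uniform) = (\<integral>\<^sup>+t. ennreal \<bar>t\<bar> * indicator {0..1} t \<partial>lborel)"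
      by (rule nn_integral_unit_uniform) measurable
    also have "\<dots> \<le> (\<integral>\<^sup>+t. indicator {0..1::real} t \<partial>lborel)"
      by (intro nn_integral_mono) (auto split: split_indicator)
    also have "\<dots> = 1" by simp
    finally show ?thesis .
  qed
  have "(\<integral>\<^sup>+\<omega>. ennreal \<bar>chaos_term N n \<omega> z\<bar> \<partial>disorder N)
      = (\<integral>\<^sup>+x. (\<integral>\<^sup>+G. ennreal \<bar>chaos_term N n (x, G) z\<bar> \<partial>gauss (all_indices N)) \<partial>strengths)"
    unfolding disorder_eq by (rule g.nn_integral_fst[OF m, symmetric])
  also have "\<dots> \<le> (\<integral>\<^sup>+x. ennreal ((1 / 2) ^ Suc n) * ennreal \<bar>x (Suc n)\<bar> \<partial>strengths)"
  proof (rule nn_integral_mono)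
    fix x :: "nat \<Rightarrow> real"
    have "(\<integral>\<^sup>+G. ennreal \<bar>chaos_term N n (x, G) z\<bar> \<partial>gauss (all_indices N))
      = (\<integral>\<^sup>+G. (ennreal ((1 / 2) ^ Suc n) * ennreal \<bar>x (Suc n)\<bar>) * ennreal \<bar>homogeneous_part N (Suc n) G z\<bar> \<partial>gauss (all_indices N))"
    proof (rule nn_integral_cong)
      fix G
      have "\<bar>chaos_term N n (x, G) z\<bar> = ((1 / 2) ^ Suc n * \<bar>x (Suc n)\<bar>) * \<bar>homogeneous_part N (Suc n) G z\<bar>"
        by (simp add: chaos_term_def abs_mult)
      also have "ennreal \<dots> = ennreal ((1 / 2) ^ Suc n * \<bar>x (Suc n)\<bar>) * ennreal \<bar>homogeneous_part N (Suc n) G z\<bar>"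
        by (rule ennreal_mult) auto
      also have "ennreal ((1 / 2) ^ Suc n * \<bar>x (Suc n)\<bar>) = ennreal ((1 / 2) ^ Suc n) * ennreal \<bar>x (Suc n)\<bar>"
        by (rule ennreal_mult) auto
      finally show "ennreal \<bar>chaos_term N n (x, G) z\<bar> = (ennreal ((1 / 2) ^ Suc n) * ennreal \<bar>x (Suc n)\<bar>) * ennreal \<bar>homogeneous_part N (Suc n) G z\<bar>" .
    qed
    also have "\<dots> = (ennreal ((1 / 2) ^ Suc n) * ennreal \<bar>x (Suc n)\<bar>) * (\<integral>\<^sup>+G. ennreal \<bar>homogeneous_part N (Suc n) G z\<bar> \<partial>gauss (all_indices N))"
      by (rule nn_integral_cmult[OF mh])
    also have "\<dots> \<le> (ennreal ((1 / 2) ^ Suc n) * ennreal \<bar>x (Suc n)\<bar>) * 1"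
      by (intro mult_left_mono hom) simp
    finally show "(\<integral>\<^sup>+G. ennreal \<bar>chaos_term N n (x, G) z\<bar> \<partial>gauss (all_indices N)) \<le> ennreal ((1 / 2) ^ Suc n) * ennreal \<bar>x (Suc n)\<bar>"
      by (simp only: mult_1_right)
  qed
  also have "\<dots> = ennreal ((1 / 2) ^ Suc n) * (\<integral>\<^sup>+x. ennreal \<bar>x (Suc n)\<bar> \<partial>strengths)"
    using comp unfolding measurable_unit_uniform by (intro nn_integral_cmult) measurable
  also have "\<dots> \<le> ennreal ((1 / 2) ^ Suc n) * 1" by (intro mult_left_mono strength) simp
  finally show ?thesis by (simp only: mult_1_right)
qed

text \<open>
  For fixed \<open>z\<close> the expected absolute values of the terms decay geometrically, so their sum has finite
  expectation also with respect to \<open>\<nu>\<close>; exchanging the integrals gives convergence \<open>\<nu>\<close>-almost everywhere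
  for almost every disorder.
\<close>

lemma AE_summable: "AE \<omega> in disorder N. AE z in \<nu>. summable (\<lambda>n. chaos_term N n \<omega> z)"
proof -
  interpret \<nu>: prob_space \<nu> by (rule prob_\<nu>)
  interpret \<Omega>: prob_space "disorder N" by (rule prob_space_disorder)
  interpret P: pair_prob_space "disorder N" \<nu> ..
  define S where "S = (\<lambda>x. \<Sum>n. ennreal \<bar>chaos_term N n (fst x) (snd x)\<bar>)"
  have t: "(\<lambda>x. ennreal \<bar>chaos_term N n (fst x) (snd x)\<bar>) \<in> borel_measurable (disorder N \<Otimes>\<^sub>M \<nu>)" for n
    using measurable_chaos_term[of n] by measurable
  have Sm: "S \<in> borel_measurable (disorder N \<Otimes>\<^sub>M \<nu>)"
    unfolding S_def by (intro borel_measurable_suminf_order t)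
  have "(\<integral>\<^sup>+x. S x \<partial>(disorder N \<Otimes>\<^sub>M \<nu>)) = (\<Sum>n. \<integral>\<^sup>+x. ennreal \<bar>chaos_term N n (fst x) (snd x)\<bar> \<partial>(disorder N \<Otimes>\<^sub>M \<nu>))"
    unfolding S_def by (intro nn_integral_suminf t)
  also have "\<dots> \<le> (\<Sum>n. ennreal ((1 / 2) ^ Suc n))"
  proof (intro suminf_le)
    fix n
    have "(\<integral>\<^sup>+x. ennreal \<bar>chaos_term N n (fst x) (snd x)\<bar> \<partial>(disorder N \<Otimes>\<^sub>M \<nu>))
       = (\<integral>\<^sup>+z. (\<integral>\<^sup>+\<omega>. ennreal \<bar>chaos_term N n \<omega> z\<bar> \<partial>disorder N) \<partial>\<nu>)"
      using P.nn_integral_snd[OF t[of n]] by simp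
    also have "\<dots> \<le> (\<integral>\<^sup>+z. ennreal ((1 / 2) ^ Suc n) \<partial>\<nu>)"
      by (intro nn_integral_mono nn_integral_chaos_term)
    also have "\<dots> = ennreal ((1 / 2) ^ Suc n)" by (simp only: nn_integral_const \<nu>.emeasure_space_1 mult_1_right)
    finally show "(\<integral>\<^sup>+x. ennreal \<bar>chaos_term N n (fst x) (snd x)\<bar> \<partial>(disorder N \<Otimes>\<^sub>M \<nu>)) \<le> ennreal ((1 / 2) ^ Suc n)" .
  qed auto
  also have "\<dots> = ennreal 1"
    using power_half_series by (intro suminf_ennreal_eq) auto
  finally have "(\<integral>\<^sup>+x. S x \<partial>(disorder N \<Otimes>\<^sub>M \<nu>)) \<noteq> \<infinity>" by (auto simp: top_unique)
  from nn_integral_PInf_AE[OF Sm this] have "AE x in disorder N \<Otimes>\<^sub>M \<nu>. S x \<noteq> \<infinity>" .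
  then have "AE \<omega> in disorder N. AE z in \<nu>. S (\<omega>, z) \<noteq> \<infinity>" by (rule P.AE_pair)
  moreover have "summable (\<lambda>n. chaos_term N n \<omega> z)" if "S (\<omega>, z) \<noteq> \<infinity>" for \<omega> z
  proof -
    have "summable (\<lambda>n. \<bar>chaos_term N n \<omega> z\<bar>)"
      using that unfolding S_def by (intro summable_suminf_not_top) auto
    then show ?thesis by (rule summable_rabs_cancel)
  qed
  ultimately show ?thesis by (auto elim!: eventually_mono)
qed

section \<open>Conditioning on the high degrees\<close>

text \<open>
  Rewriting the measure of \<open>A\<close> as an integral of densities against \<open>\<nu> \<Otimes>\<^sub>M \<nu>\<close> moves the dependence on
  \<open>\<omega>\<close> from the measure into a jointly measurable integrand.
\<close>

lemma measurable_tilted_pair: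
  assumes A: "A \<in> sets (\<nu> \<Otimes>\<^sub>M \<nu>)"
  shows "(\<lambda>\<omega>. emeasure (tilted_measure \<nu> (random_fun v N \<omega>) \<Otimes>\<^sub>M tilted_measure \<nu> (random_fun v N \<omega>)) A)
    \<in> borel_measurable (disorder N)"
proof -
  interpret \<nu>: prob_space \<nu> by (rule prob_\<nu>)
  interpret P: pair_prob_space \<nu> \<nu> ..
  define D where "D = (\<lambda>\<omega> z. ennreal (exp (random_fun v N \<omega> z) / (\<integral>z'. exp (random_fun v N \<omega> z') \<partial>\<nu>)))"
  have e: "(\<lambda>x. exp (random_fun v N (fst x) (snd x))) \<in> borel_measurable (disorder N \<Otimes>\<^sub>M \<nu>)"
    using measurable_random_fun by measurable
  have Z: "(\<lambda>\<omega>. \<integral>z. exp (random_fun v N \<omega> z) \<partial>\<nu>) \<in> borel_measurable (disorder N)"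
    using e by (intro \<nu>.borel_measurable_lebesgue_integral) (simp add: case_prod_beta)
  have D: "(\<lambda>x. D (fst x) (snd x)) \<in> borel_measurable (disorder N \<Otimes>\<^sub>M \<nu>)"
    unfolding D_def by (intro measurable_compose[OF _ measurable_ennreal] borel_measurable_divide e measurable_compose[OF measurable_fst Z])
  have eq: "emeasure (tilted_measure \<nu> (random_fun v N \<omega>) \<Otimes>\<^sub>M tilted_measure \<nu> (random_fun v N \<omega>)) A
     = (\<integral>\<^sup>+x. D \<omega> (fst x) * D \<omega> (snd x) * indicator A x \<partial>(\<nu> \<Otimes>\<^sub>M \<nu>))" if \<omega>: "\<omega> \<in> space (disorder N)" for \<omega>
  proof -
    have D\<omega>: "D \<omega> \<in> borel_measurable \<nu>"
      using measurable_compose[OF measurable_Pair1'[OF \<omega>, of \<nu>] D] by simp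
    have sf: "sigma_finite_measure (density \<nu> (D \<omega>))"
      using \<nu>.sigma_finite_iff_density_finite[OF D\<omega>] by (simp add: D_def)
    have t: "tilted_measure \<nu> (random_fun v N \<omega>) = density \<nu> (D \<omega>)"
      by (simp add: tilted_measure_def D_def)
    have m: "(\<lambda>(x, y). D \<omega> x * D \<omega> y) \<in> borel_measurable (\<nu> \<Otimes>\<^sub>M \<nu>)" using D\<omega> by measurable
    show ?thesis
      unfolding t pair_measure_density[OF D\<omega> D\<omega> \<nu>.sigma_finite_measure_axioms sf] emeasure_density[OF m A]
      by (simp add: case_prod_beta)
  qed
  have "(\<lambda>\<omega>. \<integral>\<^sup>+x. D \<omega> (fst x) * D \<omega> (snd x) * indicator A x \<partial>(\<nu> \<Otimes>\<^sub>M \<nu>)) \<in> borel_measurable (disorder N)"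
  proof (rule P.P.borel_measurable_nn_integral)
    have 1: "(\<lambda>p. (fst p, fst (snd p))) \<in> measurable (disorder N \<Otimes>\<^sub>M (\<nu> \<Otimes>\<^sub>M \<nu>)) (disorder N \<Otimes>\<^sub>M \<nu>)"
      "(\<lambda>p. (fst p, snd (snd p))) \<in> measurable (disorder N \<Otimes>\<^sub>M (\<nu> \<Otimes>\<^sub>M \<nu>)) (disorder N \<Otimes>\<^sub>M \<nu>)"
      by measurable
    have 2: "(\<lambda>p. indicator A (snd p) :: ennreal) \<in> borel_measurable (disorder N \<Otimes>\<^sub>M (\<nu> \<Otimes>\<^sub>M \<nu>))"
      using A by measurable
    show "(\<lambda>(\<omega>, x). D \<omega> (fst x) * D \<omega> (snd x) * indicator A x) \<in> borel_measurable (disorder N \<Otimes>\<^sub>M (\<nu> \<Otimes>\<^sub>M \<nu>))"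
      using measurable_compose[OF 1(1) D] measurable_compose[OF 1(2) D] 2
      by (simp add: case_prod_beta borel_measurable_times_ennreal)
  qed
  then show ?thesis by (simp add: eq cong: measurable_cong)
qed

text \<open>
  Fubini's theorem in the form needed for conditioning: the outer integrals fix the high degrees, the inner
  ones average over the variables of degree at most \<open>d\<close>.
\<close>

lemma nn_integral_disorder_resample:
  assumes F: "F \<in> borel_measurable (disorder N)"
  shows "(\<integral>\<^sup>+\<omega>. F \<omega> \<partial>disorder N)
    = (\<integral>\<^sup>+x. (\<integral>\<^sup>+G. (\<integral>\<^sup>+x'. (\<integral>\<^sup>+G'.
        F (resample {1..d} {1..} x' x, resample (indices N d) (all_indices N) G' G)
      \<partial>gauss (indices N d)) \<partial>PiM {1..d} (\<lambda>_. unit_uniform)) \<partial>gauss (all_indices N)) \<partial>strengths)"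
proof -
  let ?J = "all_indices N" and ?I = "indices N d"
  let ?U = "PiM {1..d} (\<lambda>_. unit_uniform)"
  interpret x: prob_space strengths by (rule prob_space_strengths)
  interpret u: prob_space ?U by (intro prob_space_PiM prob_space_unit_uniform)
  interpret g: prob_space "gauss ?J" by (rule prob_space_gauss)
  interpret gI: prob_space "gauss ?I" by (rule prob_space_gauss)
  interpret ug: pair_prob_space ?U "gauss ?J" ..
  have IJ: "?I \<subseteq> ?J" by (auto simp: indices_def)
  have F': "F \<in> borel_measurable (strengths \<Otimes>\<^sub>M gauss ?J)" using F unfolding disorder_eq .
  have Fx: "(\<lambda>G. F (x, G)) \<in> borel_measurable (gauss ?J)" if "x \<in> space strengths" for x
    using measurable_compose[OF measurable_Pair1'[OF that] F'] by simp
  have r1: "(\<lambda>p. resample {1..d} {1..} (fst p) (snd p)) \<in> measurable (?U \<Otimes>\<^sub>M strengths) strengths"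
    by (rule measurable_resample) auto
  have r2: "(\<lambda>p. resample ?I ?J (fst p) (snd p)) \<in> measurable (gauss ?I \<Otimes>\<^sub>M gauss ?J) (gauss ?J)"
    by (rule measurable_resample[OF IJ])
  have "(\<integral>\<^sup>+\<omega>. F \<omega> \<partial>disorder N) = (\<integral>\<^sup>+x. (\<integral>\<^sup>+G. F (x, G) \<partial>gauss ?J) \<partial>strengths)"
    unfolding disorder_eq by (rule g.nn_integral_fst[OF F', symmetric])
  also have "\<dots> = (\<integral>\<^sup>+x. (\<integral>\<^sup>+x'. (\<integral>\<^sup>+G. F (resample {1..d} {1..} x' x, G) \<partial>gauss ?J) \<partial>?U) \<partial>strengths)"
    by (rule nn_integral_resample[OF prob_space_unit_uniform _ g.borel_measurable_nn_integral_fst[OF F']]) auto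
  also have "\<dots> = (\<integral>\<^sup>+x. (\<integral>\<^sup>+x'. (\<integral>\<^sup>+G. (\<integral>\<^sup>+G'. F (resample {1..d} {1..} x' x, resample ?I ?J G' G) \<partial>gauss ?I) \<partial>gauss ?J) \<partial>?U) \<partial>strengths)"
  proof (rule nn_integral_cong, rule nn_integral_cong)
    fix x x' assume "x \<in> space strengths" "x' \<in> space ?U"
    then have "(x', x) \<in> space (?U \<Otimes>\<^sub>M strengths)" by (simp add: space_pair_measure)
    from measurable_space[OF r1 this] have "resample {1..d} {1..} x' x \<in> space strengths" by simp
    from nn_integral_resample[OF prob_space_std_gauss IJ Fx[OF this]]
    show "(\<integral>\<^sup>+G. F (resample {1..d} {1..} x' x, G) \<partial>gauss ?J)
      = (\<integral>\<^sup>+G. (\<integral>\<^sup>+G'. F (resample {1..d} {1..} x' x, resample ?I ?J G' G) \<partial>gauss ?I) \<partial>gauss ?J)" .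
  qed
  also have "\<dots> = (\<integral>\<^sup>+x. (\<integral>\<^sup>+G. (\<integral>\<^sup>+x'. (\<integral>\<^sup>+G'. F (resample {1..d} {1..} x' x, resample ?I ?J G' G) \<partial>gauss ?I) \<partial>?U) \<partial>gauss ?J) \<partial>strengths)"
  proof (intro nn_integral_cong ug.Fubini'[symmetric])
    fix x assume x: "x \<in> space strengths"
    have 1: "(\<lambda>p. (fst (fst p), x)) \<in> measurable ((?U \<Otimes>\<^sub>M gauss ?J) \<Otimes>\<^sub>M gauss ?I) (?U \<Otimes>\<^sub>M strengths)"
      using x by measurable
    have 2: "(\<lambda>p. (snd p, snd (fst p))) \<in> measurable ((?U \<Otimes>\<^sub>M gauss ?J) \<Otimes>\<^sub>M gauss ?I) (gauss ?I \<Otimes>\<^sub>M gauss ?J)"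
      by measurable
    have "(\<lambda>p. (resample {1..d} {1..} (fst (fst p)) x, resample ?I ?J (snd p) (snd (fst p))))
        \<in> measurable ((?U \<Otimes>\<^sub>M gauss ?J) \<Otimes>\<^sub>M gauss ?I) (strengths \<Otimes>\<^sub>M gauss ?J)"
      using measurable_compose[OF 1 r1] measurable_compose[OF 2 r2] by (intro measurable_Pair) simp_all
    from measurable_compose[OF this F']
    have "(\<lambda>p. \<integral>\<^sup>+G'. F (resample {1..d} {1..} (fst p) x, resample ?I ?J G' (snd p)) \<partial>gauss ?I) \<in> borel_measurable (?U \<Otimes>\<^sub>M gauss ?J)"
      by (intro gI.borel_measurable_nn_integral) (simp add: case_prod_beta)
    then show "(\<lambda>(x', G). \<integral>\<^sup>+G'. F (resample {1..d} {1..} x' x, resample ?I ?J G' G) \<partial>gauss ?I) \<in> borel_measurable (?U \<Otimes>\<^sub>M gauss ?J)"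
      by (simp add: case_prod_beta)
  qed
  finally show ?thesis .
qed

text \<open>
  For almost every choice of the variables of high degree, the tilt by the tail of the series is a
  probability measure \<open>M\<close> on the sphere, and tilting it further by the low degrees gives the Gibbs measure
  of the finite model over \<open>M\<close>. The hypothesis \<open>bound\<close> holds for all \<open>M\<close>, hence for this random one.
\<close>

lemma annealed_reduction:
  fixes \<epsilon> v :: real and d :: nat
  assumes fin: "AE \<omega> in disorder N. (\<integral>\<^sup>+ z. ennreal (exp (random_fun v N \<omega> z)) \<partial>\<nu>) < \<infinity>"
    and bound: "\<And>M. prob_space M \<Longrightarrow> sets M = sets (unit_sphere N) \<Longrightarrow>
      (\<integral>\<^sup>+x. (\<integral>\<^sup>+G. ennreal (gaussian_overlap.overlap_mean M (indices N d) monomial (scalar_prod N)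
          (low_strength v x) G (indicator {..- \<epsilon>})) \<partial>gauss (indices N d))
        \<partial>PiM {1..d} (\<lambda>_. unit_uniform)) \<le> ennreal \<epsilon>"
  shows "(\<integral>\<^sup>+ \<omega>. emeasure
        (tilted_measure \<nu> (random_fun v N \<omega>) \<Otimes>\<^sub>M tilted_measure \<nu> (random_fun v N \<omega>))
        {(z1, z2) \<in> space \<nu> \<times> space \<nu>. scalar_prod N z1 z2 \<le> - \<epsilon>}
      \<partial>disorder N) \<le> ennreal \<epsilon>"
proof -
  let ?J = "all_indices N" and ?I = "indices N d"
  let ?U = "PiM {1..d} (\<lambda>_. unit_uniform)"
  let ?A = "{(z1, z2) \<in> space \<nu> \<times> space \<nu>. scalar_prod N z1 z2 \<le> - \<epsilon>}"
  interpret \<nu>: prob_space \<nu> by (rule prob_\<nu>)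
  interpret x: prob_space strengths by (rule prob_space_strengths)
  interpret g: prob_space "gauss ?J" by (rule prob_space_gauss)
  interpret xg: pair_prob_space strengths "gauss ?J" ..
  interpret S: mixed_p_spin \<nu> ?I monomial "scalar_prod N" length d
    by (rule sphere_mixed_p_spin[OF prob_\<nu> sets_\<nu>])
  note gg = S.gaussian_gibbs_axioms
  have A: "?A \<in> sets (\<nu> \<Otimes>\<^sub>M \<nu>)"
  proof -
    have "?A = {x \<in> space (\<nu> \<Otimes>\<^sub>M \<nu>). scalar_prod N (fst x) (snd x) \<le> - \<epsilon>}" by (auto simp: space_pair_measure)
    also have "\<dots> \<in> sets (\<nu> \<Otimes>\<^sub>M \<nu>)" using S.R_measurable by measurable
    finally show ?thesis .
  qed
  define \<Phi> where "\<Phi> = (\<lambda>\<omega>. emeasure (tilted_measure \<nu> (random_fun v N \<omega>) \<Otimes>\<^sub>M tilted_measure \<nu> (random_fun v N \<omega>)) ?A)"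
  have \<Phi>: "\<Phi> \<in> borel_measurable (disorder N)" unfolding \<Phi>_def by (rule measurable_tilted_pair[OF A])
  have rfm: "random_fun v N \<omega> \<in> borel_measurable \<nu>" if "\<omega> \<in> space (disorder N)" for \<omega>
    using measurable_compose[OF measurable_Pair1'[OF that] measurable_random_fun[of v]] by simp
  define good where "good = (\<lambda>\<omega>. \<omega> \<in> space (disorder N) \<and> (AE z in \<nu>. summable (\<lambda>n. chaos_term N n \<omega> z))
      \<and> integrable \<nu> (\<lambda>z. exp (v * chaos_tail N d \<omega> z)))"
  have AE_good: "AE \<omega> in disorder N. good \<omega>"
    using AE_summable fin AE_space
  proof eventually_elim
    case (elim \<omega>)
    then obtain x G where \<omega>: "\<omega> = (x, G)" by (cases \<omega>)
    let ?h = "S.ham (low_strength v x) G"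
    have tm: "chaos_tail N d \<omega> \<in> borel_measurable \<nu>" using elim by (intro measurable_chaos_tail)
    obtain B where B: "\<And>z. z \<in> space \<nu> \<Longrightarrow> \<bar>?h z\<bar> \<le> B"
      using S.bounded_measurable_ham[of "low_strength v x" G] by (metis bounded_measurableE)
    have hm: "?h \<in> borel_measurable \<nu>" using S.bounded_measurable_ham by (rule bounded_measurableD)
    have split: "AE z in \<nu>. random_fun v N \<omega> z = v * chaos_tail N d \<omega> z + ?h z"
      using elim(1) unfolding \<omega>
      by eventually_elim (rule random_fun_split[OF gg], auto)
    have ir: "integrable \<nu> (\<lambda>z. exp (random_fun v N \<omega> z))"
      using elim rfm[of \<omega>] by (intro integrableI_nonneg) auto
    \<comment> \<open>For fixed disorder the low-degree part is bounded on the sphere, so the tail inherits exponential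
       integrability from the full series.\<close>
    have "integrable \<nu> (\<lambda>z. exp (v * chaos_tail N d \<omega> z))"
    proof (rule Bochner_Integration.integrable_bound)
      show "integrable \<nu> (\<lambda>z. exp B * exp (random_fun v N \<omega> z))" using ir by simp
      show "(\<lambda>z. exp (v * chaos_tail N d \<omega> z)) \<in> borel_measurable \<nu>" using tm by measurable
      show "AE z in \<nu>. norm (exp (v * chaos_tail N d \<omega> z)) \<le> norm (exp B * exp (random_fun v N \<omega> z))"
        using split AE_space
      proof eventually_elim
        case (elim z)
        have "v * chaos_tail N d \<omega> z \<le> B + random_fun v N \<omega> z" using B[OF elim(2)] unfolding elim(1) by linarith
        then show ?case by (simp add: exp_add[symmetric])
      qed
    qed
    then show ?case using elim unfolding good_def by auto
  qed
  have inner: "(\<integral>\<^sup>+x'. (\<integral>\<^sup>+G'. \<Phi> (resample {1..d} {1..} x' x, resample ?I ?J G' G) \<partial>gauss ?I) \<partial>?U) \<le> ennreal \<epsilon>"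
    if good: "good (x, G)" for x G
  proof -
    have \<omega>: "(x, G) \<in> space (disorder N)" and summ: "AE z in \<nu>. summable (\<lambda>n. chaos_term N n (x, G) z)"
      and int: "integrable \<nu> (\<lambda>z. exp (v * chaos_tail N d (x, G) z))"
      using good unfolding good_def by auto
    define t where "t = (\<lambda>z. v * chaos_tail N d (x, G) z)"
    have tm: "t \<in> borel_measurable \<nu>" unfolding t_def using measurable_chaos_tail[OF \<omega>, of d] by measurable
    define M where "M = tilted_measure \<nu> t"
    have M: "prob_space M" unfolding M_def using tm int unfolding t_def by (rule \<nu>.prob_space_tilted)
    have sM: "sets M = sets (unit_sphere N)" by (simp add: M_def sets_\<nu>)
    interpret T: mixed_p_spin M ?I monomial "scalar_prod N" length d
      by (rule sphere_mixed_p_spin[OF M sM])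
    have "\<Phi> (resample {1..d} {1..} x' x, resample ?I ?J G' G) = ennreal (T.overlap_mean (low_strength v x') G' (indicator {..- \<epsilon>}))"
      if x': "x' \<in> space ?U" and G': "G' \<in> space (gauss ?I)" for x' G'
    proof -
      let ?\<omega> = "(resample {1..d} {1..} x' x, resample ?I ?J G' G)"
      have \<omega>': "?\<omega> \<in> space (disorder N)"
      proof -
        have xG: "x \<in> space strengths" "G \<in> space (gauss ?J)" using \<omega> by (auto simp: disorder_eq space_pair_measure)
        have "?I \<subseteq> ?J" by (auto simp: indices_def)
        from measurable_space[OF measurable_resample[OF this, of "\<lambda>_. std_gauss"], of "(G', G)"] G' xG
        have 1: "resample ?I ?J G' G \<in> space (gauss ?J)" by (simp add: space_pair_measure)
        have "{1..d} \<subseteq> {1::nat..}" by auto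
        from measurable_space[OF measurable_resample[OF this, of "\<lambda>_. unit_uniform"], of "(x', x)"] x' xG
        have 2: "resample {1..d} {1..} x' x \<in> space strengths" by (simp add: space_pair_measure)
        show ?thesis unfolding disorder_eq using 1 2 by (simp add: space_pair_measure)
      qed
      have hm: "S.ham (low_strength v x') G' \<in> borel_measurable \<nu>"
        using S.bounded_measurable_ham by (rule bounded_measurableD)
      have "tilted_measure \<nu> (random_fun v N ?\<omega>) = tilted_measure \<nu> (\<lambda>z. t z + S.ham (low_strength v x') G' z)"
      proof (rule tilted_cong_AE)
        show "random_fun v N ?\<omega> \<in> borel_measurable \<nu>" by (rule rfm[OF \<omega>'])
        show "(\<lambda>z. t z + S.ham (low_strength v x') G' z) \<in> borel_measurable \<nu>"
          using tm hm by measurable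
        show "AE z in \<nu>. random_fun v N ?\<omega> z = t z + S.ham (low_strength v x') G' z"
          using summ
        proof eventually_elim
          case (elim z)
          from random_fun_split[where v=v and x="resample {1..d} {1..} x' x" and G="resample ?I ?J G' G",
              OF gg elim chaos_term_resample]
          show ?case unfolding t_def low_ham_resample[OF gg] .
        qed
      qed
      also have "\<dots> = tilted_measure M (S.ham (low_strength v x') G')"
        unfolding M_def using int hm tm by (intro \<nu>.tilted_tilted[symmetric]) (auto simp: t_def)
      also have "\<dots> = T.gibbs (low_strength v x') G'"
        unfolding T.gibbs_def T.ham_def[abs_def] S.ham_def[abs_def] ..
      finally have "\<Phi> ?\<omega> = emeasure (T.gibbs (low_strength v x') G' \<Otimes>\<^sub>M T.gibbs (low_strength v x') G') ?A"
        unfolding \<Phi>_def by simp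
      also have "space \<nu> = space M" by (simp add: M_def)
      finally show ?thesis unfolding T.emeasure_gibbs_pair .
    qed
    then have "(\<integral>\<^sup>+x'. (\<integral>\<^sup>+G'. \<Phi> (resample {1..d} {1..} x' x, resample ?I ?J G' G) \<partial>gauss ?I) \<partial>?U)
      = (\<integral>\<^sup>+x'. (\<integral>\<^sup>+G'. ennreal (T.overlap_mean (low_strength v x') G' (indicator {..- \<epsilon>})) \<partial>gauss ?I) \<partial>?U)"
      by (intro nn_integral_cong) auto
    also have "\<dots> \<le> ennreal \<epsilon>" by (rule bound[OF M sM])
    finally show ?thesis .
  qed
  have "AE x in strengths. AE G in gauss ?J. good (x, G)"
    using AE_good unfolding disorder_eq by (rule xg.AE_pair)
  then have ae: "AE x in strengths. (\<integral>\<^sup>+G. (\<integral>\<^sup>+x'. (\<integral>\<^sup>+G'. \<Phi> (resample {1..d} {1..} x' x, resample ?I ?J G' G) \<partial>gauss ?I) \<partial>?U) \<partial>gauss ?J) \<le> ennreal \<epsilon>"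
  proof eventually_elim
    case (elim x)
    have "(\<integral>\<^sup>+G. (\<integral>\<^sup>+x'. (\<integral>\<^sup>+G'. \<Phi> (resample {1..d} {1..} x' x, resample ?I ?J G' G) \<partial>gauss ?I) \<partial>?U) \<partial>gauss ?J)
      \<le> (\<integral>\<^sup>+G. ennreal \<epsilon> \<partial>gauss ?J)"
    proof (rule nn_integral_mono_AE)
      show "AE G in gauss ?J. (\<integral>\<^sup>+x'. (\<integral>\<^sup>+G'. \<Phi> (resample {1..d} {1..} x' x, resample ?I ?J G' G) \<partial>gauss ?I) \<partial>?U) \<le> ennreal \<epsilon>"
        using elim by (rule eventually_mono) (rule inner)
    qed
    then show ?case by (simp only: nn_integral_const g.emeasure_space_1 mult_1_right)
  qed
  have "(\<integral>\<^sup>+\<omega>. \<Phi> \<omega> \<partial>disorder N) \<le> (\<integral>\<^sup>+x. ennreal \<epsilon> \<partial>strengths)"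
    unfolding nn_integral_disorder_resample[OF \<Phi>, of d] by (rule nn_integral_mono_AE[OF ae])
  then show ?thesis unfolding \<Phi>_def by (simp only: nn_integral_const x.emeasure_space_1 mult_1_right)
qed

end

theorem theorem1:
  fixes \<epsilon> :: real
  assumes "\<epsilon> > 0"
  shows "\<exists>v\<ge>1. \<forall>N\<ge>1. \<forall>\<nu> :: (nat \<Rightarrow> real) measure.
    prob_space \<nu> \<longrightarrow> sets \<nu> = sets (unit_sphere N) \<longrightarrow>
    (AE \<omega> in disorder N. (\<integral>\<^sup>+ z. ennreal (exp (random_fun v N \<omega> z)) \<partial>\<nu>) < \<infinity>) \<longrightarrow>
    (\<integral>\<^sup>+ \<omega>. emeasure
        (tilted_measure \<nu> (random_fun v N \<omega>) \<Otimes>\<^sub>M tilted_measure \<nu> (random_fun v N \<omega>))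
        {(z1, z2) \<in> space \<nu> \<times> space \<nu>. scalar_prod N z1 z2 \<le> - \<epsilon>}
      \<partial>disorder N) \<le> ennreal \<epsilon>"
proof -
  \<comment> \<open>Overlaps are at least -1, and the statement for \<open>\<epsilon> = 1\<close> implies it for larger \<open>\<epsilon>\<close>.\<close>
  define \<epsilon>' where "\<epsilon>' = min \<epsilon> 1"
  have \<epsilon>': "0 < \<epsilon>'" "\<epsilon>' \<le> 1" "\<epsilon>' \<le> \<epsilon>" using assms by (auto simp: \<epsilon>'_def)
  show ?thesis
  proof (rule finite_disorder_bound[OF \<epsilon>'(1,2), where ?'a = "nat \<Rightarrow> real" and ?'i = "nat list"])
    fix v :: real and d :: nat
    assume v: "1 \<le> v" and
      bound: "\<And>(M :: (nat \<Rightarrow> real) measure) (I :: nat list set) e R deg. mixed_p_spin M I e R deg d \<Longrightarrow>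
        (\<integral>\<^sup>+x. (\<integral>\<^sup>+G. ennreal (gaussian_overlap.overlap_mean M I e R
            (\<lambda>i. v * (1 / 2) ^ deg i * x (deg i)) G (indicator {..- \<epsilon>'})) \<partial>gauss I)
          \<partial>PiM {1..d} (\<lambda>_. unit_uniform)) \<le> ennreal \<epsilon>'"
    have "(\<integral>\<^sup>+ \<omega>. emeasure
          (tilted_measure \<nu> (random_fun v N \<omega>) \<Otimes>\<^sub>M tilted_measure \<nu> (random_fun v N \<omega>))
          {(z1, z2) \<in> space \<nu> \<times> space \<nu>. scalar_prod N z1 z2 \<le> - \<epsilon>}
        \<partial>disorder N) \<le> ennreal \<epsilon>"
      if \<nu>: "prob_space \<nu>" "sets \<nu> = sets (unit_sphere N)"
        "AE \<omega> in disorder N. (\<integral>\<^sup>+ z. ennreal (exp (random_fun v N \<omega> z)) \<partial>\<nu>) < \<infinity>"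
      for N and \<nu> :: "(nat \<Rightarrow> real) measure"
    proof -
      let ?A = "\<lambda>\<epsilon>. {(z1, z2) \<in> space \<nu> \<times> space \<nu>. scalar_prod N z1 z2 \<le> - \<epsilon>}"
      let ?T = "\<lambda>\<omega>. tilted_measure \<nu> (random_fun v N \<omega>) \<Otimes>\<^sub>M tilted_measure \<nu> (random_fun v N \<omega>)"
      interpret S: mixed_p_spin \<nu> "indices N d" monomial "scalar_prod N" length d
        by (rule sphere_mixed_p_spin[OF \<nu>(1,2)])
      have A: "?A \<epsilon>' \<in> sets (?T \<omega>)" for \<omega>
      proof -
        have s: "sets (?T \<omega>) = sets (\<nu> \<Otimes>\<^sub>M \<nu>)" by (intro sets_pair_measure_cong) auto
        have "?A \<epsilon>' = {x \<in> space (\<nu> \<Otimes>\<^sub>M \<nu>). scalar_prod N (fst x) (snd x) \<le> - \<epsilon>'}" by (auto simp: space_pair_measure)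
        also have "\<dots> \<in> sets (\<nu> \<Otimes>\<^sub>M \<nu>)" using S.R_measurable by measurable
        finally show ?thesis unfolding s .
      qed
      have "(\<integral>\<^sup>+ \<omega>. emeasure (?T \<omega>) (?A \<epsilon>) \<partial>disorder N) \<le> (\<integral>\<^sup>+ \<omega>. emeasure (?T \<omega>) (?A \<epsilon>') \<partial>disorder N)"
        using \<epsilon>' by (intro nn_integral_mono emeasure_mono A) auto
      also have "\<dots> \<le> ennreal \<epsilon>'"
      proof (rule annealed_reduction[OF \<nu>])
        fix M :: "(nat \<Rightarrow> real) measure"
        assume "prob_space M" "sets M = sets (unit_sphere N)"
        from bound[OF sphere_mixed_p_spin[OF this]]
        show "(\<integral>\<^sup>+x. (\<integral>\<^sup>+G. ennreal (gaussian_overlap.overlap_mean M (indices N d) monomial (scalar_prod N)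
            (low_strength v x) G (indicator {..- \<epsilon>'})) \<partial>gauss (indices N d))
          \<partial>PiM {1..d} (\<lambda>_. unit_uniform)) \<le> ennreal \<epsilon>'"
          unfolding low_strength_def[abs_def] .
      qed
      also have "\<dots> \<le> ennreal \<epsilon>" using \<epsilon>' by (intro ennreal_leI)
      finally show ?thesis .
    qed
    with v show ?thesis by blast
  qed
qed

end
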